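(* Assume (A1), (C1), (C2), and let $\{h_n\}_{n\ge1}$ be any kernel bandwidth sequence satisfying assumption (B). Then, with probability $1$, the volume $V(F_n^{PI})$ of the region in $\mathcal X$ misclassified by the plug-in classifier $F_n^{PI}$ satisfies $$V\big(F_n^{PI}\big)\le\frac{2}{n^2}\sum_{l,m=1}^n\theta_{lm}\,V_{lm,h_n}+\mathcal O(h_n^{\gamma}),$$ where $\theta_{lm}=\mathbf 1_{\{Y_l\neq Y_m\}}$ and $$V_{lm,h_n}=V_{h_n}(X_l,X_m),\qquad V_h(x,y)=\frac{K_h(x-y)}{\hat f_{n,h}(x)\,\hat f_{n,h}(y)} .$$
   Context: Setting: $(X,Y)$ is a random couple with $X\in\mathcal X\subset[-M_0,M_0]^d\subset\mathbb R^d$ and $Y\in\{1,\dots,Q\}$; $(X_1,Y_1),(X_2,Y_2),\dots$ are i.i.d. copies of $(X,Y)$. $f$ is the density of $X$, $\eta^{(i)}(x)=P[Y=i\mid X=x]$, $\pi^{(i)}=P[Y=i]$ and $f^{(i)}$ is the class-conditional density of class $i$, so $f=\sum_i\pi^{(i)}f^{(i)}$; all these functions are measurable. Kernel: $K(x)=(2\pi)^{-d/2}e^{-\|x\|^2/2}$, $K_h(x)=h^{-d}K(x/h)$. Kernel density estimator: $\hat f_{n,h}(x)=\frac1n\sum_{l=1}^nK_h(x-X_l)$. Plug-in classifier: $F_n^{PI}(x)=\arg\max_{1\le i\le Q}\hat\eta_n^{(i)}(x)$ with $\hat\eta_n^{(i)}(x)=\dfrac{\sum_{l=1}^nK_{h_n}(x-X_l)\mathbf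 1_{\{Y_l=i\}}}{n\hat f_{n,h_n}(x)}$. Misclassified volume: for fixed training data, $V(F_n^{PI})$ is the misclassification error with the data distribution replaced by Lebesgue measure on $\mathcal X$, i.e. $V(F_n^{PI})=\sum_{i\neq j}\int_{\mathcal X}\eta^{(i)}(x)\mathbf 1_{\{F_n^{PI}(x)=j\}}\,dx$. Assumptions: (A1) $0<f_{\min}\le f\le f_{\max}$. (C1) $0<f^{(i)}_{\min}\le f^{(i)}\le f^{(i)}_{\max}$ for $1\le i\le Q$. (C2) There are $\gamma>0$ and constants $c_i$ with $|f^{(i)}(x)-f^{(i)}(y)|\le c_i\|x-y\|^\gamma$ for all $x,y$ and $1\le i\le Q$. (B) $h_n\searrow0$; $\frac{-\log h_n}{nh_n^{d+2\gamma}}\to0$; $\frac{-\log h_n}{\log\log n}\to\infty$; and $h_n^d<a\,h_{2n}^d$ for some $a>0$. $\mathcal O(h_n^\gamma)$ denotes a term bounded by a constant multiple of $h_n^\gamma$ for all sufficiently large $n$. *)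

theory Defs
  imports "HOL-Probability.Probability"
begin

definition gauss_kernel :: "real ^ 'd \<Rightarrow> real" where
  "gauss_kernel x = (2 * pi) powr (- (real CARD('d) / 2)) * exp (- (norm x)\<^sup>2 / 2)"

definition scaled_kernel :: "real \<Rightarrow> real ^ 'd \<Rightarrow> real" where
  "scaled_kernel h x = gauss_kernel (x /\<^sub>R h) / h ^ CARD('d)"

text \<open>
  Below, \<open>xs\<close> and \<open>ys\<close> are the realised training data;
  observations are numbered from 1, so the entries at index 0 are never used.
\<close>

definition kde :: "(nat \<Rightarrow> real ^ 'd) \<Rightarrow> nat \<Rightarrow> real \<Rightarrow> real ^ 'd \<Rightarrow> real" where
  "kde xs n h x = (1 / real n) * (\<Sum>l=1..n. scaled_kernel h (x - xs l))"

definition eta_hat ::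
  "(nat \<Rightarrow> real ^ 'd) \<Rightarrow> (nat \<Rightarrow> nat) \<Rightarrow> nat \<Rightarrow> real \<Rightarrow> nat \<Rightarrow> real ^ 'd \<Rightarrow> real" where
  "eta_hat xs ys n h i x =
     (\<Sum>l=1..n. scaled_kernel h (x - xs l) * of_bool (ys l = i)) / (real n * kde xs n h x)"

text \<open>
  Ties in the arg max may be broken in any way that keeps the classifier measurable.
\<close>

definition plugin_classifier ::
  "nat \<Rightarrow> (nat \<Rightarrow> real ^ 'd) \<Rightarrow> (nat \<Rightarrow> nat) \<Rightarrow> nat \<Rightarrow> real \<Rightarrow> (real ^ 'd \<Rightarrow> nat) \<Rightarrow> bool" where
  "plugin_classifier Q xs ys n h F \<longleftrightarrow>
     F \<in> borel \<rightarrow>\<^sub>M count_space UNIV \<and>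
     (\<forall>x. is_arg_max (\<lambda>i. eta_hat xs ys n h i x) (\<lambda>i. i \<in> {1..Q}) (F x))"

definition misclassified_volume ::
  "(real ^ 'd) set \<Rightarrow> nat \<Rightarrow> (nat \<Rightarrow> real ^ 'd \<Rightarrow> real) \<Rightarrow> (real ^ 'd \<Rightarrow> nat) \<Rightarrow> real" where
  "misclassified_volume S Q \<eta> F =
     (\<Sum>i=1..Q. \<Sum>j\<in>{1..Q} - {i}. LINT x:S|lborel. \<eta> i x * of_bool (F x = j))"

definition V_kernel :: "(nat \<Rightarrow> real ^ 'd) \<Rightarrow> nat \<Rightarrow> real \<Rightarrow> real ^ 'd \<Rightarrow> real ^ 'd \<Rightarrow> real" where
  "V_kernel xs n h x y = scaled_kernel h (x - y) / (kde xs n h x * kde xs n h y)"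

definition iid_copies ::
  "'w measure \<Rightarrow> 'b measure \<Rightarrow> ('w \<Rightarrow> 'b) \<Rightarrow> (nat \<Rightarrow> 'w \<Rightarrow> 'b) \<Rightarrow> bool" where
  "iid_copies M N Z Zs \<longleftrightarrow>
     prob_space.indep_vars M (\<lambda>_. N) Zs {1..} \<and>
     (\<forall>l\<ge>1. distr M N (Zs l) = distr M N Z)"

text \<open>
  \<open>g\<close> is a version of \<open>x \<mapsto> P[Y = i | X = x]\<close>: composed with \<open>X\<close> it is the
  conditional probability of \<open>{Y = i}\<close> given the sigma-algebra generated by \<open>X\<close>.
\<close>

definition cond_prob_version ::
  "'w measure \<Rightarrow> ('w \<Rightarrow> real ^ 'd) \<Rightarrow> ('w \<Rightarrow> nat) \<Rightarrow> nat \<Rightarrow> (real ^ 'd \<Rightarrow> real) \<Rightarrow> bool" where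
  "cond_prob_version M X Y i g \<longleftrightarrow>
     g \<in> borel_measurable borel \<and>
     (AE \<omega> in M. g (X \<omega>) =
        real_cond_exp M (vimage_algebra (space M) X borel) (\<lambda>\<omega>. of_bool (Y \<omega> = i)) \<omega>)"

text \<open>
  The \<open>uniform_measure\<close> below is the conditional law given \<open>Y = i\<close>, which makes sense
  only for a class of positive probability.
\<close>

definition class_density ::
  "'w measure \<Rightarrow> ('w \<Rightarrow> real ^ 'd) \<Rightarrow> ('w \<Rightarrow> nat) \<Rightarrow> nat \<Rightarrow> (real ^ 'd \<Rightarrow> real) \<Rightarrow> bool" where
  "class_density M X Y i g \<longleftrightarrow>
     g \<in> borel_measurable borel \<and> (\<forall>x. 0 \<le> g x) \<and>
     (0 < measure M {\<omega> \<in> space M. Y \<omega> = i} \<longrightarrow>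
        distributed (uniform_measure M {\<omega> \<in> space M. Y \<omega> = i}) lborel X (\<lambda>x. ennreal (g x)))"

definition bandwidth_cond :: "nat \<Rightarrow> real \<Rightarrow> (nat \<Rightarrow> real) \<Rightarrow> bool" where
  "bandwidth_cond d \<gamma> h \<longleftrightarrow>
     (\<forall>n\<ge>1. 0 < h n) \<and>
     antimono_on {1..} h \<and>
     h \<longlonglongrightarrow> 0 \<and>
     (\<lambda>n. - ln (h n) / (real n * h n powr (real d + 2 * \<gamma>))) \<longlonglongrightarrow> 0 \<and>
     filterlim (\<lambda>n. - ln (h n) / ln (ln (real n))) at_top sequentially \<and>
     (\<exists>a>0. \<forall>n\<ge>1. h n ^ d < a * h (2 * n) ^ d)"

end

theory Submission
  imports Defs "HOL-Real_Asymp.Real_Asymp"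
begin

text \<open>
  Write \<open>p\<^sub>i\<close> for the density of \<open>X\<close> on the event \<open>Y = i\<close>, so that \<open>\<eta>\<^sub>i = p\<^sub>i / \<Sum>\<^sub>j p\<^sub>j\<close>, and let
  \<open>J = \<integral>\<^sub>S \<Sum>\<^sub>i \<eta>\<^sub>i (1 - \<eta>\<^sub>i)\<close>. The misclassified volume is asymptotically
  \<open>\<integral>\<^sub>S (1 - max\<^sub>i \<eta>\<^sub>i) \<le> J\<close>, while the V-statistic without the factor 2 is asymptotically at
  least \<open>J\<close>. If two classes have positive probability then \<open>J > 0\<close>, and the factor 2 leaves a
  constant amount of room: it is enough that the class density estimators are consistent,
  which follows from a Bernstein inequality on a polynomial grid, the Borel-Cantelli lemma and
  \<open>L\<^sup>1\<close> convergence of the mollified densities. If there is only one class, the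
  misclassified volume vanishes. Either way the remainder \<open>O(h\<^sub>n\<^sup>\<gamma>)\<close> can be taken to be zero.
\<close>

section \<open>The Gaussian kernel\<close>

text \<open>The constant \<open>J\<close> arises as follows. For fixed \<open>l\<close>, the average
  over \<open>m\<close> of \<open>\<theta>\<^sub>l\<^sub>m V\<^sub>l\<^sub>m\<close> is close to
  \<open>(1 - \<eta>\<^sub>i(X\<^sub>l)) / f(X\<^sub>l)\<close> with \<open>i = Y\<^sub>l\<close>,
  at least away from the boundary of \<open>S\<close>; the remaining factor \<open>1 / f\<close>
  turns the sample average over \<open>l\<close> into a Lebesgue integral. On the volume side,
  \<open>1 - max \<eta>\<close> is an average of itself with weights \<open>\<eta>\<^sub>i\<close>,
  and each \<open>1 - \<eta>\<^sub>i\<close> is at least as large. The boundary of \<open>S\<close>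
  shapes the proof. Kernel mass leaks out of \<open>S\<close> there, so an estimator may stay a
  constant factor below its target, and no uniform estimate against the true density is available.
  The error is therefore split: the deviation from the smoothed density is uniform in
  \<open>x\<close>, while the bias is controlled only after averaging, over \<open>S\<close> for the
  volume and over the sample for the V-statistic. Since the estimators stand in denominators, lost
  mass can only enlarge the V-statistic; a lower bound for it uses only upper bounds on
  them.\<close>

lemma norm_cart_power2_eq_sum_Basis:
  fixes z :: "real ^ 'd"
  shows "(norm z)\<^sup>2 = (\<Sum>b\<in>Basis. (z \<bullet> b)\<^sup>2)"
  unfolding power2_norm_eq_inner by (subst euclidean_inner) (simp add: power2_eq_square)

lemma scaled_kernel_eq:
  fixes x :: "real ^ 'd"
  assumes "h > 0"
  shows "scaled_kernel h x =
    (2 * pi) powr (- (real CARD('d) / 2)) / h ^ CARD('d) * exp (- (norm x)\<^sup>2 / (2 * h\<^sup>2))"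
proof -
  have "norm (x /\<^sub>R h) = norm x / h" using assms by (simp add: divide_inverse_commute)
  then show ?thesis
    unfolding scaled_kernel_def gauss_kernel_def by (simp add: power_divide mult.commute)
qed

lemma scaled_kernel_pos: "h > 0 \<Longrightarrow> 0 < scaled_kernel h x"
  by (simp add: scaled_kernel_eq)

lemma scaled_kernel_nonneg: "h > 0 \<Longrightarrow> 0 \<le> scaled_kernel h x"
  by (simp add: scaled_kernel_pos less_imp_le)

lemma scaled_kernel_measurable [measurable]:
  "scaled_kernel h \<in> borel_measurable (borel :: (real ^ 'd) measure)"
  unfolding scaled_kernel_def[abs_def] gauss_kernel_def[abs_def] by measurable

lemma scaled_kernel_commute:
  fixes x y :: "real ^ 'd"
  shows "scaled_kernel h (x - y) = scaled_kernel h (y - x)"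
  by (simp add: scaled_kernel_def gauss_kernel_def norm_minus_commute)

lemma gauss_constant_le_1: "(2 * pi) powr (- (real CARD('d::finite) / 2)) \<le> 1"
proof -
  have "1 \<le> 2 * pi" using pi_gt3 by simp
  then have "1 \<le> (2 * pi) powr (real CARD('d) / 2)"
    by (intro ge_one_powr_ge_zero) auto
  then show ?thesis
    by (simp add: powr_minus field_simps)
qed

text \<open>At a fixed distance \<open>r > 0\<close> the right-hand side tends to 0 with
  \<open>h\<close>. This handles pairs of observations too far apart for the continuity of the
  mixture to help; \<open>r = 0\<close> gives the supremum bound.\<close>

lemma scaled_kernel_le_exp:
  fixes x :: "real ^ 'd"
  assumes "h > 0" "r \<ge> 0" "norm x \<ge> r"
  shows "scaled_kernel h x \<le> exp (- r\<^sup>2 / (2 * h\<^sup>2)) / h ^ CARD('d)"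
proof -
  have "r\<^sup>2 \<le> (norm x)\<^sup>2" using assms by (intro power_mono) auto
  then have "exp (- (norm x)\<^sup>2 / (2 * h\<^sup>2)) \<le> exp (- r\<^sup>2 / (2 * h\<^sup>2))"
    using assms by (auto intro!: divide_right_mono)
  then have "(2 * pi) powr (- (real CARD('d) / 2)) * exp (- (norm x)\<^sup>2 / (2 * h\<^sup>2))
      \<le> 1 * exp (- r\<^sup>2 / (2 * h\<^sup>2))"
    by (intro mult_mono gauss_constant_le_1) auto
  then show ?thesis
    using assms by (simp add: scaled_kernel_eq divide_right_mono)
qed

lemma scaled_kernel_le:
  fixes x :: "real ^ 'd"
  assumes "h > 0"
  shows "scaled_kernel h x \<le> 1 / h ^ CARD('d)"
  using scaled_kernel_le_exp[OF assms, of 0 x] by simp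

text \<open>The kernel is a product of one-dimensional normal densities with means
  \<open>y \<bullet> b\<close> and common deviation \<open>h\<close>, so the integral over
  \<open>lborel\<close> factors along the basis.\<close>

lemma nn_integral_scaled_kernel:
  fixes y :: "real ^ 'd"
  assumes "h > 0"
  shows "(\<integral>\<^sup>+x. ennreal (scaled_kernel h (x - y)) \<partial>lborel) = 1"
proof -
  have const: "(2 * pi) powr (- (real CARD('d) / 2)) / h ^ CARD('d)
      = (\<Prod>b\<in>(Basis :: (real ^ 'd) set). 1 / sqrt (2 * pi * h\<^sup>2))"
  proof -
    have "(2 * pi) powr (- (real CARD('d) / 2)) = (1 / sqrt (2 * pi)) ^ CARD('d)"
      by (simp add: powr_minus powr_half_sqrt[symmetric] powr_power power_one_over inverse_eq_divide)
    moreover have "sqrt (2 * pi * h\<^sup>2) = sqrt (2 * pi) * h"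
      using assms by (simp add: real_sqrt_mult)
    ultimately show ?thesis
      by (simp add: power_divide power_mult_distrib)
  qed
  have "scaled_kernel h (x - y) = (\<Prod>b\<in>Basis. normal_density (y \<bullet> b) h (x \<bullet> b))" for x
    unfolding scaled_kernel_eq[OF assms] const normal_density_def
    by (simp add: norm_cart_power2_eq_sum_Basis exp_sum[symmetric] prod_dividef sum_negf
        sum_divide_distrib inner_diff_left power_one_over)
  then have "(\<integral>\<^sup>+x. ennreal (scaled_kernel h (x - y)) \<partial>lborel)
      = (\<integral>\<^sup>+x. (\<Prod>b\<in>Basis. ennreal (normal_density (y \<bullet> b) h (x \<bullet> b))) \<partial>lborel)"
    using assms by (simp add: prod_ennreal less_imp_le[OF normal_density_pos])
  also have "\<dots> = (\<Prod>b\<in>(Basis :: (real ^ 'd) set).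
      (\<integral>\<^sup>+t. ennreal (normal_density (y \<bullet> b) h t) \<partial>lborel))"
    by (rule nn_integral_lborel_prod) auto
  also have "\<dots> = 1"
    using prob_space.emeasure_space_1[OF prob_space_normal_density[OF assms]]
    by (simp add: emeasure_density)
  finally show ?thesis .
qed

lemma scaled_kernel_integrable: "h > 0 \<Longrightarrow> integrable lborel (\<lambda>x. scaled_kernel h (x - y))"
  by (rule integrableI_nn_integral_finite[where x=1])
     (auto simp: nn_integral_scaled_kernel scaled_kernel_nonneg)

lemma scaled_kernel_integral:
  fixes y :: "real ^ 'd"
  shows "h > 0 \<Longrightarrow> (\<integral>x. scaled_kernel h (x - y) \<partial>lborel) = 1"
  by (simp add: integral_eq_nn_integral scaled_kernel_nonneg nn_integral_scaled_kernel)

text \<open>Mean value theorem: the derivative is at most 1 in absolute value because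
  \<open>\<bar>x\<bar> \<le> 1 + x^2 / 2 \<le> exp (x^2 / 2)\<close>.\<close>

lemma gauss_lipschitz:
  fixes s t :: real
  shows "\<bar>exp (- s\<^sup>2 / 2) - exp (- t\<^sup>2 / 2)\<bar> \<le> \<bar>s - t\<bar>"
proof -
  have "norm (exp (- s\<^sup>2 / 2) - exp (- t\<^sup>2 / 2)) \<le> 1 * norm (s - t)"
  proof (rule field_differentiable_bound[where S = UNIV and f' = "\<lambda>x. - x * exp (- x\<^sup>2 / 2)"])
    show "norm (- x * exp (- x\<^sup>2 / 2)) \<le> 1" for x :: real
    proof -
      have "\<bar>x\<bar> \<le> 1 + x\<^sup>2 / 2"
        using zero_le_power2[of "\<bar>x\<bar> - 1"] by (simp add: power2_eq_square algebra_simps)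
      also have "\<dots> \<le> exp (x\<^sup>2 / 2)" by (rule exp_ge_add_one_self)
      finally have "\<bar>x\<bar> * exp (- x\<^sup>2 / 2) \<le> exp (x\<^sup>2 / 2) * exp (- x\<^sup>2 / 2)"
        by (intro mult_right_mono) auto
      then show ?thesis by (simp add: abs_mult flip: exp_add)
    qed
  qed (auto intro!: derivative_eq_intros)
  then show ?thesis by simp
qed

text \<open>The profile depends on the norm only and is 1-Lipschitz in it. Rescaling the argument
  costs one factor \<open>1 / h\<close> on top of the normalisation
  \<open>1 / h ^ CARD('d)\<close>.\<close>

lemma scaled_kernel_lipschitz:
  fixes x y :: "real ^ 'd"
  assumes "h > 0"
  shows "\<bar>scaled_kernel h x - scaled_kernel h y\<bar> \<le> norm (x - y) / h ^ (CARD('d) + 1)"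
proof -
  let ?c = "(2 * pi) powr (- (real CARD('d) / 2))"
  have "\<bar>gauss_kernel (x /\<^sub>R h) - gauss_kernel (y /\<^sub>R h)\<bar>
      = ?c * \<bar>exp (- (norm (x /\<^sub>R h))\<^sup>2 / 2) - exp (- (norm (y /\<^sub>R h))\<^sup>2 / 2)\<bar>"
    unfolding gauss_kernel_def by (simp add: abs_mult flip: right_diff_distrib)
  also have "\<dots> \<le> 1 * \<bar>norm (x /\<^sub>R h) - norm (y /\<^sub>R h)\<bar>"
    by (intro mult_mono gauss_constant_le_1 gauss_lipschitz) auto
  also have "\<dots> \<le> norm (x /\<^sub>R h - y /\<^sub>R h)"
    using norm_triangle_ineq3[of "x /\<^sub>R h" "y /\<^sub>R h"] by simp
  also have "x /\<^sub>R h - y /\<^sub>R h = (x - y) /\<^sub>R h" by (simp add: scaleR_diff_right)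
  also have "norm \<dots> = norm (x - y) / h"
    using assms by (simp only: norm_scaleR) (simp add: divide_inverse_commute)
  finally have "\<bar>gauss_kernel (x /\<^sub>R h) - gauss_kernel (y /\<^sub>R h)\<bar> \<le> norm (x - y) / h" .
  then have "\<bar>gauss_kernel (x /\<^sub>R h) - gauss_kernel (y /\<^sub>R h)\<bar> / h ^ CARD('d)
      \<le> norm (x - y) / h / h ^ CARD('d)"
    using assms by (intro divide_right_mono) auto
  then show ?thesis
    using assms by (simp add: scaled_kernel_def abs_divide flip: diff_divide_distrib)
qed

text \<open>Half of the Gaussian exponent supplies the small factor; the other half is again a
  Gaussian kernel, of bandwidth \<open>sqrt 2 * h\<close>. Since that kernel has mass one, the bound
  can be integrated over all of space, which a supremum bound would not allow.\<close>

lemma scaled_kernel_tail: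
  fixes x :: "real ^ 'd"
  assumes "h > 0" "r \<ge> 0" "norm x \<ge> r"
  shows "scaled_kernel h x
    \<le> sqrt 2 ^ CARD('d) * exp (- r\<^sup>2 / (4 * h\<^sup>2)) * scaled_kernel (sqrt 2 * h) x"
proof -
  have "r\<^sup>2 \<le> (norm x)\<^sup>2" using assms by (intro power_mono) auto
  then have "exp (- (norm x)\<^sup>2 / (4 * h\<^sup>2)) \<le> exp (- r\<^sup>2 / (4 * h\<^sup>2))"
    using assms by (auto intro!: divide_right_mono)
  then have "exp (- (norm x)\<^sup>2 / (4 * h\<^sup>2)) * exp (- (norm x)\<^sup>2 / (4 * h\<^sup>2))
      \<le> exp (- r\<^sup>2 / (4 * h\<^sup>2)) * exp (- (norm x)\<^sup>2 / (4 * h\<^sup>2))"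
    by (intro mult_right_mono) auto
  then have *: "exp (- (norm x)\<^sup>2 / (2 * h\<^sup>2)) \<le> exp (- r\<^sup>2 / (4 * h\<^sup>2)) * exp (- (norm x)\<^sup>2 / (4 * h\<^sup>2))"
    by (simp flip: exp_add)
  have "(2 * pi) powr (- (real CARD('d) / 2)) / h ^ CARD('d) * exp (- (norm x)\<^sup>2 / (2 * h\<^sup>2))
     \<le> (2 * pi) powr (- (real CARD('d) / 2)) / h ^ CARD('d) *
        (exp (- r\<^sup>2 / (4 * h\<^sup>2)) * exp (- (norm x)\<^sup>2 / (4 * h\<^sup>2)))"
    using assms by (intro mult_left_mono *) auto
  also have "\<dots> = sqrt 2 ^ CARD('d) * exp (- r\<^sup>2 / (4 * h\<^sup>2)) * scaled_kernel (sqrt 2 * h) x"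
    using assms by (simp add: scaled_kernel_eq power_mult_distrib)
  finally show ?thesis using assms by (simp add: scaled_kernel_eq)
qed

text \<open>Once \<open>h n < 1\<close>, the square in the exponent may be replaced by
  \<open>h n\<close> itself. With \<open>x = b / h n\<close> the claim is then that
  \<open>x ^ d / exp x\<close> tends to 0.\<close>

lemma tendsto_exp_div_power:
  fixes h :: "nat \<Rightarrow> real"
  assumes "h \<longlonglongrightarrow> 0" "\<forall>\<^sub>F n in sequentially. h n > 0" "b > 0"
  shows "(\<lambda>n. exp (- b / (h n)\<^sup>2) / h n ^ d) \<longlonglongrightarrow> 0"
proof -
  have lim: "((\<lambda>x. x ^ d / exp x) \<longlongrightarrow> 0) (at_top :: real filter)"
    by (rule tendsto_power_div_exp_0)
  have h: "filterlim h (at_right 0) sequentially"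
    using assms by (auto simp: filterlim_at elim: eventually_mono)
  have "filterlim (\<lambda>n. b / h n) at_top sequentially"
    using filterlim_compose[OF filterlim_inverse_at_top_right h] assms(3)
    by (simp add: divide_inverse filterlim_tendsto_pos_mult_at_top[OF tendsto_const])
  from filterlim_compose[OF lim this]
  have "(\<lambda>n. (b / h n) ^ d / exp (b / h n) / b ^ d) \<longlonglongrightarrow> 0 / b ^ d"
    using assms by (intro tendsto_divide tendsto_const) auto
  then have lim2: "(\<lambda>n. exp (- b / h n) / h n ^ d) \<longlonglongrightarrow> 0"
    using assms by (simp add: power_divide exp_minus field_simps)
  have "\<forall>\<^sub>F n in sequentially. h n < 1"
    using assms(1) by (rule order_tendstoD) simp
  then have ev: "\<forall>\<^sub>F n in sequentially. exp (- b / (h n)\<^sup>2) / h n ^ d \<le> exp (- b / h n) / h n ^ d"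
    using assms(2)
  proof eventually_elim
    case (elim n)
    then have "(h n)\<^sup>2 \<le> h n" by (simp add: power2_eq_square)
    then have "b / h n \<le> b / (h n)\<^sup>2"
      using elim assms by (intro divide_left_mono) auto
    then show ?case using elim by (intro divide_right_mono) auto
  qed
  show ?thesis
    by (rule tendsto_sandwich[OF _ ev tendsto_const lim2])
       (use assms(2) in \<open>eventually_elim, auto\<close>)
qed

section \<open>Empirical means\<close>

text \<open>This second-order bound is what brings the variance into the moment generating function.
  For \<open>u = - v < 0\<close> it rests on \<open>(1 + v) * exp (- v) \<le> 1\<close> and
  \<open>1 + v ^ 3 = (1 + v) * (1 - v + v^2)\<close>.\<close>

lemma exp_le_quadratic:
  fixes u :: real
  assumes "\<bar>u\<bar> \<le> 1"
  shows "exp u \<le> 1 + u + u\<^sup>2"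
proof (cases "u \<ge> 0")
  case True
  then show ?thesis using assms exp_bound[of u] by simp
next
  case False
  define v where "v = - u"
  have v: "v \<ge> 0" "v \<le> 1" using False assms by (auto simp: v_def)
  have "(1 + v) * exp u \<le> exp v * exp u"
    using exp_ge_add_one_self[of v] by (intro mult_right_mono) auto
  also have "\<dots> = 1" by (simp add: v_def flip: exp_add)
  also have "1 \<le> 1 + v ^ 3" using v by simp
  also have "\<dots> = (1 + v) * (1 + u + u\<^sup>2)"
    by (simp add: v_def power2_eq_square power3_eq_cube algebra_simps)
  finally show ?thesis using v by simp
qed

context prob_space
begin

text \<open>From \<open>0 \<le> W \<le> B\<close> follows \<open>W^2 \<le> B * W\<close>, so the
  variance is at most \<open>B * A\<close> rather than of order \<open>B^2\<close>. Kernel values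
  reach order \<open>h ^ (- d)\<close> while their means stay bounded, so this saves a factor
  \<open>B\<close> in the exponent. The scale \<open>t / B\<close> keeps the argument of
  \<open>exp\<close> in the range of \<open>exp_le_quadratic\<close>; \<open>s = 1\<close> and
  \<open>s = -1\<close> serve the two tails.\<close>

lemma expectation_exp_centered_le:
  fixes W :: "'a \<Rightarrow> real"
  assumes W [measurable]: "W \<in> borel_measurable M"
    and bounds: "\<And>\<omega>. \<omega> \<in> space M \<Longrightarrow> 0 \<le> W \<omega> \<and> W \<omega> \<le> B"
    and "expectation W \<le> A" "B > 0" "0 \<le> t" "t \<le> 1" "\<bar>s\<bar> = 1"
  shows "integrable M (\<lambda>\<omega>. exp (t / B * (s * (W \<omega> - expectation W))))"
    and "expectation (\<lambda>\<omega>. exp (t / B * (s * (W \<omega> - expectation W)))) \<le> exp (t\<^sup>2 * A / B)"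
proof -
  let ?\<mu> = "expectation W"
  have int: "integrable M W"
    by (rule integrable_const_bound[where B = B]) (use bounds in \<open>auto intro!: AE_I2\<close>)
  have int2: "integrable M (\<lambda>\<omega>. (W \<omega>)\<^sup>2)"
    by (rule integrable_const_bound[where B = "B\<^sup>2"])
       (use bounds in \<open>auto intro!: AE_I2 power_mono\<close>)
  have \<mu>: "0 \<le> ?\<mu>" "?\<mu> \<le> B"
    using bounds by (auto intro!: Bochner_Integration.integral_nonneg integral_le_const int AE_I2)
  have u: "\<bar>t / B * (s * (W \<omega> - ?\<mu>))\<bar> \<le> 1" if "\<omega> \<in> space M" for \<omega>
  proof -
    have "\<bar>W \<omega> - ?\<mu>\<bar> \<le> B" using bounds[OF that] \<mu> by auto
    then have "t * \<bar>W \<omega> - ?\<mu>\<bar> \<le> 1 * B" using assms by (intro mult_mono) auto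
    then have "t / B * (\<bar>s\<bar> * \<bar>W \<omega> - ?\<mu>\<bar>) \<le> 1" using assms by (simp add: field_simps)
    then show ?thesis using assms by (simp only: abs_mult abs_divide abs_of_pos[OF \<open>B > 0\<close>] abs_of_nonneg[OF \<open>0 \<le> t\<close>])
  qed
  have u_le: "t / B * (s * (W \<omega> - ?\<mu>)) \<le> 1" if "\<omega> \<in> space M" for \<omega>
    using u[OF that] by (rule order_trans[OF abs_ge_self])
  show int3: "integrable M (\<lambda>\<omega>. exp (t / B * (s * (W \<omega> - ?\<mu>))))"
    by (rule integrable_const_bound[where B = "exp 1"])
       (use u_le in \<open>auto intro!: AE_I2 simp del: times_divide_eq_left\<close>)
  have s2: "s\<^sup>2 = 1" using assms(7) by (metis power2_abs one_power2)
  have int4: "integrable M (\<lambda>\<omega>. (W \<omega> - ?\<mu>)\<^sup>2)"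
    unfolding power2_diff using int int2 by (intro Bochner_Integration.integrable_add
      Bochner_Integration.integrable_diff) (auto simp: mult.assoc mult.left_commute)
  have "variance W = expectation (\<lambda>\<omega>. (W \<omega>)\<^sup>2) - ?\<mu>\<^sup>2"
    by (rule variance_eq[OF int int2])
  also have "\<dots> \<le> expectation (\<lambda>\<omega>. (W \<omega>)\<^sup>2)" by simp
  also have "\<dots> \<le> expectation (\<lambda>\<omega>. B * W \<omega>)"
    by (rule integral_mono[OF int2]) (use int bounds in \<open>auto simp: power2_eq_square mult_right_mono\<close>)
  also have "\<dots> \<le> B * A" using assms by simp
  finally have var: "variance W \<le> B * A" .
  have "expectation (\<lambda>\<omega>. exp (t / B * (s * (W \<omega> - ?\<mu>))))
      \<le> expectation (\<lambda>\<omega>. 1 + t / B * s * (W \<omega> - ?\<mu>) + (t / B)\<^sup>2 * (W \<omega> - ?\<mu>)\<^sup>2)"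
  proof (rule integral_mono[OF int3])
    show "integrable M (\<lambda>\<omega>. 1 + t / B * s * (W \<omega> - ?\<mu>) + (t / B)\<^sup>2 * (W \<omega> - ?\<mu>)\<^sup>2)"
      using int int4 by auto
    show "exp (t / B * (s * (W \<omega> - ?\<mu>))) \<le> 1 + t / B * s * (W \<omega> - ?\<mu>) + (t / B)\<^sup>2 * (W \<omega> - ?\<mu>)\<^sup>2"
      if "\<omega> \<in> space M" for \<omega>
    proof -
      have "(t / B * (s * (W \<omega> - ?\<mu>)))\<^sup>2 = (t / B)\<^sup>2 * (W \<omega> - ?\<mu>)\<^sup>2"
        by (simp only: power_mult_distrib s2 mult_1)
      then show ?thesis using exp_le_quadratic[OF u[OF that]] by (simp add: mult.assoc)
    qed
  qed
  also have "\<dots> = 1 + (t / B)\<^sup>2 * variance W"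
    using int int4 by (simp add: prob_space)
  also have "\<dots> \<le> 1 + (t / B)\<^sup>2 * (B * A)" using var by (intro add_left_mono mult_left_mono) auto
  also have "(t / B)\<^sup>2 * (B * A) = t\<^sup>2 * A / B" using assms by (simp add: power2_eq_square field_simps)
  also have "1 + t\<^sup>2 * A / B \<le> exp (t\<^sup>2 * A / B)" by (rule exp_ge_add_one_self)
  finally show "expectation (\<lambda>\<omega>. exp (t / B * (s * (W \<omega> - ?\<mu>)))) \<le> exp (t\<^sup>2 * A / B)" .
qed

text \<open>Exponential Markov inequality with parameter \<open>t / B\<close>, where independence
  factors the expectation. The parameter \<open>t\<close> stays free so that it can later be taken
  small enough for \<open>t * \<epsilon> - t^2 * A\<close> to be positive.\<close>

lemma bernstein_one_sided:
  fixes W :: "'i \<Rightarrow> 'a \<Rightarrow> real" and \<epsilon> :: real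
  assumes I: "finite I" and indep: "indep_vars (\<lambda>_. borel) W I"
    and bounds: "\<And>l \<omega>. l \<in> I \<Longrightarrow> \<omega> \<in> space M \<Longrightarrow> 0 \<le> W l \<omega> \<and> W l \<omega> \<le> B"
    and "\<And>l. l \<in> I \<Longrightarrow> expectation (W l) \<le> A" "B > 0" "0 < t" "t \<le> 1" "\<bar>s\<bar> = 1"
  shows "prob {\<omega> \<in> space M. \<epsilon> * card I \<le> (\<Sum>l\<in>I. s * (W l \<omega> - expectation (W l)))}
    \<le> exp (- (card I / B * (t * \<epsilon> - t\<^sup>2 * A)))"
proof -
  have meas [measurable]: "\<And>l. l \<in> I \<Longrightarrow> W l \<in> borel_measurable M"
    using indep by (auto simp: indep_vars_def)
  let ?g = "\<lambda>l w. exp (t / B * (s * (w - expectation (W l)))) :: real"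
  note mgf = expectation_exp_centered_le[OF meas bounds assms(4) \<open>B > 0\<close> less_imp_le[OF \<open>0 < t\<close>]
      \<open>t \<le> 1\<close> \<open>\<bar>s\<bar> = 1\<close>]
  have "indep_vars (\<lambda>_. borel) (\<lambda>l \<omega>. ?g l (W l \<omega>)) I"
    by (rule indep_vars_compose2[OF indep]) measurable
  then have prod: "integrable M (\<lambda>\<omega>. \<Prod>l\<in>I. ?g l (W l \<omega>))"
    "expectation (\<lambda>\<omega>. \<Prod>l\<in>I. ?g l (W l \<omega>)) = (\<Prod>l\<in>I. expectation (\<lambda>\<omega>. ?g l (W l \<omega>)))"
    using I mgf(1) by (auto intro!: indep_vars_integrable indep_vars_lebesgue_integral)
  have exp_sum: "exp (t / B * (\<Sum>l\<in>I. s * (W l \<omega> - expectation (W l)))) = (\<Prod>l\<in>I. ?g l (W l \<omega>))"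
    for \<omega> using I by (simp add: sum_distrib_left exp_sum)
  have "prob {\<omega> \<in> space M. \<epsilon> * card I \<le> (\<Sum>l\<in>I. s * (W l \<omega> - expectation (W l)))}
    \<le> exp (- (t / B) * (\<epsilon> * card I)) *
      (\<integral>\<omega>\<in>space M. exp (t / B * (\<Sum>l\<in>I. s * (W l \<omega> - expectation (W l)))) \<partial>M)"
  proof (rule Chernoff_ineq_ge)
    show "set_integrable M (space M) (\<lambda>\<omega>. exp (t / B * (\<Sum>l\<in>I. s * (W l \<omega> - expectation (W l)))))"
      unfolding exp_sum set_integrable_def
      by (subst Bochner_Integration.integrable_cong[OF refl, where g = "\<lambda>\<omega>. \<Prod>l\<in>I. ?g l (W l \<omega>)"])
         (use prod(1) in auto)
  qed (use assms in auto)
  also have "(\<integral>\<omega>\<in>space M. exp (t / B * (\<Sum>l\<in>I. s * (W l \<omega> - expectation (W l)))) \<partial>M)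
      = (\<Prod>l\<in>I. expectation (\<lambda>\<omega>. ?g l (W l \<omega>)))"
    unfolding exp_sum set_lebesgue_integral_def prod(2)[symmetric]
    by (rule Bochner_Integration.integral_cong) auto
  also have "\<dots> \<le> (\<Prod>l\<in>I. exp (t\<^sup>2 * A / B))"
    using mgf(2) by (intro prod_mono) auto
  also have "\<dots> = exp (card I * (t\<^sup>2 * A / B))" by (simp only: exp_of_nat_mult prod_constant)
  also have "exp (- (t / B) * (\<epsilon> * card I)) * exp (card I * (t\<^sup>2 * A / B))
      = exp (- (card I / B * (t * \<epsilon> - t\<^sup>2 * A)))"
    using \<open>B > 0\<close> by (simp add: field_simps flip: exp_add)
  finally show ?thesis by simp
qed

lemma bernstein:
  fixes W :: "'i \<Rightarrow> 'a \<Rightarrow> real" and \<epsilon> :: real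
  assumes I: "finite I" "I \<noteq> {}" and indep: "indep_vars (\<lambda>_. borel) W I"
    and bounds: "\<And>l \<omega>. l \<in> I \<Longrightarrow> \<omega> \<in> space M \<Longrightarrow> 0 \<le> W l \<omega> \<and> W l \<omega> \<le> B"
    and mean: "\<And>l. l \<in> I \<Longrightarrow> expectation (W l) = \<mu>" "\<mu> \<le> A"
    and "B > 0" "0 < t" "t \<le> 1"
  shows "prob {\<omega> \<in> space M. \<epsilon> \<le> \<bar>(\<Sum>l\<in>I. W l \<omega>) / card I - \<mu>\<bar>}
    \<le> 2 * exp (- (card I / B * (t * \<epsilon> - t\<^sup>2 * A)))"
proof -
  have meas [measurable]: "\<And>l. l \<in> I \<Longrightarrow> W l \<in> borel_measurable M"
    using indep by (auto simp: indep_vars_def)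
  have card: "real (card I) > 0" using I by (simp add: card_gt_0_iff)
  let ?E = "\<lambda>s. {\<omega> \<in> space M. \<epsilon> * card I \<le> (\<Sum>l\<in>I. s * (W l \<omega> - expectation (W l)))}"
  have E: "prob (?E s) \<le> exp (- (card I / B * (t * \<epsilon> - t\<^sup>2 * A)))" if "\<bar>s\<bar> = 1" for s
    by (rule bernstein_one_sided) (use assms that in auto)
  have sum_eq: "(\<Sum>l\<in>I. s * (W l \<omega> - expectation (W l))) = s * ((\<Sum>l\<in>I. W l \<omega>) - card I * \<mu>)" for s \<omega>
    by (simp add: mean sum_subtractf flip: sum_distrib_left)
  have "prob {\<omega> \<in> space M. \<epsilon> \<le> \<bar>(\<Sum>l\<in>I. W l \<omega>) / card I - \<mu>\<bar>} \<le> prob (?E 1 \<union> ?E (-1))"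
  proof (rule finite_measure_mono)
    show "{\<omega> \<in> space M. \<epsilon> \<le> \<bar>(\<Sum>l\<in>I. W l \<omega>) / card I - \<mu>\<bar>} \<subseteq> ?E 1 \<union> ?E (-1)"
      unfolding sum_eq using card by (auto simp: abs_le_iff abs_if field_simps split: if_splits)
  qed measurable
  also have "\<dots> \<le> prob (?E 1) + prob (?E (-1))"
    by (rule measure_Un_le) measurable
  finally show ?thesis using E[of 1] E[of "-1"] by simp
qed

section \<open>Almost sure statements along an i.i.d. sample\<close>

lemma AE_iid_copies:
  assumes iid: "iid_copies M N Z Zs" and [measurable]: "Z \<in> M \<rightarrow>\<^sub>M N"
    and P: "{z \<in> space N. P z} \<in> sets N" and AE: "AE \<omega> in M. P (Z \<omega>)"
  shows "AE \<omega> in M. \<forall>l\<ge>1. P (Zs l \<omega>)"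
  unfolding AE_all_countable
proof
  fix l
  show "AE \<omega> in M. 1 \<le> l \<longrightarrow> P (Zs l \<omega>)"
  proof (cases "l \<ge> 1")
    case True
    have Zs: "Zs l \<in> M \<rightarrow>\<^sub>M N" and distr: "distr M N (Zs l) = distr M N Z"
      using iid True by (auto simp: iid_copies_def indep_vars_def)
    have "AE z in distr M N (Zs l). P z"
      unfolding distr by (subst AE_distr_iff[OF _ P]) (use AE in auto)
    then show ?thesis by (simp add: AE_distr_iff[OF Zs P])
  qed simp
qed

text \<open>Union bound and Borel-Cantelli for a triangular array: functions and index sets may both
  change with \<open>n\<close>. A single deviation has probability at most
  \<open>2 * exp (- c * n / B n)\<close> for some \<open>c > 0\<close>; by \<open>growth\<close>
  this decays faster than every power of \<open>1 / n\<close>, which absorbs polynomially many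
  indices.\<close>

lemma AE_uniform_empirical_mean:
  fixes Zs :: "nat \<Rightarrow> 'a \<Rightarrow> 'b" and \<phi> :: "nat \<Rightarrow> 'i \<Rightarrow> 'b \<Rightarrow> real" and B :: "nat \<Rightarrow> real"
  assumes iid: "iid_copies M N Z Zs" and Z [measurable]: "Z \<in> M \<rightarrow>\<^sub>M N"
    and J: "\<And>n. n \<ge> 1 \<Longrightarrow> finite (J n)" "\<And>n. n \<ge> 1 \<Longrightarrow> real (card (J n)) \<le> C * real n ^ k"
    and meas: "\<And>n j. n \<ge> 1 \<Longrightarrow> j \<in> J n \<Longrightarrow> \<phi> n j \<in> borel_measurable N"
    and bounds: "\<And>n j z. n \<ge> 1 \<Longrightarrow> j \<in> J n \<Longrightarrow> z \<in> space N \<Longrightarrow> 0 \<le> \<phi> n j z \<and> \<phi> n j z \<le> B n"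
    and mean: "\<And>n j. n \<ge> 1 \<Longrightarrow> j \<in> J n \<Longrightarrow> expectation (\<lambda>\<omega>. \<phi> n j (Z \<omega>)) \<le> A"
    and B: "\<And>n. n \<ge> 1 \<Longrightarrow> B n > 0"
    and growth: "filterlim (\<lambda>n. real n / B n / ln (real n)) at_top sequentially"
    and "\<epsilon> > 0"
  shows "AE \<omega> in M. \<forall>\<^sub>F n in sequentially. \<forall>j\<in>J n.
    \<bar>(\<Sum>l=1..n. \<phi> n j (Zs l \<omega>)) / n - expectation (\<lambda>\<omega>. \<phi> n j (Z \<omega>))\<bar> < \<epsilon>"
proof -
  have indep: "indep_vars (\<lambda>_. N) Zs {1..}"
    and distr: "\<And>l. l \<ge> 1 \<Longrightarrow> distr M N (Zs l) = distr M N Z"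
    using iid by (auto simp: iid_copies_def)
  have Zs [measurable]: "\<And>l. l \<ge> 1 \<Longrightarrow> Zs l \<in> M \<rightarrow>\<^sub>M N"
    using indep by (auto simp: indep_vars_def)
  \<comment> \<open>\<open>A'\<close> is at least 1 so that it can be divided by. With
    \<open>t \<le> \<epsilon> / (2 * A')\<close> the quadratic term uses up at most half of
    \<open>t * \<epsilon>\<close>, which makes the rate \<open>c\<close> positive.\<close>
  define A' where "A' = max A 1"
  have A': "A' \<ge> 1" "A \<le> A'" by (auto simp: A'_def)
  define t where "t = min 1 (\<epsilon> / (2 * A'))"
  have t: "0 < t" "t \<le> 1" using \<open>\<epsilon> > 0\<close> A' by (auto simp: t_def)
  define c where "c = t * \<epsilon> - t\<^sup>2 * A'"
  have "t * A' \<le> \<epsilon> / (2 * A') * A'" using A' by (intro mult_right_mono) (auto simp: t_def)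
  then have "t * A' \<le> \<epsilon> / 2" using A' by simp
  then have "t * (t * A') < t * \<epsilon>" using t \<open>\<epsilon> > 0\<close> by (intro mult_strict_left_mono) auto
  then have c: "c > 0" by (simp add: c_def power2_eq_square)
  let ?E = "\<lambda>n j. {\<omega> \<in> space M. \<epsilon> \<le> \<bar>(\<Sum>l=1..n. \<phi> n j (Zs l \<omega>)) / n - expectation (\<lambda>\<omega>. \<phi> n j (Z \<omega>))\<bar>}"
  \<comment> \<open>Nothing is known about \<open>J 0\<close>, yet Borel-Cantelli asks for a
    measurable event at every index; hence the empty set at 0.\<close>
  define bad where "bad n = (if n = 0 then {} else (\<Union>j\<in>J n. ?E n j))" for n
  have E_meas: "?E n j \<in> sets M" if "n \<ge> 1" "j \<in> J n" for n j
  proof -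
    note [measurable] = meas[OF that]
    have [measurable]: "(\<lambda>\<omega>. \<Sum>l=1..n. \<phi> n j (Zs l \<omega>)) \<in> borel_measurable M"
      by (rule borel_measurable_sum, rule measurable_compose[OF Zs meas[OF that]]) simp
    show ?thesis by measurable
  qed
  have bad_meas: "bad n \<in> sets M" for n
  proof (cases "n = 0")
    case False
    then show ?thesis
      unfolding bad_def by (simp only: if_False) (intro sets.finite_UN J E_meas, auto)
  qed (simp add: bad_def)
  have probE: "prob (?E n j) \<le> 2 * exp (- (n / B n * c))" if n: "n \<ge> 1" and j: "j \<in> J n" for n j
  proof -
    note [measurable] = meas[OF n j]
    have "prob {\<omega> \<in> space M. \<epsilon> \<le> \<bar>(\<Sum>l\<in>{1..n}. \<phi> n j (Zs l \<omega>)) / card {1..n}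
            - expectation (\<lambda>\<omega>. \<phi> n j (Z \<omega>))\<bar>}
      \<le> 2 * exp (- (card {1..n} / B n * (t * \<epsilon> - t\<^sup>2 * A')))"
    proof (rule bernstein)
      show "indep_vars (\<lambda>_. borel) (\<lambda>l \<omega>. \<phi> n j (Zs l \<omega>)) {1..n}"
        by (rule indep_vars_compose2[OF indep_vars_subset[OF indep]]) auto
      show "expectation (\<lambda>\<omega>. \<phi> n j (Zs l \<omega>)) = expectation (\<lambda>\<omega>. \<phi> n j (Z \<omega>))" if "l \<in> {1..n}" for l
      proof -
        have "expectation (\<lambda>\<omega>. \<phi> n j (Zs l \<omega>)) = (\<integral>z. \<phi> n j z \<partial>distr M N (Zs l))"
          using that by (subst integral_distr) auto
        also have "\<dots> = expectation (\<lambda>\<omega>. \<phi> n j (Z \<omega>))"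
          using that by (simp add: distr integral_distr)
        finally show ?thesis .
      qed
      show "0 \<le> \<phi> n j (Zs l \<omega>) \<and> \<phi> n j (Zs l \<omega>) \<le> B n"
        if "l \<in> {1..n}" "\<omega> \<in> space M" for l \<omega>
        using bounds[OF n j] measurable_space[OF Zs] that by auto
    qed (use n mean[OF n j] A' B[OF n] t in auto)
    then show ?thesis by (simp add: c_def)
  qed
  have prob_bad: "prob (bad n) \<le> C * real n ^ k * (2 * exp (- (n / B n * c)))" if n: "n \<ge> 1" for n
  proof -
    have "prob (bad n) \<le> (\<Sum>j\<in>J n. prob (?E n j))"
      using n J(1)[OF n] E_meas[OF n] unfolding bad_def
      by (auto intro!: finite_measure_subadditive_finite)
    also have "\<dots> \<le> (\<Sum>j\<in>J n. 2 * exp (- (n / B n * c)))"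
      by (intro sum_mono probE n)
    also have "\<dots> \<le> C * real n ^ k * (2 * exp (- (n / B n * c)))"
      using J(2)[OF n] by (simp add: mult_right_mono)
    finally show ?thesis .
  qed
  have C: "C \<ge> 0" using J(2)[of 1] by simp
  have "\<forall>\<^sub>F n in sequentially. real n / B n / ln (real n) \<ge> real (k + 2) / c"
    using growth by (auto simp: filterlim_at_top)
  then have ev: "\<forall>\<^sub>F n in sequentially. norm (prob (bad n)) \<le> 2 * C * (1 / real n ^ 2)"
    using eventually_ge_at_top[of 2]
  proof eventually_elim
    case (elim n)
    then have ln: "ln (real n) > 0" by simp
    \<comment> \<open>Of the exponent \<open>k + 2\<close>, the part \<open>k\<close> pays for the
      number of indices and the part 2 makes the series converge.\<close>
    have "real (k + 2) * ln n \<le> n / B n * c"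
    proof -
      have "real (k + 2) / c * ln n \<le> n / B n" using elim(1) ln by (simp only: pos_le_divide_eq)
      then show ?thesis using c by (simp add: field_simps)
    qed
    then have "exp (- (n / B n * c)) \<le> exp (- (real (k + 2) * ln n))" by simp
    also have "\<dots> = inverse (exp (ln n) ^ (k + 2))"
      by (simp only: exp_minus exp_of_nat_mult)
    also have "\<dots> = 1 / real n ^ (k + 2)" using elim by (simp add: inverse_eq_divide)
    finally have "C * real n ^ k * (2 * exp (- (n / B n * c))) \<le> C * real n ^ k * (2 * (1 / real n ^ (k + 2)))"
      using C by (intro mult_left_mono) auto
    also have "\<dots> = 2 * C * (1 / real n ^ 2)" using elim by (simp add: power_add power2_eq_square)
    finally show ?case using prob_bad[of n] elim by simp
  qed
  have "summable (\<lambda>n. prob (bad n))"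
  proof (rule summable_comparison_test_ev[OF ev])
    show "summable (\<lambda>n. 2 * C * (1 / real n ^ 2))"
      using inverse_power_summable[of 2, where 'a = real]
      by (intro summable_mult) (simp add: inverse_eq_divide)
  qed
  then have "AE \<omega> in M. \<forall>\<^sub>F n in sequentially. \<omega> \<in> space M - bad n"
    using bad_meas by (intro borel_cantelli_AE1) (auto simp: emeasure_eq_measure)
  then show ?thesis
  proof eventually_elim
    case (elim \<omega>)
    then show ?case
      using eventually_ge_at_top[of 1]
      by eventually_elim (auto simp: bad_def not_le)
  qed
qed

end

text \<open>
  Either \<open>h\<^sub>n \<ge> n powr (-1/(2d))\<close>, and then \<open>n h\<^sub>n\<^sup>d \<ge> sqrt n\<close>, or
  \<open>- ln h\<^sub>n\<close> is of order at least \<open>ln n\<close>. Hence the deviation probabilities are summable in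
  \<open>n\<close> without any blocking argument.
\<close>

lemma bandwidth_cond_growth:
  assumes "bandwidth_cond d \<gamma> h" "d \<ge> 1" "\<gamma> > 0"
  shows "filterlim (\<lambda>n. real n * h n ^ d / ln (real n)) at_top sequentially"
proof -
  have pos: "\<And>n. n \<ge> 1 \<Longrightarrow> 0 < h n" and lim: "h \<longlonglongrightarrow> 0"
    and ratio: "(\<lambda>n. - ln (h n) / (real n * h n powr (real d + 2 * \<gamma>))) \<longlonglongrightarrow> 0"
    using assms by (auto simp: bandwidth_cond_def)
  have "\<forall>\<^sub>F n in sequentially. Z \<le> real n * h n ^ d / ln (real n)" if "Z > 0" for Z
  proof -
    \<comment> \<open>With this value the inequality
      \<open>ln n / (2 * d) < \<delta> * (n * h n ^ d)\<close>, reached below for small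
      \<open>h n\<close>, is exactly \<open>Z * ln n < n * h n ^ d\<close>.\<close>
    define \<delta> where "\<delta> = 1 / (2 * real d * Z)"
    have \<delta>: "\<delta> > 0" using that assms by (simp add: \<delta>_def)
    have "\<forall>\<^sub>F n in sequentially. - ln (h n) / (real n * h n powr (real d + 2 * \<gamma>)) < \<delta>"
      using order_tendstoD(2)[OF ratio \<delta>] .
    moreover have "\<forall>\<^sub>F n in sequentially. h n < 1"
      using order_tendstoD(2)[OF lim, of 1] by simp
    moreover have "filterlim (\<lambda>n. sqrt (real n) / ln (real n)) at_top sequentially"
      by real_asymp
    then have "\<forall>\<^sub>F n in sequentially. Z \<le> sqrt (real n) / ln (real n)"
      by (auto simp: filterlim_at_top)
    ultimately show ?thesis
      using eventually_ge_at_top[of 2]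
    proof eventually_elim
      case (elim n)
      have h: "0 < h n" using pos elim by simp
      have n: "real n \<ge> 2" using elim by simp
      have ln: "ln (real n) > 0" using elim by simp
      show ?case
      proof (cases "h n \<ge> real n powr (- 1 / (2 * real d))")
        case True
        have "sqrt (real n) = real n * (real n powr (- 1 / (2 * real d))) ^ d"
        proof -
          have "(real n powr (- 1 / (2 * real d))) ^ d = real n powr (- 1 / 2)"
            using assms n by (simp add: powr_powr flip: powr_realpow)
          then have "real n * (real n powr (- 1 / (2 * real d))) ^ d = real n powr (1 + - 1 / 2)"
            using n by (subst powr_add) simp
          then show ?thesis by (simp add: powr_half_sqrt)
        qed
        also have "\<dots> \<le> real n * h n ^ d"
          using True by (intro mult_left_mono power_mono) auto
        finally show ?thesis using elim ln by (smt (verit) divide_right_mono)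
      next
        case False
        then have "ln (h n) < ln (real n powr (- 1 / (2 * real d)))"
          using h n by (subst ln_less_cancel_iff) auto
        then have l: "- ln (h n) > ln (real n) / (2 * real d)" using n by (simp add: ln_powr)
        have "h n powr (real d + 2 * \<gamma>) \<le> h n powr real d"
          using h elim assms by (intro powr_mono') auto
        then have hp: "h n powr (real d + 2 * \<gamma>) \<le> h n ^ d" using h by (simp add: powr_realpow)
        have "real n * h n powr (real d + 2 * \<gamma>) > 0" using h n by simp
        then have "- ln (h n) < \<delta> * (real n * h n powr (real d + 2 * \<gamma>))"
          using elim(1) by (simp only: pos_divide_less_eq)
        also have "\<dots> \<le> \<delta> * (real n * h n ^ d)"
          using hp \<delta> by (intro mult_left_mono) auto
        finally have "ln (real n) / (2 * real d) < \<delta> * (real n * h n ^ d)" using l by simp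
        then show ?thesis using that ln assms by (simp add: \<delta>_def field_simps)
      qed
    qed
  qed
  then show ?thesis by (subst filterlim_at_top_gt[where c = 0]) auto
qed

section \<open>Uniform consistency of class density estimators\<close>

text \<open>Each coordinate is rounded down to a multiple of \<open>1 / N\<close>; the norm is at
  most the sum of the coordinate errors, hence the factor \<open>CARD('d)\<close>. The cardinality
  is polynomial in \<open>N\<close>, as the union bound requires.\<close>

lemma exists_finite_grid:
  fixes R N :: nat
  assumes "N \<ge> 1"
  obtains G :: "(real ^ 'd) set"
  where "finite G" "card G \<le> (2 * R * N + 1) ^ CARD('d)"
    "\<And>x. x \<in> cbox (\<chi> i. - real R) (\<chi> i. real R) \<Longrightarrow> \<exists>g\<in>G. norm (x - g) \<le> CARD('d) / N"
proof -
  let ?K = "\<Pi>\<^sub>E i\<in>(UNIV :: 'd set). {- int (R * N)..int (R * N)}"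
  let ?f = "\<lambda>k. (\<chi> i. of_int (k i) / real N) :: real ^ 'd"
  have finK: "finite ?K" by (intro finite_PiE) auto
  have "card (?f ` ?K) \<le> card ?K" by (rule card_image_le[OF finK])
  also have "card ?K = (2 * R * N + 1) ^ CARD('d)"
  proof -
    have "card {- int (R * N)..int (R * N)} = 2 * R * N + 1"
      by (simp only: card_atLeastAtMost_int)
    then show ?thesis by (simp add: card_PiE)
  qed
  finally have card: "card (?f ` ?K) \<le> (2 * R * N + 1) ^ CARD('d)" .
  have cover: "\<exists>g\<in>?f ` ?K. norm (x - g) \<le> CARD('d) / N"
    if x: "x \<in> cbox (\<chi> i. - real R) (\<chi> i. real R)" for x
  proof
    define k where "k i = \<lfloor>x $ i * N\<rfloor>" for i
    have xi: "- real R \<le> x $ i" "x $ i \<le> real R" for i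
      using x by (auto simp: mem_box_cart)
    have "- int (R * N) \<le> k i \<and> k i \<le> int (R * N)" for i
    proof
      have "- real R * N \<le> x $ i * N" using xi[of i] by (intro mult_right_mono) auto
      then show "- int (R * N) \<le> k i" by (simp add: k_def le_floor_iff)
      have "x $ i * N \<le> real R * N" using xi[of i] by (intro mult_right_mono) auto
      then have "real_of_int (k i) \<le> real_of_int (int (R * N))"
        using of_int_floor_le[of "x $ i * N"] unfolding k_def by simp linarith
      then show "k i \<le> int (R * N)" by linarith
    qed
    then show "?f k \<in> ?f ` ?K" by auto
    have comp: "\<bar>(x - ?f k) $ i\<bar> \<le> 1 / N" for i
    proof -
      have "\<bar>x $ i * N - k i\<bar> \<le> 1"
        using of_int_floor_le[of "x $ i * N"] real_of_int_floor_add_one_ge[of "x $ i * N"]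
        unfolding k_def by linarith
      moreover have "(x - ?f k) $ i = (x $ i * N - k i) / N"
        using assms by (simp add: field_simps)
      ultimately show ?thesis by (simp add: divide_right_mono)
    qed
    have "norm (x - ?f k) \<le> (\<Sum>i\<in>UNIV. \<bar>(x - ?f k) $ i\<bar>)" by (rule norm_le_l1_cart)
    also have "\<dots> \<le> (\<Sum>i\<in>(UNIV :: 'd set). 1 / N)" by (intro sum_mono comp)
    finally show "norm (x - ?f k) \<le> CARD('d) / N" by simp
  qed
  show thesis by (rule that[OF finite_imageI[OF finK] card cover])
qed

text \<open>This estimates the joint density \<open>\<pi>\<^sub>i f\<^sub>i\<close> of position and
  class, not the class-conditional density: the sum is divided by \<open>n\<close> and not by the
  size of the class. It is the numerator of \<open>eta_hat\<close> up to the factor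
  \<open>n\<close>.\<close>

definition class_kde ::
  "(nat \<Rightarrow> real ^ 'd) \<Rightarrow> (nat \<Rightarrow> nat) \<Rightarrow> nat \<Rightarrow> real \<Rightarrow> nat \<Rightarrow> real ^ 'd \<Rightarrow> real" where
  "class_kde xs ys n h i x = (\<Sum>l=1..n. scaled_kernel h (x - xs l) * of_bool (ys l = i)) / n"

lemma class_kde_lipschitz:
  fixes x y :: "real ^ 'd"
  assumes "h > 0"
  shows "\<bar>class_kde xs ys n h i x - class_kde xs ys n h i y\<bar> \<le> norm (x - y) / h ^ (CARD('d) + 1)"
proof (cases "n = 0")
  case False
  let ?L = "norm (x - y) / h ^ (CARD('d) + 1)"
  have "\<bar>\<Sum>l=1..n. (scaled_kernel h (x - xs l) - scaled_kernel h (y - xs l)) * of_bool (ys l = i)\<bar>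
      \<le> (\<Sum>l=1..n. \<bar>(scaled_kernel h (x - xs l) - scaled_kernel h (y - xs l)) * of_bool (ys l = i)\<bar>)"
    by (rule sum_abs)
  also have "\<dots> \<le> (\<Sum>l=1..n. ?L)"
  proof (rule sum_mono)
    fix l
    have "\<bar>scaled_kernel h (x - xs l) - scaled_kernel h (y - xs l)\<bar> \<le> ?L"
      using scaled_kernel_lipschitz[OF assms, of "x - xs l" "y - xs l"] by simp
    moreover have "0 \<le> ?L" using assms by simp
    ultimately show "\<bar>(scaled_kernel h (x - xs l) - scaled_kernel h (y - xs l)) * of_bool (ys l = i)\<bar> \<le> ?L"
      by (simp only: abs_mult) (cases "ys l = i"; simp)
  qed
  finally have "\<bar>\<Sum>l=1..n. (scaled_kernel h (x - xs l) - scaled_kernel h (y - xs l)) * of_bool (ys l = i)\<bar>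
    \<le> n * ?L" by simp
  moreover have "class_kde xs ys n h i x - class_kde xs ys n h i y
    = (\<Sum>l=1..n. (scaled_kernel h (x - xs l) - scaled_kernel h (y - xs l)) * of_bool (ys l = i)) / n"
    unfolding class_kde_def by (simp add: sum_subtractf left_diff_distrib diff_divide_distrib)
  ultimately show ?thesis using False by (simp only: abs_divide abs_of_nat) (simp add: field_simps)
qed (use assms in \<open>simp add: class_kde_def\<close>)

text \<open>
  Eventually \<open>1 / h\<^sub>n\<^sup>d \<le> n\<close>, so the Lipschitz constants of the estimators are at most
  \<open>n\<^sup>2\<close>; a grid of mesh \<open>1 / n\<^sup>3\<close> therefore suffices, and its cardinality is polynomial in \<open>n\<close>.
\<close>

lemma (in prob_space) AE_class_kde_uniform:
  fixes X :: "'a \<Rightarrow> real ^ 'd" and Y :: "'a \<Rightarrow> nat" and h :: "nat \<Rightarrow> real"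
  assumes [measurable]: "X \<in> M \<rightarrow>\<^sub>M borel" "Y \<in> M \<rightarrow>\<^sub>M count_space UNIV"
    and iid: "iid_copies M (borel \<Otimes>\<^sub>M count_space UNIV) (\<lambda>\<omega>. (X \<omega>, Y \<omega>)) (\<lambda>l \<omega>. (Xs l \<omega>, Ys l \<omega>))"
    and S: "bounded S" and I: "finite I"
    and mean: "\<And>x i n. n \<ge> 1 \<Longrightarrow> i \<in> I \<Longrightarrow>
      expectation (\<lambda>\<omega>. scaled_kernel (h n) (x - X \<omega>) * of_bool (Y \<omega> = i)) \<le> A"
    and band: "bandwidth_cond CARD('d) \<gamma> h" "\<gamma> > 0" and "\<epsilon> > 0"
  shows "AE \<omega> in M. \<forall>\<^sub>F n in sequentially. \<forall>i\<in>I. \<forall>x\<in>S.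
    \<bar>class_kde (\<lambda>l. Xs l \<omega>) (\<lambda>l. Ys l \<omega>) n (h n) i x
      - expectation (\<lambda>\<omega>. scaled_kernel (h n) (x - X \<omega>) * of_bool (Y \<omega> = i))\<bar> \<le> \<epsilon>"
proof -
  have d: "CARD('d) \<ge> 1" by (simp add: Suc_leI)
  have hpos: "\<And>n. n \<ge> 1 \<Longrightarrow> 0 < h n" and hlim: "h \<longlonglongrightarrow> 0"
    using band by (auto simp: bandwidth_cond_def)
  note growth = bandwidth_cond_growth[OF band(1) d band(2)]
  obtain b where b: "\<And>x. x \<in> S \<Longrightarrow> norm x \<le> b" using S by (auto simp: bounded_iff)
  define R where "R = nat \<lceil>b\<rceil>"
  have R: "S \<subseteq> cbox (\<chi> i. - real R) (\<chi> i. real R)"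
  proof
    fix x assume "x \<in> S"
    then have "norm x \<le> b" by (rule b)
    then have "\<bar>x $ i\<bar> \<le> real R" for i
      using component_le_norm_cart[of x i] real_nat_ceiling_ge[of b] unfolding R_def by linarith
    then show "x \<in> cbox (\<chi> i. - real R) (\<chi> i. real R)" by (simp add: mem_box_cart abs_le_iff minus_le_iff)
  qed
  define P where "P n G \<longleftrightarrow> finite G \<and> card G \<le> (2 * R * n ^ 3 + 1) ^ CARD('d)
      \<and> (\<forall>x\<in>S. \<exists>g\<in>G. norm (x - g) \<le> CARD('d) / real (n ^ 3))" for n :: nat and G :: "(real ^ 'd) set"
  define G where "G n = (SOME G. P n G)" for n
  have "P n (G n)" if n: "n \<ge> 1" for n
  proof -
    obtain G' :: "(real ^ 'd) set" where "finite G'" "card G' \<le> (2 * R * n ^ 3 + 1) ^ CARD('d)"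
      "\<And>x. x \<in> cbox (\<chi> i. - real R) (\<chi> i. real R) \<Longrightarrow> \<exists>g\<in>G'. norm (x - g) \<le> CARD('d) / real (n ^ 3)"
    proof (rule exists_finite_grid[of "n ^ 3" R])
      show "1 \<le> n ^ 3" using n by (rule one_le_power)
    qed (rule that)
    then have "P n G'" unfolding P_def using R subsetD by auto
    then show ?thesis unfolding G_def by (rule someI)
  qed
  then have G: "finite (G n)" "card (G n) \<le> (2 * R * n ^ 3 + 1) ^ CARD('d)"
      "\<And>x. x \<in> S \<Longrightarrow> \<exists>g\<in>G n. norm (x - g) \<le> CARD('d) / real (n ^ 3)" if "n \<ge> 1" for n
    using that by (simp_all only: P_def)
  define \<phi> where "\<phi> n j z = scaled_kernel (h n) (snd j - fst z) * of_bool (snd z = fst j)"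
    for n and j :: "nat \<times> (real ^ 'd)" and z :: "(real ^ 'd) \<times> nat"
  let ?q = "\<lambda>n i x. expectation (\<lambda>\<omega>. scaled_kernel (h n) (x - X \<omega>) * of_bool (Y \<omega> = i))"
  have int: "integrable M (\<lambda>\<omega>. scaled_kernel (h n) (x - X \<omega>) * of_bool (Y \<omega> = i))" if "n \<ge> 1" for n x i
  proof (rule integrable_const_bound[where B = "1 / h n ^ CARD('d)"])
    have "\<bar>scaled_kernel (h n) z * of_bool b\<bar> \<le> 1 / h n ^ CARD('d)" for z :: "real ^ 'd" and b
      using scaled_kernel_le[OF hpos[OF that], of z] scaled_kernel_nonneg[OF hpos[OF that], of z]
        hpos[OF that] by (cases b) simp_all
    then show "AE \<omega> in M. norm (scaled_kernel (h n) (x - X \<omega>) * of_bool (Y \<omega> = i)) \<le> 1 / h n ^ CARD('d)"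
      by simp
  qed measurable
  have q_lip: "\<bar>?q n i x - ?q n i y\<bar> \<le> norm (x - y) / h n ^ (CARD('d) + 1)" if "n \<ge> 1" for n i x y
  proof -
    have L: "0 \<le> norm (x - y) / h n ^ (CARD('d) + 1)" using hpos[OF that] by simp
    have "\<bar>?q n i x - ?q n i y\<bar>
      = \<bar>expectation (\<lambda>\<omega>. (scaled_kernel (h n) (x - X \<omega>) - scaled_kernel (h n) (y - X \<omega>)) * of_bool (Y \<omega> = i))\<bar>"
      using int[OF that] by (simp add: left_diff_distrib)
    also have "\<dots> \<le> expectation (\<lambda>\<omega>. \<bar>(scaled_kernel (h n) (x - X \<omega>) - scaled_kernel (h n) (y - X \<omega>)) * of_bool (Y \<omega> = i)\<bar>)"
      by (rule integral_abs_bound)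
    also have "\<dots> \<le> expectation (\<lambda>\<omega>. norm (x - y) / h n ^ (CARD('d) + 1))"
    proof (rule integral_mono)
      show "integrable M (\<lambda>\<omega>. \<bar>(scaled_kernel (h n) (x - X \<omega>) - scaled_kernel (h n) (y - X \<omega>)) * of_bool (Y \<omega> = i)\<bar>)"
        using int[OF that] by (simp add: left_diff_distrib)
      show "\<bar>(scaled_kernel (h n) (x - X \<omega>) - scaled_kernel (h n) (y - X \<omega>)) * of_bool (Y \<omega> = i)\<bar>
          \<le> norm (x - y) / h n ^ (CARD('d) + 1)" for \<omega>
        using scaled_kernel_lipschitz[OF hpos[OF that], of "x - X \<omega>" "y - X \<omega>"] L
        by (simp only: abs_mult) (cases "Y \<omega> = i"; simp)
    qed simp
    finally show ?thesis by (simp add: prob_space)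
  qed
  \<comment> \<open>One third of the tolerance covers the deviation at the grid points; the other
    two thirds cover moving the estimator, and then its mean, from \<open>x\<close> to a nearby grid
    point.\<close>
  have "AE \<omega> in M. \<forall>\<^sub>F n in sequentially. \<forall>j\<in>I \<times> G n.
    \<bar>(\<Sum>l=1..n. \<phi> n j (Xs l \<omega>, Ys l \<omega>)) / n - expectation (\<lambda>\<omega>. \<phi> n j (X \<omega>, Y \<omega>))\<bar> < \<epsilon> / 3"
  proof (rule AE_uniform_empirical_mean[OF iid])
    show "(\<lambda>\<omega>. (X \<omega>, Y \<omega>)) \<in> M \<rightarrow>\<^sub>M borel \<Otimes>\<^sub>M count_space UNIV" by measurable
    show "finite (I \<times> G n)" if "n \<ge> 1" for n using I G(1)[OF that] by simp
    show "real (card (I \<times> G n)) \<le> real (card I * (2 * R + 1) ^ CARD('d)) * real n ^ (3 * CARD('d))"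
      if "n \<ge> 1" for n
    proof -
      have "card (I \<times> G n) = card I * card (G n)" by (rule card_cartesian_product)
      also have "\<dots> \<le> card I * (2 * R * n ^ 3 + 1) ^ CARD('d)"
        using G(2)[OF that] by (rule mult_le_mono2)
      also have "\<dots> \<le> card I * ((2 * R + 1) * n ^ 3) ^ CARD('d)"
        using that by (intro mult_le_mono2 power_mono) (auto simp: algebra_simps)
      also have "\<dots> = card I * (2 * R + 1) ^ CARD('d) * n ^ (3 * CARD('d))"
        by (simp only: power_mult_distrib power_mult mult.assoc)
      finally have "real (card (I \<times> G n)) \<le> real (card I * (2 * R + 1) ^ CARD('d) * n ^ (3 * CARD('d)))"
        by (simp only: of_nat_le_iff)
      then show ?thesis by (simp only: of_nat_mult of_nat_power)
    qed
    show "\<phi> n j \<in> borel_measurable (borel \<Otimes>\<^sub>M count_space UNIV)" for n j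
      unfolding \<phi>_def[abs_def] by measurable
    show "0 \<le> \<phi> n j z \<and> \<phi> n j z \<le> 1 / h n ^ CARD('d)" if "n \<ge> 1" for n j z
      using hpos[OF that] scaled_kernel_le[OF hpos[OF that], of "snd j - fst z"]
        scaled_kernel_nonneg[OF hpos[OF that], of "snd j - fst z"]
      by (auto simp: \<phi>_def)
    show "expectation (\<lambda>\<omega>. \<phi> n j (X \<omega>, Y \<omega>)) \<le> A" if "n \<ge> 1" "j \<in> I \<times> G n" for n j
      using mean[of n "fst j" "snd j"] that by (auto simp: \<phi>_def)
    show "filterlim (\<lambda>n. real n / (1 / h n ^ CARD('d)) / ln (real n)) at_top sequentially"
      using growth by simp
  qed (use hpos \<open>\<epsilon> > 0\<close> in auto)
  then show ?thesis
  proof eventually_elim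
    case (elim \<omega>)
    let ?p = "class_kde (\<lambda>l. Xs l \<omega>) (\<lambda>l. Ys l \<omega>)"
    have "\<forall>\<^sub>F n in sequentially. 1 \<le> real n * h n ^ CARD('d) / ln (real n)"
      using growth by (auto simp: filterlim_at_top)
    moreover have "\<forall>\<^sub>F n in sequentially. h n < 1" using order_tendstoD(2)[OF hlim, of 1] by simp
    moreover have "(\<lambda>n. CARD('d) / real n) \<longlonglongrightarrow> 0" by (rule lim_const_over_n)
    then have "\<forall>\<^sub>F n in sequentially. CARD('d) / real n < \<epsilon> / 3"
      using \<open>\<epsilon> > 0\<close> by (intro order_tendstoD) auto
    ultimately show ?case using elim eventually_ge_at_top[of 3]
    proof eventually_elim
      case (elim n)
      have n: "n \<ge> 1" "real n \<ge> 3" using elim by auto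
      have h: "0 < h n" using hpos n by simp
      \<comment> \<open>From \<open>n = 3\<close> on \<open>ln n\<close> is at least 1, so the
        growth condition with constant 1 already gives \<open>n * h n ^ d \<ge> 1\<close>.\<close>
      have "exp 1 \<le> real n" using n exp_le by linarith
      then have "1 \<le> ln (real n)" using n by (subst ln_ge_iff) auto
      then have "1 \<le> real n * h n ^ CARD('d)" using elim(1) by (simp add: field_simps)
      then have nh: "1 / h n ^ CARD('d) \<le> real n" using h by (simp add: field_simps)
      have "1 / h n ^ (CARD('d) + 1) \<le> 1 / h n ^ (CARD('d) + CARD('d))"
        using h d elim by (intro divide_left_mono power_decreasing) auto
      also have "\<dots> = (1 / h n ^ CARD('d)) * (1 / h n ^ CARD('d))" by (simp add: power_add)
      also have "\<dots> \<le> real n * real n" using nh h by (intro mult_mono) auto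
      finally have lip: "1 / h n ^ (CARD('d) + 1) \<le> real n * real n" .
      show ?case
      proof (intro ballI)
        fix i x assume i: "i \<in> I" and x: "x \<in> S"
        obtain g where g: "g \<in> G n" "norm (x - g) \<le> CARD('d) / n ^ 3"
          using G(3)[OF n(1) x] by auto
        have "norm (x - g) / h n ^ (CARD('d) + 1) = norm (x - g) * (1 / h n ^ (CARD('d) + 1))" by simp
        also have "\<dots> \<le> CARD('d) / n ^ 3 * (real n * real n)"
          using g lip h by (intro mult_mono) auto
        also have "\<dots> = CARD('d) / n" using n by (simp add: power3_eq_cube)
        finally have small: "norm (x - g) / h n ^ (CARD('d) + 1) < \<epsilon> / 3" using elim by linarith
        have "\<bar>?p n (h n) i g - ?q n i g\<bar> < \<epsilon> / 3"
          using elim i g by (auto simp: \<phi>_def class_kde_def)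
        then show "\<bar>?p n (h n) i x - ?q n i x\<bar> \<le> \<epsilon>"
          using small q_lip[OF n(1), of x i g]
            class_kde_lipschitz[OF h, where xs = "\<lambda>l. Xs l \<omega>" and ys = "\<lambda>l. Ys l \<omega>" and n = n
              and i = i and x = x and y = g]
          by linarith
      qed
    qed
  qed
qed

section \<open>Mollification\<close>

lemma tendsto_kernel_tail:
  fixes h :: "nat \<Rightarrow> real"
  assumes "h \<longlonglongrightarrow> 0" "\<And>n. n \<ge> 1 \<Longrightarrow> 0 < h n" "r > 0"
  shows "(\<lambda>n. sqrt 2 ^ d * exp (- r\<^sup>2 / (4 * (h n)\<^sup>2))) \<longlonglongrightarrow> 0"
proof -
  have "(\<lambda>n. sqrt 2 ^ d * (exp (- (r\<^sup>2 / 4) / (h n)\<^sup>2) / h n ^ 0)) \<longlonglongrightarrow> sqrt 2 ^ d * 0"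
    using assms
    by (intro tendsto_mult tendsto_const tendsto_exp_div_power)
       (auto intro: eventually_sequentiallyI[of 1])
  then show ?thesis by (simp add: field_simps)
qed

lemma nn_integral_scaled_kernel':
  fixes x :: "real ^ 'd"
  assumes "h > 0"
  shows "(\<integral>\<^sup>+y. ennreal (scaled_kernel h (x - y)) \<partial>lborel) = 1"
  using nn_integral_scaled_kernel[OF assms, of x] by (simp add: scaled_kernel_commute[of h x])

text \<open>
  The density jumps at the boundary of \<open>S\<close>, which may be arbitrarily rough, so the bias of the
  estimators is not uniformly small. It is small in \<open>L\<^sup>1\<close>, because little kernel mass leaks
  out of \<open>S\<close>: compare \<open>S\<close> with a compact subset and an open superset.
\<close>

lemma eventually_kernel_leak_le:
  fixes S :: "(real ^ 'd) set" and h :: "nat \<Rightarrow> real"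
  assumes S [measurable]: "S \<in> sets borel" and "bounded S"
    and h: "h \<longlonglongrightarrow> 0" "\<And>n. n \<ge> 1 \<Longrightarrow> 0 < h n" and "\<epsilon> > 0"
  shows "\<forall>\<^sub>F n in sequentially. (\<integral>\<^sup>+x. indicator S x *
    (\<integral>\<^sup>+y. ennreal (scaled_kernel (h n) (x - y)) * indicator (- S) y \<partial>lborel) \<partial>lborel) \<le> ennreal \<epsilon>"
proof -
  have "\<epsilon> / 3 > 0" using \<open>\<epsilon> > 0\<close> by simp
  obtain U where U: "open U" "S \<subseteq> U" "emeasure lborel (U - S) < ennreal (\<epsilon> / 3)"
    using outer_regular_lborel[OF S \<open>\<epsilon> / 3 > 0\<close>] by blast
  obtain C where C: "closed C" "C \<subseteq> S" "emeasure lebesgue (S - C) < ennreal (\<epsilon> / 3)"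
    using sets_lebesgue_inner_closed[of S "\<epsilon> / 3"] \<open>\<epsilon> > 0\<close> by (metis \<open>\<epsilon> / 3 > 0\<close> S sets_completionI_sets sets_lborel)
  have [measurable]: "U \<in> sets borel" "C \<in> sets borel" using U C by auto
  have SC: "emeasure lborel (S - C) < ennreal (\<epsilon> / 3)"
    using C(3) by (simp add: emeasure_completion)
  have "compact C" using C \<open>bounded S\<close> bounded_subset compact_eq_bounded_closed by blast
  then obtain r where r: "r > 0" "\<And>x y. x \<in> C \<Longrightarrow> y \<in> - U \<Longrightarrow> r \<le> dist x y"
    using separate_compact_closed[of C "- U"] U C by (metis Compl_disjoint2 Diff_eq Diff_eq_empty_iff Int_commute closed_Compl disjoint_eq_subset_Compl double_complement order_trans)
  have fin: "emeasure lborel S < \<infinity>" using \<open>bounded S\<close> by (rule emeasure_bounded_finite)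
  define m where "m = measure lborel S"
  have m: "emeasure lborel S = ennreal m" "m \<ge> 0"
    using fin by (auto simp: m_def emeasure_eq_ennreal_measure)
  define T where "T n = sqrt 2 ^ CARD('d) * exp (- r\<^sup>2 / (4 * (h n)\<^sup>2))" for n
  have T: "T n \<ge> 0" for n by (simp add: T_def)
  have "(\<lambda>n. T n * m) \<longlonglongrightarrow> 0 * m"
    unfolding T_def using h r by (intro tendsto_mult tendsto_const tendsto_kernel_tail)
  then have "\<forall>\<^sub>F n in sequentially. T n * m < \<epsilon> / 3"
    using \<open>\<epsilon> > 0\<close> by (intro order_tendstoD) auto
  then show ?thesis using eventually_ge_at_top[of 1]
  proof eventually_elim
    case (elim n)
    have hn: "0 < h n" using h elim by simp
    let ?K = "\<lambda>x y. ennreal (scaled_kernel (h n) (x - y))"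
    let ?K2 = "\<lambda>x y. ennreal (scaled_kernel (sqrt 2 * h n) (x - y))"
    \<comment> \<open>Every leaking pair has \<open>x\<close> in the thin set \<open>S - C\<close>,
      or \<open>y\<close> in the thin set \<open>U - S\<close>, or \<open>x\<close> in
      \<open>C\<close> and \<open>y\<close> outside \<open>U\<close>. The thin sets meet kernel mass
      one; in the last case the distance is at least \<open>r\<close> and the tail factor
      \<open>T n\<close> is small.\<close>
    have pointwise: "indicator S x * (?K x y * indicator (- S) y)
      \<le> indicator (S - C) x * ?K x y + (indicator (U - S) y * ?K x y + indicator S x * (ennreal (T n) * ?K2 x y))" for x y
    proof (cases "x \<in> C \<and> y \<notin> U")
      case True
      then have "scaled_kernel (h n) (x - y) \<le> T n * scaled_kernel (sqrt 2 * h n) (x - y)"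
        unfolding T_def using r(2)[of x y] r(1) by (intro scaled_kernel_tail hn) (auto simp: dist_norm)
      then have "?K x y \<le> ennreal (T n) * ?K2 x y"
        by (simp add: ennreal_leI T flip: ennreal_mult')
      then show ?thesis using True C U by (auto simp: indicator_def)
    next
      case False
      then show ?thesis using C U by (auto simp: indicator_def add_increasing2)
    qed
    have "(\<integral>\<^sup>+x. indicator S x * (\<integral>\<^sup>+y. ?K x y * indicator (- S) y \<partial>lborel) \<partial>lborel)
      = (\<integral>\<^sup>+x. (\<integral>\<^sup>+y. indicator S x * (?K x y * indicator (- S) y) \<partial>lborel) \<partial>lborel)"
      by (intro nn_integral_cong nn_integral_cmult[symmetric]) measurable
    also have "\<dots> \<le> (\<integral>\<^sup>+x. (\<integral>\<^sup>+y. indicator (S - C) x * ?K x y + (indicator (U - S) y * ?K x y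
        + indicator S x * (ennreal (T n) * ?K2 x y)) \<partial>lborel) \<partial>lborel)"
      by (intro nn_integral_mono pointwise)
    also have "\<dots> = (\<integral>\<^sup>+x. (\<integral>\<^sup>+y. indicator (S - C) x * ?K x y \<partial>lborel) \<partial>lborel)
        + ((\<integral>\<^sup>+x. (\<integral>\<^sup>+y. indicator (U - S) y * ?K x y \<partial>lborel) \<partial>lborel)
        + (\<integral>\<^sup>+x. (\<integral>\<^sup>+y. indicator S x * (ennreal (T n) * ?K2 x y) \<partial>lborel) \<partial>lborel))"
      by (simp add: nn_integral_add)
    \<comment> \<open>Here the thin set confines \<open>y\<close>, so the kernel mass has to be
      integrated out in \<open>x\<close> first.\<close>
    also have "(\<integral>\<^sup>+x. (\<integral>\<^sup>+y. indicator (U - S) y * ?K x y \<partial>lborel) \<partial>lborel)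
        = (\<integral>\<^sup>+y. (\<integral>\<^sup>+x. indicator (U - S) y * ?K x y \<partial>lborel) \<partial>lborel)"
      by (rule lborel_pair.Fubini') measurable
    also have "\<dots> = emeasure lborel (U - S)"
      using hn by (simp add: nn_integral_cmult nn_integral_scaled_kernel)
    also have "(\<integral>\<^sup>+x. (\<integral>\<^sup>+y. indicator (S - C) x * ?K x y \<partial>lborel) \<partial>lborel) = emeasure lborel (S - C)"
      using hn by (simp add: nn_integral_cmult nn_integral_scaled_kernel')
    also have "(\<integral>\<^sup>+x. (\<integral>\<^sup>+y. indicator S x * (ennreal (T n) * ?K2 x y) \<partial>lborel) \<partial>lborel)
        = ennreal (T n * m)"
      using hn T m by (simp add: nn_integral_cmult nn_integral_multc nn_integral_scaled_kernel' ennreal_mult' mult.commute)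
    also have "emeasure lborel (S - C) + (emeasure lborel (U - S) + ennreal (T n * m))
      \<le> ennreal (\<epsilon> / 3) + (ennreal (\<epsilon> / 3) + ennreal (\<epsilon> / 3))"
      using SC U elim by (intro add_mono) (auto intro: ennreal_leI)
    also have "\<dots> = ennreal \<epsilon>" using \<open>\<epsilon> > 0\<close> by (simp flip: ennreal_plus)
    finally show ?case .
  qed
qed

section \<open>L1 convergence of the mollified densities\<close>

text \<open>For \<open>x\<close> in \<open>S\<close> the average of \<open>p y - p x\<close> is
  split according to \<open>y\<close>: within the modulus of continuity inside \<open>S\<close>, at
  distance at least \<open>r\<close>, or outside \<open>S\<close>. The first two contributions are
  small uniformly in \<open>x\<close>. The third is at most \<open>A\<close> times the leaked mass,
  which is small only after integration over \<open>x\<close>.\<close>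

lemma eventually_mollify_L1_le:
  fixes S :: "(real ^ 'd) set" and h :: "nat \<Rightarrow> real" and p :: "real ^ 'd \<Rightarrow> real"
  assumes S [measurable]: "S \<in> sets borel" and "bounded S"
    and p [measurable]: "p \<in> borel_measurable borel"
    and p_bounds: "\<And>x. 0 \<le> p x" "\<And>x. p x \<le> A" and off: "\<And>x. x \<notin> S \<Longrightarrow> p x = 0"
    and cont: "uniformly_continuous_on S p"
    and h: "h \<longlonglongrightarrow> 0" "\<And>n. n \<ge> 1 \<Longrightarrow> 0 < h n" and "\<epsilon> > 0"
  shows "\<forall>\<^sub>F n in sequentially.
    (LINT x:S|lborel. \<bar>(\<integral>y. scaled_kernel (h n) (x - y) * p y \<partial>lborel) - p x\<bar>) \<le> \<epsilon>"
proof -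
  have A: "A \<ge> 0" using p_bounds order_trans by blast
  have fin: "emeasure lborel S < \<infinity>" using \<open>bounded S\<close> by (rule emeasure_bounded_finite)
  define m where "m = measure lborel S"
  have m: "emeasure lborel S = ennreal m" "m \<ge> 0"
    using fin by (auto simp: m_def emeasure_eq_ennreal_measure)
  \<comment> \<open>The summand 1 keeps the quotient meaningful when \<open>m = 0\<close>; the
    \<open>A + 1\<close> in the leak tolerance has the same purpose.\<close>
  define w where "w = \<epsilon> / (3 * (m + 1))"
  have w: "w > 0" using \<open>\<epsilon> > 0\<close> m by (simp add: w_def)
  have wm: "w * m \<le> \<epsilon> / 3"
    using \<open>\<epsilon> > 0\<close> m by (simp add: w_def field_simps)
  obtain r where r: "r > 0" "\<And>x y. x \<in> S \<Longrightarrow> y \<in> S \<Longrightarrow> dist y x < r \<Longrightarrow> dist (p y) (p x) < w"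
    using cont w unfolding uniformly_continuous_on_def by metis
  define T where "T n = sqrt 2 ^ CARD('d) * exp (- r\<^sup>2 / (4 * (h n)\<^sup>2))" for n
  have T: "T n \<ge> 0" for n by (simp add: T_def)
  have "(\<lambda>n. A * T n * m) \<longlonglongrightarrow> A * 0 * m"
    unfolding T_def using h r by (intro tendsto_mult tendsto_const tendsto_kernel_tail)
  then have "\<forall>\<^sub>F n in sequentially. A * T n * m < \<epsilon> / 3"
    using \<open>\<epsilon> > 0\<close> by (intro order_tendstoD) auto
  moreover have "\<forall>\<^sub>F n in sequentially. (\<integral>\<^sup>+x. indicator S x *
      (\<integral>\<^sup>+y. ennreal (scaled_kernel (h n) (x - y)) * indicator (- S) y \<partial>lborel) \<partial>lborel) \<le> ennreal (\<epsilon> / (3 * (A + 1)))"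
    using \<open>\<epsilon> > 0\<close> A by (intro eventually_kernel_leak_le assms) auto
  ultimately show ?thesis using eventually_ge_at_top[of 1]
  proof eventually_elim
    case (elim n)
    have hn: "0 < h n" using h elim by simp
    let ?k = "\<lambda>x y. scaled_kernel (h n) (x - y)"
    let ?k2 = "\<lambda>x y. scaled_kernel (sqrt 2 * h n) (x - y)"
    define L where "L x = (\<integral>\<^sup>+y. ennreal (?k x y) * indicator (- S) y \<partial>lborel)" for x
    have [measurable]: "L \<in> borel_measurable borel"
      unfolding L_def by measurable
    have k: "0 \<le> ?k x y" "0 \<le> ?k2 x y" for x y using hn by (auto simp: scaled_kernel_nonneg)
    have int: "integrable lborel (?k x)" for x
      using scaled_kernel_integrable[OF hn, of x] by (simp add: scaled_kernel_commute[of _ x])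
    have int1: "(\<integral>y. ?k x y \<partial>lborel) = 1" for x
      using scaled_kernel_integral[OF hn, of x] by (simp add: scaled_kernel_commute[of _ x])
    have intp: "integrable lborel (\<lambda>y. ?k x y * p y)" for x
      by (rule Bochner_Integration.integrable_bound[OF integrable_mult_left[OF int[of x], of A]])
         (use k p_bounds A in \<open>auto intro!: AE_I2 mult_left_mono simp: abs_mult\<close>)
    have bound: "ennreal \<bar>(\<integral>y. ?k x y * p y \<partial>lborel) - p x\<bar>
        \<le> ennreal w + (ennreal (A * T n) + ennreal A * L x)" if x: "x \<in> S" for x
    proof -
      have pw: "ennreal \<bar>?k x y * (p y - p x)\<bar> \<le> ennreal w * ennreal (?k x y) +
        (ennreal (A * T n) * ennreal (?k2 x y) + ennreal A * (ennreal (?k x y) * indicator (- S) y))" for y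
      proof -
        have dp: "\<bar>p y - p x\<bar> \<le> A" using p_bounds[of x] p_bounds[of y] by (auto simp: abs_le_iff)
        consider "y \<in> S" "dist y x < r" | "dist y x \<ge> r" | "y \<notin> S" by linarith
        then show ?thesis
        proof cases
          case 1
          then have "\<bar>p y - p x\<bar> \<le> w" using r(2)[OF x, of y] by (simp add: dist_real_def)
          then have "\<bar>?k x y * (p y - p x)\<bar> \<le> w * ?k x y"
            by (simp only: abs_mult abs_of_nonneg[OF k(1)] mult.commute[of "?k x y"] mult_right_mono[OF _ k(1)])
          then have "ennreal \<bar>?k x y * (p y - p x)\<bar> \<le> ennreal w * ennreal (?k x y)"
            using w by (subst ennreal_mult'[symmetric]) (auto intro: ennreal_leI)
          then show ?thesis by (rule order_trans) simp
        next
          case 2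
          then have "?k x y \<le> T n * ?k2 x y"
            unfolding T_def using r(1) by (intro scaled_kernel_tail hn) (auto simp: dist_norm norm_minus_commute)
          then have "\<bar>?k x y * (p y - p x)\<bar> \<le> (T n * ?k2 x y) * A"
            unfolding abs_mult abs_of_nonneg[OF k(1)]
            by (rule mult_mono[OF _ dp mult_nonneg_nonneg[OF T k(2)]]) simp
          then have "ennreal \<bar>?k x y * (p y - p x)\<bar> \<le> ennreal (A * T n) * ennreal (?k2 x y)"
            using A T by (subst ennreal_mult'[symmetric]) (auto intro!: ennreal_leI simp: mult_ac)
          also have "\<dots> \<le> ennreal w * ennreal (?k x y) +
              (ennreal (A * T n) * ennreal (?k2 x y) + ennreal A * (ennreal (?k x y) * indicator (- S) y))"
            by (simp add: add_increasing add_increasing2)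
          finally show ?thesis .
        next
          case 3
          have "\<bar>?k x y * (p y - p x)\<bar> \<le> A * ?k x y"
            using dp by (simp only: abs_mult abs_of_nonneg[OF k(1)] mult.commute[of "?k x y"] mult_right_mono[OF _ k(1)])
          then have "ennreal \<bar>?k x y * (p y - p x)\<bar> \<le> ennreal A * ennreal (?k x y)"
            using A by (subst ennreal_mult'[symmetric]) (auto intro: ennreal_leI)
          also have "\<dots> = ennreal A * (ennreal (?k x y) * indicator (- S) y)" using 3 by simp
          finally have "ennreal \<bar>?k x y * (p y - p x)\<bar> \<le> ennreal A * (ennreal (?k x y) * indicator (- S) y)" .
          then show ?thesis by (rule order_trans) (simp add: add_increasing)
        qed
      qed
      have "(\<integral>y. ?k x y * p y \<partial>lborel) - p x = (\<integral>y. ?k x y * (p y - p x) \<partial>lborel)"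
        using int[of x] intp[of x] int1[of x] by (simp add: right_diff_distrib)
      also have "ennreal \<bar>\<dots>\<bar> \<le> (\<integral>\<^sup>+y. ennreal \<bar>?k x y * (p y - p x)\<bar> \<partial>lborel)"
        using integral_norm_bound_ennreal[of lborel "\<lambda>y. ?k x y * (p y - p x)"] int[of x] intp[of x]
        by (simp add: right_diff_distrib)
      also have "\<dots> \<le> (\<integral>\<^sup>+y. ennreal w * ennreal (?k x y) +
        (ennreal (A * T n) * ennreal (?k2 x y) + ennreal A * (ennreal (?k x y) * indicator (- S) y)) \<partial>lborel)"
        by (intro nn_integral_mono pw)
      also have "\<dots> = ennreal w + (ennreal (A * T n) + ennreal A * L x)"
        using hn by (simp add: nn_integral_add nn_integral_cmult nn_integral_scaled_kernel' L_def)
      finally show ?thesis .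
    qed
    have "(\<integral>\<^sup>+x. ennreal (indicator S x * \<bar>(\<integral>y. ?k x y * p y \<partial>lborel) - p x\<bar>) \<partial>lborel)
      \<le> (\<integral>\<^sup>+x. ennreal w * indicator S x + (ennreal (A * T n) * indicator S x + ennreal A * (indicator S x * L x)) \<partial>lborel)"
      by (rule nn_integral_mono) (use bound in \<open>auto simp: indicator_def\<close>)
    also have "\<dots> = ennreal w * ennreal m + (ennreal (A * T n) * ennreal m + ennreal A * (\<integral>\<^sup>+x. indicator S x * L x \<partial>lborel))"
      by (simp add: nn_integral_add nn_integral_cmult m)
    also have "\<dots> \<le> ennreal (w * m) + (ennreal (A * T n * m) + ennreal A * ennreal (\<epsilon> / (3 * (A + 1))))"
      using elim m w A T unfolding L_def by (intro add_mono mult_left_mono) (auto simp: ennreal_mult)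
    also have "\<dots> = ennreal (w * m + (A * T n * m + A * (\<epsilon> / (3 * (A + 1)))))"
      unfolding ennreal_mult'[OF A, symmetric]
      using m w A T \<open>\<epsilon> > 0\<close> by (simp flip: ennreal_plus)
    also have "\<dots> \<le> ennreal \<epsilon>"
    proof (rule ennreal_leI)
      have "A * (\<epsilon> / (3 * (A + 1))) \<le> \<epsilon> / 3"
        using A \<open>\<epsilon> > 0\<close> by (simp add: field_simps)
      then show "w * m + (A * T n * m + A * (\<epsilon> / (3 * (A + 1)))) \<le> \<epsilon>"
        using wm elim by linarith
    qed
    finally show ?case
      unfolding set_lebesgue_integral_def using \<open>\<epsilon> > 0\<close>
      by (intro integral_real_bounded) auto
  qed
qed

section \<open>The V-statistic and the misclassified volume\<close>

lemma sum_of_bool_eq_select: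
  fixes c :: "'i \<Rightarrow> real"
  assumes "finite I"
  shows "(\<Sum>i\<in>I. of_bool (y = i) * c i) = (if y \<in> I then c y else 0)"
proof -
  have "(\<Sum>i\<in>I. of_bool (y = i) * c i) = (\<Sum>i\<in>I. if y = i then c i else 0)"
    by (intro sum.cong) auto
  then show ?thesis using assms by simp
qed

lemma kde_eq_sum_class_kde:
  assumes "finite I" "\<And>l. l \<in> {1..n} \<Longrightarrow> ys l \<in> I"
  shows "kde xs n h x = (\<Sum>i\<in>I. class_kde xs ys n h i x)"
proof -
  have "(\<Sum>i\<in>I. class_kde xs ys n h i x)
      = (\<Sum>i\<in>I. \<Sum>l=1..n. scaled_kernel h (x - xs l) * of_bool (ys l = i)) / n"
    by (simp add: class_kde_def sum_divide_distrib)
  also have "(\<Sum>i\<in>I. \<Sum>l=1..n. scaled_kernel h (x - xs l) * of_bool (ys l = i))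
      = (\<Sum>l=1..n. \<Sum>i\<in>I. of_bool (ys l = i) * scaled_kernel h (x - xs l))"
    by (subst sum.swap) (simp add: mult.commute)
  also have "\<dots> = (\<Sum>l=1..n. scaled_kernel h (x - xs l))"
    using assms by (intro sum.cong refl) (simp add: sum_of_bool_eq_select)
  finally show ?thesis by (simp add: kde_def)
qed

lemma kde_pos:
  assumes "h > 0" "n \<ge> 1"
  shows "0 < kde xs n h x"
  unfolding kde_def using assms by (intro mult_pos_pos sum_pos) (auto simp: scaled_kernel_pos)

text \<open>Telescoping from \<open>1 / u^2\<close> through \<open>1 / (u * v)\<close> and
  \<open>1 / ((u + d) * v)\<close> to \<open>1 / ((u + d) * (v + e))\<close>, each step costing its
  increment over \<open>a ^ 3\<close>. In the application \<open>u\<close> and \<open>v\<close> are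
  mixture values and \<open>s\<close> and \<open>t\<close> estimators, which are positive and
  bounded above by \<open>u + d\<close> and \<open>v + e\<close>.\<close>

lemma inverse_product_lower_bound:
  fixes a u v d e s t :: real
  assumes a: "a > 0" and u: "a \<le> u" and v: "a \<le> v" and d: "0 \<le> d" and e: "0 \<le> e"
    and s: "0 < s" "s \<le> u + d" and t: "0 < t" "t \<le> v + e"
  shows "1 / u\<^sup>2 - (\<bar>u - v\<bar> + d + e) / a ^ 3 \<le> 1 / (s * t)"
proof -
  have inv_diff: "1 / x - 1 / y \<le> \<bar>x - y\<bar> / a\<^sup>2" if "a \<le> x" "a \<le> y" for x y :: real
  proof -
    have "1 / x - 1 / y = (y - x) / (x * y)" using that a by (simp add: field_simps)
    also have "\<dots> \<le> \<bar>x - y\<bar> / (x * y)" using that a by (intro divide_right_mono) auto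
    also have "\<dots> \<le> \<bar>x - y\<bar> / a\<^sup>2"
      using that a by (intro divide_left_mono) (auto simp: power2_eq_square intro: mult_mono)
    finally show ?thesis .
  qed
  have ub: "1 / x \<le> 1 / a" if "a \<le> x" for x :: real
    using that a by (intro divide_left_mono) auto
  have "1 / u\<^sup>2 - 1 / ((u + d) * (v + e))
      = 1 / u * (1 / u - 1 / v) + (1 / u - 1 / (u + d)) * (1 / v) + 1 / (u + d) * (1 / v - 1 / (v + e))"
    by (simp add: power2_eq_square algebra_simps)
  also have "\<dots> \<le> 1 / a * (\<bar>u - v\<bar> / a\<^sup>2) + \<bar>u - (u + d)\<bar> / a\<^sup>2 * (1 / a) + 1 / a * (\<bar>v - (v + e)\<bar> / a\<^sup>2)"
  proof (intro add_mono)
    have "1 / u * (1 / u - 1 / v) \<le> 1 / u * (\<bar>u - v\<bar> / a\<^sup>2)"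
      using inv_diff[OF u v] a u by (intro mult_left_mono) auto
    also have "\<dots> \<le> 1 / a * (\<bar>u - v\<bar> / a\<^sup>2)" using ub[OF u] by (intro mult_right_mono) auto
    finally show "1 / u * (1 / u - 1 / v) \<le> 1 / a * (\<bar>u - v\<bar> / a\<^sup>2)" .
    show "(1 / u - 1 / (u + d)) * (1 / v) \<le> \<bar>u - (u + d)\<bar> / a\<^sup>2 * (1 / a)"
      using inv_diff[of u "u + d"] ub[OF v] a u v d by (intro mult_mono) auto
    have "1 / v - 1 / (v + e) \<ge> 0" using v e a by (simp add: field_simps)
    then show "1 / (u + d) * (1 / v - 1 / (v + e)) \<le> 1 / a * (\<bar>v - (v + e)\<bar> / a\<^sup>2)"
      using inv_diff[of v "v + e"] ub[of "u + d"] a u v d e by (intro mult_mono) auto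
  qed
  also have "\<dots> = (\<bar>u - v\<bar> + d + e) / a ^ 3"
    using a d e by (simp add: power2_eq_square power3_eq_cube add_divide_distrib)
  finally have "1 / u\<^sup>2 - (\<bar>u - v\<bar> + d + e) / a ^ 3 \<le> 1 / ((u + d) * (v + e))" by simp
  also have "\<dots> \<le> 1 / (s * t)"
    using assms by (intro divide_left_mono mult_mono) auto
  finally show ?thesis .
qed

text \<open>A deterministic estimate for one realised sample. The estimators in the denominator are
  traded for the mixture at \<open>xs l\<close>; the row sum over \<open>m\<close> then counts the
  classes other than \<open>ys l\<close>. The estimation error \<open>D\<close> is an average over
  the sample points and not a supremum, because the bias is not uniformly small. The row sums of the
  kernel matrix are at most \<open>n * B\<close>, which converts weighted errors into
  \<open>D\<close>.\<close>

lemma V_statistic_lower_bound: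
  fixes xs :: "nat \<Rightarrow> real ^ 'd" and ys :: "nat \<Rightarrow> nat" and p :: "nat \<Rightarrow> real ^ 'd \<Rightarrow> real"
  assumes h: "h > 0" and n: "n \<ge> 1" and I: "finite I"
    and data: "\<And>l. l \<in> {1..n} \<Longrightarrow> xs l \<in> S" "\<And>l. l \<in> {1..n} \<Longrightarrow> ys l \<in> I"
    and p: "\<And>i x. 0 \<le> p i x"
    and a: "a > 0" and g: "\<And>x. x \<in> S \<Longrightarrow> a \<le> (\<Sum>i\<in>I. p i x)" "\<And>x. x \<in> S \<Longrightarrow> (\<Sum>i\<in>I. p i x) \<le> G"
    and B: "\<And>l. l \<in> {1..n} \<Longrightarrow> kde xs n h (xs l) \<le> B"
    and near: "\<And>x y. x \<in> S \<Longrightarrow> y \<in> S \<Longrightarrow> norm (x - y) < r \<Longrightarrow> \<bar>(\<Sum>i\<in>I. p i x) - (\<Sum>i\<in>I. p i y)\<bar> \<le> w"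
    and far: "\<And>z :: real ^ 'd. r \<le> norm z \<Longrightarrow> scaled_kernel h z \<le> \<kappa>"
    and w: "0 \<le> w" and \<kappa>: "0 \<le> \<kappa>"
    and D: "(\<Sum>l=1..n. \<Sum>i\<in>I. \<bar>class_kde xs ys n h i (xs l) - p i (xs l)\<bar>) / n \<le> D"
  shows "(\<Sum>l=1..n. (1 - p (ys l) (xs l) / (\<Sum>i\<in>I. p i (xs l))) / (\<Sum>i\<in>I. p i (xs l))) / n
      - (2 * B / a ^ 3 + 1 / a\<^sup>2) * D - (w * B + G * \<kappa>) / a ^ 3
    \<le> (\<Sum>l=1..n. \<Sum>m=1..n. of_bool (ys l \<noteq> ys m) * V_kernel xs n h (xs l) (xs m)) / (real n)\<^sup>2"
proof -
  let ?I = "{1..n}"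
  define g' where "g' l = (\<Sum>i\<in>I. p i (xs l))" for l
  define P where "P i l = class_kde xs ys n h i (xs l)" for i l
  define e where "e l = (\<Sum>i\<in>I. \<bar>P i l - p i (xs l)\<bar>)" for l
  define f where "f l = kde xs n h (xs l)" for l
  define K where "K l m = scaled_kernel h (xs l - xs m)" for l m
  define \<theta> :: "nat \<Rightarrow> nat \<Rightarrow> real" where "\<theta> l m = of_bool (ys l \<noteq> ys m)" for l m
  have n0: "real n > 0" using n by simp
  have K: "0 \<le> K l m" "K l m = K m l" for l m
    using h by (simp_all add: K_def scaled_kernel_nonneg scaled_kernel_commute[of h "xs l"])
  have e: "0 \<le> e l" for l by (simp add: e_def sum_nonneg)
  have g': "a \<le> g' l" "g' l \<le> G" if "l \<in> ?I" for l using g data that by (auto simp: g'_def)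
  have f_sum: "f l = (\<Sum>i\<in>I. P i l)" for l
    unfolding f_def P_def using I data(2) by (rule kde_eq_sum_class_kde)
  have f_pos: "0 < f l" for l unfolding f_def using h n by (rule kde_pos)
  have f_K: "(\<Sum>m\<in>?I. K l m) = n * f l" for l
    unfolding f_def kde_def K_def using n0 by simp
  have f_le: "f l \<le> g' l + e l" for l
    unfolding f_sum g'_def e_def sum.distrib[symmetric] by (intro sum_mono) auto
  have fB: "f l \<le> B" if "l \<in> ?I" for l using B that by (simp add: f_def)
  have B0: "0 \<le> B" using fB[of 1] f_pos[of 1] n by simp
  \<comment> \<open>The change of the mixture between \<open>xs l\<close> and \<open>xs m\<close> is
    charged to \<open>w\<close> for close pairs and to \<open>\<kappa>\<close> for distant ones; the
    errors of the two estimators enter as \<open>e l\<close> and \<open>e m\<close>.\<close>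
  have summand: "\<theta> l m * K l m / (g' l)\<^sup>2 - (K l m * w + G * \<kappa> + K l m * e l + K l m * e m) / a ^ 3
      \<le> \<theta> l m * V_kernel xs n h (xs l) (xs m)" if l: "l \<in> ?I" and m: "m \<in> ?I" for l m
  proof -
    have G0: "0 \<le> G" using g'[OF l] a by simp
    have dist: "K l m * \<bar>g' l - g' m\<bar> \<le> K l m * w + G * \<kappa>"
    proof (cases "norm (xs l - xs m) < r")
      case True
      then have "\<bar>g' l - g' m\<bar> \<le> w" using near data l m by (simp add: g'_def)
      then have "K l m * \<bar>g' l - g' m\<bar> \<le> K l m * w" using K by (intro mult_left_mono) auto
      then show ?thesis using G0 \<kappa> by (simp add: add_increasing2)
    next
      case False
      then have "K l m \<le> \<kappa>" using far by (simp add: K_def)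
      moreover have "\<bar>g' l - g' m\<bar> \<le> G" using g'[OF l] g'[OF m] a by (simp add: abs_le_iff)
      ultimately have "K l m * \<bar>g' l - g' m\<bar> \<le> \<kappa> * G" using K \<kappa> by (intro mult_mono) auto
      then show ?thesis using K w by (simp add: mult.commute add_increasing)
    qed
    have \<theta>K: "0 \<le> \<theta> l m * K l m" "\<theta> l m * K l m \<le> K l m"
      using K by (auto simp: \<theta>_def)
    have nn: "0 \<le> (\<bar>g' l - g' m\<bar> + e l + e m) / a ^ 3" using e a by simp
    have "\<theta> l m * K l m * (1 / (g' l)\<^sup>2 - (\<bar>g' l - g' m\<bar> + e l + e m) / a ^ 3)
        \<le> \<theta> l m * K l m * (1 / (f l * f m))"
      using a g'(1)[OF l] g'(1)[OF m] e f_pos f_le \<theta>K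
      by (intro mult_left_mono inverse_product_lower_bound) auto
    moreover have "\<theta> l m * K l m * ((\<bar>g' l - g' m\<bar> + e l + e m) / a ^ 3)
        \<le> K l m * ((\<bar>g' l - g' m\<bar> + e l + e m) / a ^ 3)"
      using \<theta>K nn by (intro mult_right_mono)
    moreover have "K l m * ((\<bar>g' l - g' m\<bar> + e l + e m) / a ^ 3)
        \<le> (K l m * w + G * \<kappa> + K l m * e l + K l m * e m) / a ^ 3"
      using dist a by (simp add: divide_right_mono distrib_left)
    moreover have "\<theta> l m * K l m * (1 / (f l * f m)) = \<theta> l m * V_kernel xs n h (xs l) (xs m)"
      by (simp add: V_kernel_def K_def f_def)
    ultimately show ?thesis by (simp add: right_diff_distrib)
  qed
  have main: "n * ((1 - p (ys l) (xs l) / g' l) / g' l - e l / a\<^sup>2) \<le> (\<Sum>m\<in>?I. \<theta> l m * K l m / (g' l)\<^sup>2)"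
    if l: "l \<in> ?I" for l
  proof -
    have y: "ys l \<in> I" using data l by simp
    have gl: "g' l > 0" using g'(1)[OF l] a by simp
    \<comment> \<open>Removing the class of \<open>l\<close> from the row sum leaves the estimators
      of the remaining classes, whose target is \<open>g' l - p (ys l) (xs l)\<close>.\<close>
    have "(\<Sum>m\<in>?I. \<theta> l m * K l m) = (\<Sum>m\<in>?I. K l m - K l m * of_bool (ys m = ys l))"
      by (intro sum.cong) (auto simp: \<theta>_def)
    also have "\<dots> = n * f l - n * P (ys l) l"
      unfolding sum_subtractf f_K unfolding P_def class_kde_def K_def using n0 by simp
    also have "f l = P (ys l) l + (\<Sum>i\<in>I - {ys l}. P i l)"
      unfolding f_sum using I y by (simp add: sum.remove)
    finally have sum_eq: "(\<Sum>m\<in>?I. \<theta> l m * K l m) = n * (\<Sum>i\<in>I - {ys l}. P i l)"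
      by (simp add: distrib_left)
    have "g' l - p (ys l) (xs l) - e l \<le> (\<Sum>i\<in>I - {ys l}. p i (xs l)) - (\<Sum>i\<in>I - {ys l}. \<bar>P i l - p i (xs l)\<bar>)"
      unfolding g'_def e_def sum.remove[OF I y] by simp
    also have "\<dots> \<le> (\<Sum>i\<in>I - {ys l}. P i l)"
      unfolding sum_subtractf[symmetric] by (intro sum_mono) auto
    finally have "n * ((g' l - p (ys l) (xs l) - e l) / (g' l)\<^sup>2) \<le> n * ((\<Sum>i\<in>I - {ys l}. P i l) / (g' l)\<^sup>2)"
      using n0 by (intro mult_left_mono divide_right_mono) auto
    also have "\<dots> = (\<Sum>m\<in>?I. \<theta> l m * K l m / (g' l)\<^sup>2)"
      unfolding sum_divide_distrib[symmetric] sum_eq by simp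
    finally have 1: "n * ((g' l - p (ys l) (xs l) - e l) / (g' l)\<^sup>2) \<le> (\<Sum>m\<in>?I. \<theta> l m * K l m / (g' l)\<^sup>2)" .
    have "e l / (g' l)\<^sup>2 \<le> e l / a\<^sup>2"
      using e a g'(1)[OF l] gl by (intro divide_left_mono power_mono) auto
    moreover have "(g' l - p (ys l) (xs l) - e l) / (g' l)\<^sup>2 = (1 - p (ys l) (xs l) / g' l) / g' l - e l / (g' l)\<^sup>2"
      using gl by (simp add: field_simps power2_eq_square)
    ultimately have "(1 - p (ys l) (xs l) / g' l) / g' l - e l / a\<^sup>2 \<le> (g' l - p (ys l) (xs l) - e l) / (g' l)\<^sup>2"
      by linarith
    then have "n * ((1 - p (ys l) (xs l) / g' l) / g' l - e l / a\<^sup>2) \<le> n * ((g' l - p (ys l) (xs l) - e l) / (g' l)\<^sup>2)"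
      using n0 by (intro mult_left_mono) auto
    then show ?thesis using 1 by linarith
  qed
  let ?E = "\<Sum>l\<in>?I. e l"
  let ?W = "\<Sum>l\<in>?I. (1 - p (ys l) (xs l) / g' l) / g' l"
  have fe: "(\<Sum>l\<in>?I. f l * e l) \<le> B * ?E"
    unfolding sum_distrib_left using fB e by (intro sum_mono mult_right_mono) auto
  have s1: "(\<Sum>l\<in>?I. \<Sum>m\<in>?I. K l m * w) \<le> n\<^sup>2 * (w * B)"
  proof -
    have "(\<Sum>l\<in>?I. \<Sum>m\<in>?I. K l m * w) = (\<Sum>l\<in>?I. n * f l * w)"
      by (simp only: f_K sum_distrib_right[symmetric])
    also have "\<dots> \<le> (\<Sum>l\<in>?I. n * B * w)"
      using fB w by (intro sum_mono mult_right_mono mult_left_mono) auto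
    finally show ?thesis by (simp add: power2_eq_square mult_ac)
  qed
  have s2: "(\<Sum>l\<in>?I. \<Sum>m\<in>?I. K l m * e l) \<le> n * (B * ?E)"
  proof -
    have "(\<Sum>l\<in>?I. \<Sum>m\<in>?I. K l m * e l) = n * (\<Sum>l\<in>?I. f l * e l)"
      by (simp only: f_K sum_distrib_right[symmetric]) (simp add: sum_distrib_left mult.assoc)
    then show ?thesis using fe n0 by (simp add: mult_left_mono)
  qed
  \<comment> \<open>Symmetry of the kernel matrix moves the error from the column index to the row
    index, which accounts for the 2 in \<open>2 * B / a ^ 3\<close>.\<close>
  have s3: "(\<Sum>l\<in>?I. \<Sum>m\<in>?I. K l m * e m) \<le> n * (B * ?E)"
  proof -
    have "(\<Sum>l\<in>?I. \<Sum>m\<in>?I. K l m * e m) = (\<Sum>l\<in>?I. \<Sum>m\<in>?I. K l m * e l)"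
      by (subst sum.swap) (simp add: K(2))
    then show ?thesis using s2 by simp
  qed
  have "n * (?W - ?E / a\<^sup>2) = (\<Sum>l\<in>?I. n * ((1 - p (ys l) (xs l) / g' l) / g' l - e l / a\<^sup>2))"
    by (simp only: sum_subtractf sum_divide_distrib sum_distrib_left[symmetric])
  also have "\<dots> \<le> (\<Sum>l\<in>?I. \<Sum>m\<in>?I. \<theta> l m * K l m / (g' l)\<^sup>2)"
    by (intro sum_mono main)
  finally have lower: "n * (?W - ?E / a\<^sup>2) \<le> (\<Sum>l\<in>?I. \<Sum>m\<in>?I. \<theta> l m * K l m / (g' l)\<^sup>2)" .
  have s4: "(\<Sum>l\<in>?I. \<Sum>m\<in>?I. G * \<kappa>) = n\<^sup>2 * (G * \<kappa>)"
    by (simp add: power2_eq_square)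
  have "(\<Sum>l\<in>?I. \<Sum>m\<in>?I. K l m * w + G * \<kappa> + K l m * e l + K l m * e m)
      \<le> n\<^sup>2 * (w * B) + n\<^sup>2 * (G * \<kappa>) + n * (B * ?E) + n * (B * ?E)"
    using s1 s2 s3 s4 unfolding sum.distrib by linarith
  then have upper: "(\<Sum>l\<in>?I. \<Sum>m\<in>?I. (K l m * w + G * \<kappa> + K l m * e l + K l m * e m) / a ^ 3)
      \<le> (n\<^sup>2 * (w * B + G * \<kappa>) + n * (2 * B * ?E)) / a ^ 3"
    unfolding sum_divide_distrib[symmetric] using a by (intro divide_right_mono) (auto simp: algebra_simps)
  have "(\<Sum>l\<in>?I. \<Sum>m\<in>?I. \<theta> l m * K l m / (g' l)\<^sup>2
        - (K l m * w + G * \<kappa> + K l m * e l + K l m * e m) / a ^ 3)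
      \<le> (\<Sum>l\<in>?I. \<Sum>m\<in>?I. \<theta> l m * V_kernel xs n h (xs l) (xs m))"
    by (intro sum_mono summand)
  then have "n * (?W - ?E / a\<^sup>2) - (n\<^sup>2 * (w * B + G * \<kappa>) + n * (2 * B * ?E)) / a ^ 3
      \<le> (\<Sum>l\<in>?I. \<Sum>m\<in>?I. \<theta> l m * V_kernel xs n h (xs l) (xs m))"
    using lower upper unfolding sum_subtractf by linarith
  then have "(n * (?W - ?E / a\<^sup>2) - (n\<^sup>2 * (w * B + G * \<kappa>) + n * (2 * B * ?E)) / a ^ 3) / n\<^sup>2
      \<le> (\<Sum>l\<in>?I. \<Sum>m\<in>?I. \<theta> l m * V_kernel xs n h (xs l) (xs m)) / n\<^sup>2"
    by (rule divide_right_mono) simp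
  also have "(n * (?W - ?E / a\<^sup>2) - (n\<^sup>2 * (w * B + G * \<kappa>) + n * (2 * B * ?E)) / a ^ 3) / n\<^sup>2
      = ?W / n - (2 * B / a ^ 3 + 1 / a\<^sup>2) * (?E / n) - (w * B + G * \<kappa>) / a ^ 3"
    using n0 a by (simp add: field_simps power2_eq_square)
  finally have "?W / n - (2 * B / a ^ 3 + 1 / a\<^sup>2) * (?E / n) - (w * B + G * \<kappa>) / a ^ 3
      \<le> (\<Sum>l\<in>?I. \<Sum>m\<in>?I. \<theta> l m * V_kernel xs n h (xs l) (xs m)) / n\<^sup>2" .
  moreover have "(2 * B / a ^ 3 + 1 / a\<^sup>2) * (?E / n) \<le> (2 * B / a ^ 3 + 1 / a\<^sup>2) * D"
    using D B0 a unfolding e_def P_def by (intro mult_left_mono) auto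
  ultimately show ?thesis unfolding g'_def \<theta>_def by simp
qed

section \<open>Upper bound for the misclassified volume\<close>

lemma set_integrable_bounded:
  fixes f :: "'a \<Rightarrow> real"
  assumes "A \<in> sets M" "f \<in> borel_measurable M" "emeasure M A < \<infinity>" "\<And>x. x \<in> A \<Longrightarrow> \<bar>f x\<bar> \<le> c"
  shows "set_integrable M A f"
  unfolding set_integrable_def
  by (rule integrableI_bounded_set_indicator[where B = c]) (use assms in auto)

lemma
  fixes f :: "'i \<Rightarrow> 'a \<Rightarrow> real"
  assumes "\<And>i. i \<in> I \<Longrightarrow> set_integrable M A (f i)"
  shows set_integrable_sum: "set_integrable M A (\<lambda>x. \<Sum>i\<in>I. f i x)"
    and set_integral_sum: "(LINT x:A|M. (\<Sum>i\<in>I. f i x)) = (\<Sum>i\<in>I. LINT x:A|M. f i x)"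
  using assms unfolding set_integrable_def set_lebesgue_integral_def
  by (simp_all add: scaleR_sum_right sum_distrib_left)

text \<open>A version of the posterior is determined only almost everywhere on \<open>S\<close>;
  this allows it to be replaced by the ratio of densities.\<close>

lemma misclassified_volume_cong_AE:
  assumes [measurable]: "S \<in> sets borel" "F \<in> borel \<rightarrow>\<^sub>M count_space UNIV"
    and "\<And>i. i \<in> {1..Q} \<Longrightarrow> \<eta> i \<in> borel_measurable borel" "\<And>i. i \<in> {1..Q} \<Longrightarrow> \<zeta> i \<in> borel_measurable borel"
    and AE: "\<And>i. i \<in> {1..Q} \<Longrightarrow> AE x in lborel. x \<in> S \<longrightarrow> \<eta> i x = \<zeta> i x"
  shows "misclassified_volume S Q \<eta> F = misclassified_volume S Q \<zeta> F"
  unfolding misclassified_volume_def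
proof (intro sum.cong refl)
  fix i j assume i: "i \<in> {1..Q}"
  note [measurable] = assms(3,4)[OF i]
  show "(LINT x:S|lborel. \<eta> i x * of_bool (F x = j)) = (LINT x:S|lborel. \<zeta> i x * of_bool (F x = j))"
  proof (rule set_lebesgue_integral_cong_AE)
    show "AE x\<in>S in lborel. \<eta> i x * of_bool (F x = j) = \<zeta> i x * of_bool (F x = j)"
      using AE[OF i] by eventually_elim simp
  qed measurable
qed

text \<open>A maximiser of the estimators \<open>P\<close> nearly maximises \<open>p\<close>, with a
  loss bounded by the total estimation error. The integrand of the volume is
  \<open>1 - p (F x) x / g x\<close>, which is then compared with the sum of
  \<open>\<eta>\<^sub>i (1 - \<eta>\<^sub>i)\<close> for the ratios
  \<open>\<eta>\<^sub>i = p\<^sub>i / g\<close>. The intermediate \<open>q\<close> separates the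
  uniform error \<open>\<epsilon>\<close> of \<open>P\<close> from the bias, which enters only
  through its integral.\<close>

lemma misclassified_volume_le:
  fixes p q P :: "nat \<Rightarrow> real ^ 'd \<Rightarrow> real" and F :: "real ^ 'd \<Rightarrow> nat"
  assumes S [measurable]: "S \<in> sets borel" and fin: "emeasure lborel S < \<infinity>"
    and p [measurable]: "\<And>i. p i \<in> borel_measurable borel"
    and p0: "\<And>i x. 0 \<le> p i x" and pA: "\<And>i x. p i x \<le> A"
    and a: "a > 0" and g: "\<And>x. x \<in> S \<Longrightarrow> a \<le> (\<Sum>i=1..Q. p i x)"
    and q [measurable]: "\<And>i. q i \<in> borel_measurable borel" and q_bounds: "\<And>i x. 0 \<le> q i x" "\<And>i x. q i x \<le> A"
    and F [measurable]: "F \<in> borel \<rightarrow>\<^sub>M count_space UNIV"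
    and argmax: "\<And>x. F x \<in> {1..Q}" "\<And>x i. i \<in> {1..Q} \<Longrightarrow> P i x \<le> P (F x) x"
    and close: "\<And>i x. i \<in> {1..Q} \<Longrightarrow> x \<in> S \<Longrightarrow> \<bar>P i x - q i x\<bar> \<le> \<epsilon>"
  shows "misclassified_volume S Q (\<lambda>i x. p i x / (\<Sum>j=1..Q. p j x)) F
    \<le> (LINT x:S|lborel. (\<Sum>i=1..Q. p i x / (\<Sum>j=1..Q. p j x) * (1 - p i x / (\<Sum>j=1..Q. p j x))))
      + ((\<Sum>i=1..Q. LINT x:S|lborel. \<bar>q i x - p i x\<bar>) + Q * \<epsilon> * measure lborel S) / a"
proof -
  define g where "g x = (\<Sum>i=1..Q. p i x)" for x
  have g_meas [measurable]: "g \<in> borel_measurable borel" unfolding g_def by measurable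
  have ga: "a \<le> g x" if "x \<in> S" for x using assms that by (simp add: g_def)
  have p_le_g: "p i x \<le> g x" if "i \<in> {1..Q}" for i x
    unfolding g_def by (rule member_le_sum[OF that]) (use p0 in auto)
  have ratio: "0 \<le> p i x / g x" "p i x / g x \<le> 1" if "i \<in> {1..Q}" "x \<in> S" for i x
    using p0[of i x] p_le_g[OF that(1), of x] ga[OF that(2)] a by (auto simp: divide_le_eq)
  define J where "J x = (\<Sum>i=1..Q. p i x / g x * (1 - p i x / g x))" for x
  define e where "e x = (\<Sum>i=1..Q. \<bar>q i x - p i x\<bar>)" for x
  have int1: "set_integrable lborel S (\<lambda>x. p i x / g x * of_bool (F x = j))" if "i \<in> {1..Q}" for i j
  proof (rule set_integrable_bounded[where c = 1])
    fix x assume "x \<in> S"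
    then show "\<bar>p i x / g x * of_bool (F x = j)\<bar> \<le> 1"
      using ratio[OF that, of x] by (cases "F x = j") (simp_all only: of_bool_eq, simp_all)
  qed (use fin in auto)
  have intJ: "set_integrable lborel S J"
    unfolding J_def
  proof (rule set_integrable_sum, rule set_integrable_bounded[where c = 1])
    fix i x assume "i \<in> {1..Q}" "x \<in> S"
    then have "0 \<le> p i x / g x" "p i x / g x \<le> 1" using ratio by auto
    then have "\<bar>p i x / g x\<bar> * \<bar>1 - p i x / g x\<bar> \<le> 1 * 1" by (intro mult_mono) auto
    then show "\<bar>p i x / g x * (1 - p i x / g x)\<bar> \<le> 1" by (simp add: abs_mult)
  qed (use fin in auto)
  have inte_i: "set_integrable lborel S (\<lambda>x. \<bar>q i x - p i x\<bar>)" for i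
  proof (rule set_integrable_bounded[where c = A])
    show "\<bar>\<bar>q i x - p i x\<bar>\<bar> \<le> A" for x
      using p0[of i x] pA[of i x] q_bounds(1)[of i x] q_bounds(2)[of i x] by (simp add: abs_le_iff)
  qed (use fin in auto)
  have inte: "set_integrable lborel S e"
    unfolding e_def by (intro set_integrable_sum inte_i)
  have intc: "set_integrable lborel S (\<lambda>x. Q * \<epsilon>)"
    by (rule set_integrable_bounded[where c = "\<bar>Q * \<epsilon>\<bar>"]) (use fin in auto)
  have pointwise: "(\<Sum>i=1..Q. \<Sum>j\<in>{1..Q} - {i}. p i x / g x * of_bool (F x = j))
      \<le> J x + (e x + Q * \<epsilon>) / a" if x: "x \<in> S" for x
  proof -
    have gx: "g x > 0" using ga[OF x] a by simp
    have sum1: "(\<Sum>i=1..Q. p i x / g x) = 1"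
      using gx by (simp add: g_def flip: sum_divide_distrib)
    have err: "p i x - p (F x) x \<le> e x + Q * \<epsilon>" if i: "i \<in> {1..Q}" for i
    proof -
      define E where "E i = \<bar>q i x - p i x\<bar> + \<epsilon>" for i
      have E: "\<bar>P i x - p i x\<bar> \<le> E i" if "i \<in> {1..Q}" for i
        using close[OF that x] by (simp add: E_def)
      then have E0: "0 \<le> E i" if "i \<in> {1..Q}" for i using E[OF that] by linarith
      have "p i x - p (F x) x \<le> (\<Sum>i=1..Q. E i)"
      proof (cases "i = F x")
        case True
        moreover have "0 \<le> (\<Sum>i=1..Q. E i)" using E0 by (rule sum_nonneg)
        ultimately show ?thesis by simp
      next
        case False
        \<comment> \<open>For \<open>i \<noteq> F x\<close> the two errors are different terms of
          the total, so the total bounds their sum without a factor 2.\<close>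
        have "p i x - p (F x) x \<le> E i + E (F x)"
          using E[OF i] E[OF argmax(1)[of x]] argmax(2)[OF i, of x] by linarith
        also have "\<dots> = sum E {i, F x}" using False by simp
        also have "\<dots> \<le> sum E {1..Q}"
          using i argmax(1)[of x] E0 by (intro sum_mono2) auto
        finally show ?thesis .
      qed
      also have "\<dots> = e x + Q * \<epsilon>" by (simp add: E_def e_def sum.distrib)
      finally show ?thesis .
    qed
    have e0: "0 \<le> e x + Q * \<epsilon>" using err[OF argmax(1)[of x]] by simp
    have "(\<Sum>i=1..Q. \<Sum>j\<in>{1..Q} - {i}. p i x / g x * of_bool (F x = j))
        = (\<Sum>i=1..Q. p i x / g x - p i x / g x * of_bool (F x = i))"
    proof (intro sum.cong refl)
      fix i assume i: "i \<in> {1..Q}"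
      have "(\<Sum>j\<in>{1..Q} - {i}. p i x / g x * of_bool (F x = j))
          = (\<Sum>j\<in>{1..Q} - {i}. of_bool (F x = j) * (p i x / g x))"
        by (simp add: mult.commute)
      also have "\<dots> = (if F x \<in> {1..Q} - {i} then p i x / g x else 0)"
        by (rule sum_of_bool_eq_select) simp
      also have "\<dots> = p i x / g x - p i x / g x * of_bool (F x = i)"
        using argmax(1)[of x] by auto
      finally show "(\<Sum>j\<in>{1..Q} - {i}. p i x / g x * of_bool (F x = j))
          = p i x / g x - p i x / g x * of_bool (F x = i)" .
    qed
    also have "\<dots> = 1 - (\<Sum>i=1..Q. of_bool (F x = i) * (p i x / g x))"
      by (simp only: sum_subtractf sum1 mult.commute)
    also have "\<dots> = 1 - p (F x) x / g x"
      using argmax(1)[of x] by (subst sum_of_bool_eq_select) auto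
    \<comment> \<open>Writing 1 as the sum of the posterior weights reduces the bound to a termwise
      comparison of class \<open>F x\<close> with class \<open>i\<close>.\<close>
    also have "\<dots> = (\<Sum>i=1..Q. p i x / g x * (1 - p (F x) x / g x))"
      by (simp only: sum_distrib_right[symmetric] sum1) simp
    also have "\<dots> \<le> (\<Sum>i=1..Q. p i x / g x * (1 - p i x / g x + (e x + Q * \<epsilon>) / a))"
    proof (intro sum_mono mult_left_mono)
      fix i assume i: "i \<in> {1..Q}"
      have "(p i x - p (F x) x) / g x \<le> (e x + Q * \<epsilon>) / g x"
        using err[OF i] gx by (intro divide_right_mono) auto
      also have "\<dots> \<le> (e x + Q * \<epsilon>) / a"
        using e0 ga[OF x] a by (intro divide_left_mono) auto
      finally show "1 - p (F x) x / g x \<le> 1 - p i x / g x + (e x + Q * \<epsilon>) / a"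
        by (simp add: diff_divide_distrib)
    qed (use ratio x in auto)
    also have "\<dots> = J x + (e x + Q * \<epsilon>) / a"
      unfolding distrib_left[of _ "1 - _"] sum.distrib sum_distrib_right[symmetric] sum1 J_def by simp
    finally show ?thesis .
  qed
  have "misclassified_volume S Q (\<lambda>i x. p i x / g x) F
      = (LINT x:S|lborel. (\<Sum>i=1..Q. \<Sum>j\<in>{1..Q} - {i}. p i x / g x * of_bool (F x = j)))"
    unfolding misclassified_volume_def
    by (subst set_integral_sum, intro set_integrable_sum int1, assumption)
       (intro sum.cong refl set_integral_sum[symmetric] int1)
  also have "\<dots> \<le> (LINT x:S|lborel. J x + (e x + Q * \<epsilon>) / a)"
    by (intro set_integral_mono pointwise set_integrable_sum int1 set_integral_add set_integrable_divide
        intJ inte intc) auto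
  also have "\<dots> = (LINT x:S|lborel. J x) + ((LINT x:S|lborel. e x) + (LINT x:S|lborel. Q * \<epsilon>)) / a"
    using intJ inte intc by (simp add: set_integral_add set_integrable_divide)
  also have "(LINT x:S|lborel. e x) = (\<Sum>i=1..Q. LINT x:S|lborel. \<bar>q i x - p i x\<bar>)"
    unfolding e_def by (intro set_integral_sum inte_i)
  also have "(LINT x:S|lborel. Q * \<epsilon>) = Q * \<epsilon> * measure lborel S"
    using fin by (simp add: set_lebesgue_integral_def mult.commute)
  finally show ?thesis unfolding J_def g_def .
qed

section \<open>Asymptotics for the plug-in classifier\<close>

text \<open>Here \<open>p i\<close> stands for \<open>\<pi>\<^sup>(\<^sup>i\<^sup>) f\<^sup>(\<^sup>i\<^sup>)\<close> restricted to \<open>S\<close>.\<close>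

locale plugin_model = prob_space M for M :: "'w measure" +
  fixes X :: "'w \<Rightarrow> real ^ 'd" and Y :: "'w \<Rightarrow> nat" and S :: "(real ^ 'd) set" and Q :: nat
    and p :: "nat \<Rightarrow> real ^ 'd \<Rightarrow> real" and a A :: real
  assumes X_meas [measurable]: "X \<in> M \<rightarrow>\<^sub>M borel"
    and Y_meas [measurable]: "Y \<in> M \<rightarrow>\<^sub>M count_space UNIV"
    and S_meas [measurable]: "S \<in> sets borel" and S_bounded: "bounded S"
    and data_in: "AE \<omega> in M. X \<omega> \<in> S \<and> Y \<omega> \<in> {1..Q}"
    and p_meas [measurable]: "\<And>i. p i \<in> borel_measurable borel"
    and p_nonneg: "\<And>i x. 0 \<le> p i x" and p_le: "\<And>i x. p i x \<le> A"
    and p_off: "\<And>i x. x \<notin> S \<Longrightarrow> p i x = 0"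
    and p_cont: "\<And>i. uniformly_continuous_on S (p i)"
    and a_pos: "0 < a" and sum_p_ge: "\<And>x. x \<in> S \<Longrightarrow> a \<le> (\<Sum>i=1..Q. p i x)"
    and law: "\<And>i \<phi>. i \<in> {1..Q} \<Longrightarrow> \<phi> \<in> borel_measurable borel \<Longrightarrow>
      (\<integral>\<^sup>+\<omega>. \<phi> (X \<omega>) * indicator {i} (Y \<omega>) \<partial>M) = (\<integral>\<^sup>+x. \<phi> x * ennreal (p i x) \<partial>lborel)"
begin

definition mixture :: "real ^ 'd \<Rightarrow> real" where "mixture x = (\<Sum>i=1..Q. p i x)"

definition smoothed :: "real \<Rightarrow> nat \<Rightarrow> real ^ 'd \<Rightarrow> real" where
  "smoothed h i x = (\<integral>y. scaled_kernel h (x - y) * p i y \<partial>lborel)"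

text \<open>The Gini impurity of the posterior integrated over \<open>S\<close>: at each point, the
  probability that two labels drawn independently from the posterior differ.\<close>

definition impurity :: real where
  "impurity = (LINT x:S|lborel. (\<Sum>i=1..Q. p i x / mixture x * (1 - p i x / mixture x)))"

lemma mixture_meas [measurable]: "mixture \<in> borel_measurable borel"
  unfolding mixture_def[abs_def] by measurable

lemma A_nonneg: "0 \<le> A"
  using p_nonneg p_le order_trans by blast

lemma mixture_ge: "x \<in> S \<Longrightarrow> a \<le> mixture x"
  using sum_p_ge by (simp only: mixture_def)

lemma mixture_le: "mixture x \<le> Q * A"
  unfolding mixture_def using sum_bounded_above[of "{1..Q}" "\<lambda>i. p i x" A] p_le by simp

lemma S_finite: "emeasure lborel S < \<infinity>"
  using S_bounded by (rule emeasure_bounded_finite)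

lemma ratio_bounds:
  assumes "i \<in> {1..Q}" "x \<in> S"
  shows "0 \<le> p i x / mixture x" "p i x / mixture x \<le> 1"
proof -
  have "p i x \<le> mixture x" unfolding mixture_def by (rule member_le_sum[OF assms(1)]) (use p_nonneg in auto)
  then show "0 \<le> p i x / mixture x" "p i x / mixture x \<le> 1"
    using mixture_ge[OF assms(2)] a_pos p_nonneg[of i x] by (simp_all add: divide_le_eq)
qed

lemma impurity_integrand_integrable:
  assumes "i \<in> {1..Q}"
  shows "set_integrable lborel S (\<lambda>x. p i x / mixture x * (1 - p i x / mixture x))"
proof (rule set_integrable_bounded[where c = 1])
  fix x assume "x \<in> S"
  then have "0 \<le> p i x / mixture x" "p i x / mixture x \<le> 1" using ratio_bounds[OF assms] by auto
  then have "\<bar>p i x / mixture x\<bar> * \<bar>1 - p i x / mixture x\<bar> \<le> 1 * 1" by (intro mult_mono) auto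
  then show "\<bar>p i x / mixture x * (1 - p i x / mixture x)\<bar> \<le> 1" by (simp add: abs_mult)
qed (use S_finite in auto)

lemma expectation_class:
  assumes i: "i \<in> {1..Q}" and [measurable]: "\<phi> \<in> borel_measurable borel" and \<phi>: "\<And>x. 0 \<le> \<phi> x"
  shows "expectation (\<lambda>\<omega>. \<phi> (X \<omega>) * of_bool (Y \<omega> = i)) = (\<integral>x. \<phi> x * p i x \<partial>lborel)"
proof -
  have "expectation (\<lambda>\<omega>. \<phi> (X \<omega>) * of_bool (Y \<omega> = i))
      = enn2real (\<integral>\<^sup>+\<omega>. ennreal (\<phi> (X \<omega>) * of_bool (Y \<omega> = i)) \<partial>M)"
    by (rule integral_eq_nn_integral) (auto simp: \<phi>)
  also have "(\<integral>\<^sup>+\<omega>. ennreal (\<phi> (X \<omega>) * of_bool (Y \<omega> = i)) \<partial>M)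
      = (\<integral>\<^sup>+\<omega>. ennreal (\<phi> (X \<omega>)) * indicator {i} (Y \<omega>) \<partial>M)"
    by (intro nn_integral_cong) (auto split: split_indicator)
  also have "\<dots> = (\<integral>\<^sup>+x. ennreal (\<phi> x) * ennreal (p i x) \<partial>lborel)"
    by (rule law[OF i]) measurable
  also have "\<dots> = (\<integral>\<^sup>+x. ennreal (\<phi> x * p i x) \<partial>lborel)"
    by (simp add: ennreal_mult' \<phi>)
  also have "enn2real \<dots> = (\<integral>x. \<phi> x * p i x \<partial>lborel)"
    by (rule integral_eq_nn_integral[symmetric]) (auto simp: \<phi> p_nonneg)
  finally show ?thesis .
qed

lemma expectation_split:
  assumes [measurable]: "\<And>i. \<phi> i \<in> borel_measurable borel" and \<phi>: "\<And>i x. 0 \<le> \<phi> i x" "\<And>i x. \<phi> i x \<le> c"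
  shows "expectation (\<lambda>\<omega>. \<Sum>i=1..Q. of_bool (Y \<omega> = i) * \<phi> i (X \<omega>))
    = (\<Sum>i=1..Q. \<integral>x. \<phi> i x * p i x \<partial>lborel)"
proof -
  have int: "integrable M (\<lambda>\<omega>. \<phi> i (X \<omega>) * of_bool (Y \<omega> = i))" for i
  proof (rule integrable_const_bound[where B = c])
    have "norm (\<phi> i (X \<omega>) * of_bool (Y \<omega> = i)) \<le> c" for \<omega>
      using \<phi>(1)[of i "X \<omega>"] \<phi>(2)[of i "X \<omega>"] by (cases "Y \<omega> = i") auto
    then show "AE \<omega> in M. norm (\<phi> i (X \<omega>) * of_bool (Y \<omega> = i)) \<le> c" by simp
  qed measurable
  have "expectation (\<lambda>\<omega>. \<Sum>i=1..Q. of_bool (Y \<omega> = i) * \<phi> i (X \<omega>))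
      = expectation (\<lambda>\<omega>. \<Sum>i=1..Q. \<phi> i (X \<omega>) * of_bool (Y \<omega> = i))"
    by (simp only: mult.commute)
  also have "\<dots> = (\<Sum>i=1..Q. expectation (\<lambda>\<omega>. \<phi> i (X \<omega>) * of_bool (Y \<omega> = i)))"
    by (rule Bochner_Integration.integral_sum) (rule int)
  also have "\<dots> = (\<Sum>i=1..Q. \<integral>x. \<phi> i x * p i x \<partial>lborel)"
    by (intro sum.cong refl expectation_class \<phi>) auto
  finally show ?thesis .
qed

text \<open>The law of \<open>X\<close> has density at most \<open>Q * A\<close> on
  \<open>S\<close>, so smallness in L1 with respect to Lebesgue measure passes to the mean under
  \<open>X\<close>.\<close>

lemma expectation_X_le:
  assumes [measurable]: "\<phi> \<in> borel_measurable borel" and \<phi>: "\<And>x. 0 \<le> \<phi> x" "\<And>x. \<phi> x \<le> c"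
  shows "expectation (\<lambda>\<omega>. \<phi> (X \<omega>)) \<le> Q * A * (LINT x:S|lborel. \<phi> x)"
proof -
  have "expectation (\<lambda>\<omega>. \<phi> (X \<omega>)) = expectation (\<lambda>\<omega>. \<Sum>i=1..Q. of_bool (Y \<omega> = i) * \<phi> (X \<omega>))"
  proof (rule integral_cong_AE)
    show "AE \<omega> in M. \<phi> (X \<omega>) = (\<Sum>i=1..Q. of_bool (Y \<omega> = i) * \<phi> (X \<omega>))"
      using data_in by eventually_elim (simp add: sum_of_bool_eq_select)
  qed measurable
  also have "\<dots> = (\<Sum>i=1..Q. \<integral>x. \<phi> x * p i x \<partial>lborel)"
    by (rule expectation_split[where \<phi> = "\<lambda>_. \<phi>" and c = c]) (auto simp: \<phi>)
  also have "\<dots> \<le> (\<Sum>i=1..Q. A * (LINT x:S|lborel. \<phi> x))"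
  proof (rule sum_mono)
    fix i
    have int: "set_integrable lborel S \<phi>"
      by (rule set_integrable_bounded[where c = c]) (use S_finite \<phi> in \<open>auto simp: abs_le_iff intro: order_trans[OF _ \<phi>(1)]\<close>)
    have "(\<integral>x. \<phi> x * p i x \<partial>lborel) \<le> (\<integral>x. A * (indicator S x *\<^sub>R \<phi> x) \<partial>lborel)"
    proof (rule integral_mono')
      show "integrable lborel (\<lambda>x. A * (indicator S x *\<^sub>R \<phi> x))"
        using int unfolding set_integrable_def by simp
      show "\<phi> x * p i x \<le> A * (indicator S x *\<^sub>R \<phi> x)" for x
        using mult_right_mono[OF p_le[of i x] \<phi>(1)[of x]] p_off[of x i]
        by (cases "x \<in> S") (auto simp: mult.commute)
    qed (auto simp: \<phi> A_nonneg)
    then show "(\<integral>x. \<phi> x * p i x \<partial>lborel) \<le> A * (LINT x:S|lborel. \<phi> x)"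
      by (simp add: set_lebesgue_integral_def)
  qed
  finally show ?thesis by simp
qed

lemma expectation_kernel:
  assumes "i \<in> {1..Q}" "h > 0"
  shows "expectation (\<lambda>\<omega>. scaled_kernel h (x - X \<omega>) * of_bool (Y \<omega> = i)) = smoothed h i x"
  unfolding smoothed_def
  by (rule expectation_class[OF assms(1)]) (auto simp: scaled_kernel_nonneg assms)

lemma smoothed_meas [measurable]: "smoothed h i \<in> borel_measurable borel"
  unfolding smoothed_def[abs_def] by measurable

lemma smoothed_bounds:
  assumes "h > 0"
  shows "0 \<le> smoothed h i x" "smoothed h i x \<le> A"
proof -
  show "0 \<le> smoothed h i x"
    unfolding smoothed_def by (intro Bochner_Integration.integral_nonneg)
      (simp add: scaled_kernel_nonneg assms p_nonneg)
  have int: "integrable lborel (\<lambda>y. scaled_kernel h (x - y))" "(\<integral>y. scaled_kernel h (x - y) \<partial>lborel) = 1"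
    using scaled_kernel_integrable[OF assms, of x] scaled_kernel_integral[OF assms, of x]
    by (simp_all add: scaled_kernel_commute[of h x])
  have "smoothed h i x \<le> (\<integral>y. A * scaled_kernel h (x - y) \<partial>lborel)"
    unfolding smoothed_def
  proof (rule integral_mono')
    show "scaled_kernel h (x - y) * p i y \<le> A * scaled_kernel h (x - y)" for y
      using mult_right_mono[OF p_le[of i y] scaled_kernel_nonneg[OF assms, of "x - y"]]
      by (simp add: mult.commute)
  qed (use int assms in \<open>auto simp: A_nonneg scaled_kernel_nonneg\<close>)
  then show "smoothed h i x \<le> A" using int by simp
qed

section \<open>Almost sure limits of averages over the sample\<close>

lemma data_sets:
  assumes "B \<in> sets borel"
  shows "{z \<in> space (borel \<Otimes>\<^sub>M count_space UNIV). fst z \<in> B \<and> snd z \<in> I}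
    \<in> sets (borel \<Otimes>\<^sub>M count_space UNIV :: ((real ^ 'd) \<times> nat) measure)"
proof -
  have "{z \<in> space (borel \<Otimes>\<^sub>M count_space UNIV :: ((real ^ 'd) \<times> nat) measure). fst z \<in> B \<and> snd z \<in> I} = B \<times> I"
    by (auto simp: space_pair_measure)
  then show ?thesis using assms by (simp add: pair_measureI)
qed

lemma AE_data_in:
  assumes iid: "iid_copies M (borel \<Otimes>\<^sub>M count_space UNIV) (\<lambda>\<omega>. (X \<omega>, Y \<omega>)) (\<lambda>l \<omega>. (Xs l \<omega>, Ys l \<omega>))"
  shows "AE \<omega> in M. \<forall>l\<ge>1. Xs l \<omega> \<in> S \<and> Ys l \<omega> \<in> {1..Q}"
  using AE_iid_copies[OF iid, where P = "\<lambda>z. fst z \<in> S \<and> snd z \<in> {1..Q}"] data_in data_sets by simp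

text \<open>Law of large numbers for the leading term of the V-statistic. Integrating
  \<open>(1 - p i / mixture) / mixture\<close> against \<open>p i\<close> and summing over the
  classes gives exactly the impurity.\<close>

lemma AE_mean_weight:
  assumes iid: "iid_copies M (borel \<Otimes>\<^sub>M count_space UNIV) (\<lambda>\<omega>. (X \<omega>, Y \<omega>)) (\<lambda>l \<omega>. (Xs l \<omega>, Ys l \<omega>))"
    and "\<epsilon> > 0"
  shows "AE \<omega> in M. \<forall>\<^sub>F n in sequentially.
    impurity - \<epsilon> \<le> (\<Sum>l=1..n. (1 - p (Ys l \<omega>) (Xs l \<omega>) / mixture (Xs l \<omega>)) / mixture (Xs l \<omega>)) / n"
proof -
  \<comment> \<open>The weight is set to zero off \<open>S\<close> and for invalid labels because
    the concentration lemma asks for bounds on the whole space; almost surely no observation falls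
    there.\<close>
  define \<psi> where "\<psi> i x = (if i \<in> {1..Q} \<and> x \<in> S then (1 - p i x / mixture x) / mixture x else 0)" for i x
  have [measurable]: "\<psi> i \<in> borel_measurable borel" for i
    unfolding \<psi>_def[abs_def] by (cases "i \<in> {1..Q}") simp_all
  have \<psi>: "0 \<le> \<psi> i x" "\<psi> i x \<le> 1 / a" for i x
  proof -
    have "0 \<le> (1 - p i x / mixture x) / mixture x \<and> (1 - p i x / mixture x) / mixture x \<le> 1 / a" if "i \<in> {1..Q}" "x \<in> S"
    proof
      have r: "0 \<le> p i x / mixture x" "p i x / mixture x \<le> 1" and gx: "a \<le> mixture x"
        using ratio_bounds mixture_ge that by auto
      show "0 \<le> (1 - p i x / mixture x) / mixture x" using r gx a_pos by (intro divide_nonneg_nonneg) auto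
      show "(1 - p i x / mixture x) / mixture x \<le> 1 / a" using r gx a_pos by (intro frac_le) auto
    qed
    then show "0 \<le> \<psi> i x" "\<psi> i x \<le> 1 / a" using a_pos by (auto simp: \<psi>_def)
  qed
  define \<phi> where "\<phi> z = (\<Sum>i=1..Q. of_bool (snd z = i) * \<psi> i (fst z))" for z :: "(real ^ 'd) \<times> nat"
  have \<phi>_eq: "\<phi> (x, i) = \<psi> i x" for x i
    unfolding \<phi>_def by (simp add: sum_of_bool_eq_select) (simp add: \<psi>_def)
  have "expectation (\<lambda>\<omega>. \<phi> (X \<omega>, Y \<omega>)) = (\<Sum>i=1..Q. \<integral>x. \<psi> i x * p i x \<partial>lborel)"
    unfolding \<phi>_def fst_conv snd_conv by (rule expectation_split[where c = "1 / a"]) (auto simp: \<psi>)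
  also have "\<dots> = (\<Sum>i=1..Q. LINT x:S|lborel. p i x / mixture x * (1 - p i x / mixture x))"
    unfolding set_lebesgue_integral_def
    by (intro sum.cong refl Bochner_Integration.integral_cong) (auto simp: \<psi>_def)
  also have "\<dots> = impurity"
    unfolding impurity_def by (intro set_integral_sum[symmetric] impurity_integrand_integrable)
  finally have mean: "expectation (\<lambda>\<omega>. \<phi> (X \<omega>, Y \<omega>)) = impurity" .
  \<comment> \<open>A one-point index set and \<open>k = 0\<close> turn the uniform statement into a
    strong law.\<close>
  have "AE \<omega> in M. \<forall>\<^sub>F n in sequentially. \<forall>j\<in>{()}.
    \<bar>(\<Sum>l=1..n. \<phi> (Xs l \<omega>, Ys l \<omega>)) / n - expectation (\<lambda>\<omega>. \<phi> (X \<omega>, Y \<omega>))\<bar> < \<epsilon>"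
  proof (rule AE_uniform_empirical_mean[OF iid, where B = "\<lambda>_. 1 / a" and A = impurity and C = 1 and k = 0])
    show "\<phi> \<in> borel_measurable (borel \<Otimes>\<^sub>M count_space UNIV)"
      unfolding \<phi>_def[abs_def] by measurable
    show "0 \<le> \<phi> z \<and> \<phi> z \<le> 1 / a" for z using \<psi> by (cases z) (simp add: \<phi>_eq)
    show "filterlim (\<lambda>n. real n / (1 / a) / ln (real n)) at_top sequentially"
      using a_pos by real_asymp
  qed (use mean \<open>\<epsilon> > 0\<close> a_pos in auto)
  then show ?thesis using AE_data_in[OF iid]
  proof eventually_elim
    case (elim \<omega>)
    have sum_eq: "(\<Sum>l=1..n. \<phi> (Xs l \<omega>, Ys l \<omega>)) = (\<Sum>l=1..n. (1 - p (Ys l \<omega>) (Xs l \<omega>) / mixture (Xs l \<omega>)) / mixture (Xs l \<omega>))" for n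
      using elim(2) by (intro sum.cong) (auto simp: \<phi>_eq \<psi>_def)
    show ?case
      using elim(1) unfolding mean sum_eq by (rule eventually_mono) (auto simp: abs_less_iff)
  qed
qed

text \<open>This carries the L1 bias over to the sample points. The averaged function depends on
  \<open>n\<close> through the bandwidth, so the strong law for a fixed function does not apply and
  the triangular array version is used.\<close>

lemma AE_mean_bias:
  fixes h :: "nat \<Rightarrow> real"
  assumes iid: "iid_copies M (borel \<Otimes>\<^sub>M count_space UNIV) (\<lambda>\<omega>. (X \<omega>, Y \<omega>)) (\<lambda>l \<omega>. (Xs l \<omega>, Ys l \<omega>))"
    and h: "\<And>n. n \<ge> 1 \<Longrightarrow> 0 < h n" and "\<epsilon> > 0"
  shows "AE \<omega> in M. \<forall>\<^sub>F n in sequentially.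
    (\<Sum>l=1..n. \<Sum>i=1..Q. \<bar>smoothed (h n) i (Xs l \<omega>) - p i (Xs l \<omega>)\<bar>) / n
      \<le> Q * A * (\<Sum>i=1..Q. LINT x:S|lborel. \<bar>smoothed (h n) i x - p i x\<bar>) + \<epsilon>"
proof -
  define \<delta> where "\<delta> n x = (\<Sum>i=1..Q. \<bar>smoothed (h n) i x - p i x\<bar>)" for n x
  have [measurable]: "\<delta> n \<in> borel_measurable borel" for n unfolding \<delta>_def[abs_def] by measurable
  have diff: "\<bar>smoothed (h n) i x - p i x\<bar> \<le> A" if "n \<ge> 1" for n i x
    using smoothed_bounds[OF h[OF that], of i x] p_nonneg[of i x] p_le[of i x] by (simp add: abs_le_iff)
  have \<delta>: "0 \<le> \<delta> n x" "n \<ge> 1 \<Longrightarrow> \<delta> n x \<le> Q * A" for n x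
    unfolding \<delta>_def using sum_bounded_above[of "{1..Q}" "\<lambda>i. \<bar>smoothed (h n) i x - p i x\<bar>" A] diff
    by (auto intro: sum_nonneg)
  have E\<delta>: "expectation (\<lambda>\<omega>. \<delta> n (X \<omega>)) \<le> Q * A * (\<Sum>i=1..Q. LINT x:S|lborel. \<bar>smoothed (h n) i x - p i x\<bar>)"
    if n: "n \<ge> 1" for n
  proof -
    have "(LINT x:S|lborel. \<delta> n x) = (\<Sum>i=1..Q. LINT x:S|lborel. \<bar>smoothed (h n) i x - p i x\<bar>)"
      unfolding \<delta>_def by (intro set_integral_sum set_integrable_bounded[where c = A])
        (use diff n S_finite in auto)
    then show ?thesis using expectation_X_le[of "\<delta> n" "Q * A"] \<delta> n by simp
  qed
  \<comment> \<open>The range bound is taken as \<open>Q * A + 1\<close> so that it is strictly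
    positive even if \<open>Q * A\<close> vanishes.\<close>
  have "AE \<omega> in M. \<forall>\<^sub>F n in sequentially. \<forall>j\<in>{()}.
    \<bar>(\<Sum>l=1..n. \<delta> n (fst (Xs l \<omega>, Ys l \<omega>))) / n - expectation (\<lambda>\<omega>. \<delta> n (fst (X \<omega>, Y \<omega>)))\<bar> < \<epsilon>"
  proof (rule AE_uniform_empirical_mean[OF iid, where B = "\<lambda>_. Q * A + 1" and A = "Q * A" and C = 1 and k = 0])
    show "(\<lambda>z. \<delta> n (fst z)) \<in> borel_measurable (borel \<Otimes>\<^sub>M count_space UNIV)" for n by measurable
    show "0 \<le> \<delta> n (fst z) \<and> \<delta> n (fst z) \<le> Q * A + 1" if "n \<ge> 1" for n and z :: "(real ^ 'd) \<times> nat"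
      using \<delta>(1)[of n "fst z"] \<delta>(2)[OF that, of "fst z"] by simp
    show "expectation (\<lambda>\<omega>. \<delta> n (fst (X \<omega>, Y \<omega>))) \<le> Q * A" if "n \<ge> 1" for n
      unfolding fst_conv
    proof (rule integral_le_const)
      show "integrable M (\<lambda>\<omega>. \<delta> n (X \<omega>))"
        by (rule integrable_const_bound[where B = "Q * A"]) (use \<delta> that in auto)
    qed (use \<delta> that in auto)
    have "Q * A + 1 > 0" using A_nonneg by (simp add: add_nonneg_pos)
    then show "filterlim (\<lambda>n. real n / (Q * A + 1) / ln (real n)) at_top sequentially" by real_asymp
  qed (use \<open>\<epsilon> > 0\<close> A_nonneg in \<open>auto simp: add_nonneg_pos\<close>)
  then show ?thesis
  proof eventually_elim
    case (elim \<omega>)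
    then show ?case using eventually_ge_at_top[of 1]
    proof eventually_elim
      case (elim n)
      then show ?case using E\<delta>[of n] by (simp add: abs_less_iff \<delta>_def)
    qed
  qed
qed

end

lemma eta_hat_eq:
  assumes "n \<ge> 1"
  shows "eta_hat xs ys n h i x = class_kde xs ys n h i x / kde xs n h x"
  using assms by (simp add: eta_hat_def class_kde_def)

text \<open>All \<open>eta_hat\<close> values at \<open>x\<close> share the denominator
  \<open>kde\<close>, which is positive, so the arg max may be taken over the numerators.\<close>

lemma plugin_classifier_argmax:
  assumes "plugin_classifier Q xs ys n h F" "h > 0" "n \<ge> 1"
  shows "F x \<in> {1..Q}" "i \<in> {1..Q} \<Longrightarrow> class_kde xs ys n h i x \<le> class_kde xs ys n h (F x) x"
proof -
  have argmax: "is_arg_max (\<lambda>i. eta_hat xs ys n h i x) (\<lambda>i. i \<in> {1..Q}) (F x)"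
    using assms(1) by (simp add: plugin_classifier_def)
  then show "F x \<in> {1..Q}" by (simp add: is_arg_max_def)
  assume "i \<in> {1..Q}"
  then have "\<not> eta_hat xs ys n h (F x) x < eta_hat xs ys n h i x"
    using argmax unfolding is_arg_max_def by blast
  then show "class_kde xs ys n h i x \<le> class_kde xs ys n h (F x) x"
    using divide_strict_right_mono[OF _ kde_pos[OF assms(2,3), of xs x]]
    unfolding eta_hat_eq[OF assms(3)] by (meson not_less)
qed

section \<open>Identification of the posterior\<close>

context plugin_model
begin

text \<open>The ratio composed with \<open>X\<close> satisfies the defining property of the
  conditional probability, so both agree almost everywhere under the law of \<open>X\<close>. On
  \<open>S\<close> this law has a density at least \<open>a > 0\<close>, so its null sets inside
  \<open>S\<close> are Lebesgue null.\<close>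

lemma AE_eq_posterior:
  assumes i: "i \<in> {1..Q}" and version: "cond_prob_version M X Y i \<eta>"
  shows "AE x in lborel. x \<in> S \<longrightarrow> \<eta> x = p i x / mixture x"
proof -
  let ?F = "vimage_algebra (space M) X borel"
  have \<eta> [measurable]: "\<eta> \<in> borel_measurable borel"
    and \<eta>_AE: "AE \<omega> in M. \<eta> (X \<omega>) = real_cond_exp M ?F (\<lambda>\<omega>. of_bool (Y \<omega> = i)) \<omega>"
    using version by (auto simp: cond_prob_version_def)
  have sets_F: "sets ?F = {X -` B \<inter> space M | B. B \<in> sets borel}"
    by (rule sets_vimage_algebra2) simp
  have "subalgebra M ?F"
    unfolding subalgebra_def sets_F by (auto intro: measurable_sets[OF X_meas])
  then interpret finite_measure_subalgebra M ?F by unfold_locales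
  define \<psi> where "\<psi> x = p i x / mixture x" for x
  have [measurable]: "\<psi> \<in> borel_measurable borel" unfolding \<psi>_def[abs_def] by measurable
  have \<psi>: "0 \<le> \<psi> x" "\<psi> x \<le> 1" for x
    using ratio_bounds[OF i, of x] p_off[of x i] by (cases "x \<in> S"; simp add: \<psi>_def)+
  have "AE \<omega> in M. real_cond_exp M ?F (\<lambda>\<omega>. of_bool (Y \<omega> = i)) \<omega> = \<psi> (X \<omega>)"
  proof (rule real_cond_exp_charact)
    fix C assume "C \<in> sets ?F"
    then obtain B where C: "C = X -` B \<inter> space M" and [measurable]: "B \<in> sets borel"
      unfolding sets_F by auto
    have "(\<integral>\<omega>\<in>C. (of_bool (Y \<omega> = i) :: real) \<partial>M) = expectation (\<lambda>\<omega>. indicator B (X \<omega>) * of_bool (Y \<omega> = i))"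
      unfolding set_lebesgue_integral_def
      by (intro Bochner_Integration.integral_cong) (auto simp: C indicator_def)
    also have "\<dots> = (\<integral>x. indicator B x * p i x \<partial>lborel)"
      by (rule expectation_class[OF i]) auto
    also have "\<dots> = (\<integral>x. (\<Sum>j=1..Q. indicator B x * \<psi> x * p j x) \<partial>lborel)"
    proof (rule Bochner_Integration.integral_cong)
      fix x
      \<comment> \<open>Off \<open>S\<close> both sides vanish because \<open>p i x\<close> does; on
        \<open>S\<close> the mixture is nonzero and cancels.\<close>
      have "p i x = \<psi> x * mixture x"
        using mixture_ge[of x] a_pos p_off[of x i] by (cases "x \<in> S") (auto simp: \<psi>_def)
      then show "indicator B x * p i x = (\<Sum>j=1..Q. indicator B x * \<psi> x * p j x)"
        by (simp add: mixture_def sum_distrib_left mult.assoc)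
    qed simp
    also have "\<dots> = (\<Sum>j=1..Q. \<integral>x. indicator B x * \<psi> x * p j x \<partial>lborel)"
    proof (rule Bochner_Integration.integral_sum)
      fix j
      have "norm (indicator B x * \<psi> x * p j x) \<le> 1 * 1 * A" for x
        using \<psi>[of x] p_nonneg[of j x] p_le[of j x] unfolding norm_mult
        by (intro mult_mono) (auto simp: indicator_def)
      then show "integrable lborel (\<lambda>x. indicator B x * \<psi> x * p j x)"
        by (intro integrableI_bounded_set[where A = S and B = A]) (use S_finite p_off in auto)
    qed
    also have "\<dots> = expectation (\<lambda>\<omega>. \<Sum>j=1..Q. of_bool (Y \<omega> = j) * (indicator B (X \<omega>) * \<psi> (X \<omega>)))"
      by (rule expectation_split[where \<phi> = "\<lambda>_ x. indicator B x * \<psi> x" and c = 1, symmetric])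
         (auto simp: \<psi> indicator_def)
    also have "\<dots> = (\<integral>\<omega>\<in>C. \<psi> (X \<omega>) \<partial>M)"
      unfolding set_lebesgue_integral_def
    proof (rule integral_cong_AE)
      show "(\<lambda>\<omega>. indicator C \<omega> *\<^sub>R \<psi> (X \<omega>)) \<in> borel_measurable M"
        unfolding C by measurable
      have "AE \<omega> in M. \<omega> \<in> space M" by (rule AE_space)
      then show "AE \<omega> in M. (\<Sum>j=1..Q. of_bool (Y \<omega> = j) * (indicator B (X \<omega>) * \<psi> (X \<omega>))) = indicator C \<omega> *\<^sub>R \<psi> (X \<omega>)"
        using data_in
      proof eventually_elim
        case (elim \<omega>)
        have "(\<Sum>j=1..Q. of_bool (Y \<omega> = j) * (indicator B (X \<omega>) * \<psi> (X \<omega>))) = indicator B (X \<omega>) * \<psi> (X \<omega>)"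
          using elim by (subst sum_of_bool_eq_select) auto
        then show ?case using elim by (simp add: C indicator_def)
      qed
    qed measurable
    finally show "(\<integral>\<omega>\<in>C. (of_bool (Y \<omega> = i) :: real) \<partial>M) = (\<integral>\<omega>\<in>C. \<psi> (X \<omega>) \<partial>M)" .
  next
    show "integrable M (\<lambda>\<omega>. of_bool (Y \<omega> = i) :: real)"
      by (rule integrable_const_bound[where B = 1]) auto
    show "integrable M (\<lambda>\<omega>. \<psi> (X \<omega>))"
      by (rule integrable_const_bound[where B = 1]) (auto simp: \<psi>)
    have "X \<in> ?F \<rightarrow>\<^sub>M borel" by (rule measurable_vimage_algebra1) simp
    then show "(\<lambda>\<omega>. \<psi> (X \<omega>)) \<in> borel_measurable ?F" by measurable
  qed
  then have X_AE: "AE \<omega> in M. \<eta> (X \<omega>) = \<psi> (X \<omega>)"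
    using \<eta>_AE by eventually_elim simp
  \<comment> \<open>\<open>X\<close> almost surely avoids \<open>D\<close>, so every
    \<open>p j\<close> vanishes almost everywhere on \<open>D\<close>; their sum is at least
    \<open>a\<close> on \<open>S\<close>, so \<open>D\<close> can meet \<open>S\<close> only in a
    null set.\<close>
  define D where "D = {x. \<eta> x \<noteq> \<psi> x}"
  have [measurable]: "D \<in> sets borel" unfolding D_def by measurable
  have zero: "AE x in lborel. x \<in> D \<longrightarrow> p j x = 0" if j: "j \<in> {1..Q}" for j
  proof -
    have "(\<integral>\<^sup>+x. indicator D x * ennreal (p j x) \<partial>lborel) = (\<integral>\<^sup>+\<omega>. indicator D (X \<omega>) * indicator {j} (Y \<omega>) \<partial>M)"
      by (rule law[OF j, symmetric]) measurable
    also have "\<dots> = (\<integral>\<^sup>+\<omega>. 0 \<partial>M)"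
      by (rule nn_integral_cong_AE) (use X_AE in eventually_elim, auto simp: D_def)
    finally have "AE x in lborel. indicator D x * ennreal (p j x) = 0"
      by (simp add: nn_integral_0_iff_AE)
    then show ?thesis
    proof eventually_elim
      case (elim x)
      then show ?case using p_nonneg[of j x] by auto
    qed
  qed
  have "AE x in lborel. \<forall>j\<in>{1..Q}. x \<in> D \<longrightarrow> p j x = 0"
    by (rule AE_finite_allI) (use zero in auto)
  then show ?thesis
  proof eventually_elim
    case (elim x)
    show ?case
    proof
      assume "x \<in> S"
      then have "mixture x \<noteq> 0" using mixture_ge a_pos by fastforce
      then have "x \<notin> D" using elim by (auto simp: mixture_def)
      then show "\<eta> x = p i x / mixture x" by (simp add: D_def \<psi>_def)
    qed
  qed
qed

section \<open>Positivity of the impurity and the comparison in the two cases\<close>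

lemma AE_class_neq:
  assumes "i \<in> {1..Q}" "AE x in lborel. p i x = 0"
  shows "AE \<omega> in M. Y \<omega> \<noteq> i"
proof -
  have [measurable]: "(\<lambda>\<omega>. indicator {i} (Y \<omega>) :: ennreal) \<in> borel_measurable M"
    by (rule measurable_compose[OF Y_meas]) simp
  have "(\<integral>\<^sup>+\<omega>. indicator {i} (Y \<omega>) \<partial>M) = (\<integral>\<^sup>+x. ennreal (p i x) \<partial>lborel)"
    using law[OF assms(1), of "\<lambda>_. 1"] by simp
  also have "\<dots> = (\<integral>\<^sup>+x. 0 \<partial>(lborel :: (real ^ 'd) measure))"
    by (rule nn_integral_cong_AE) (use assms(2) in eventually_elim, simp)
  finally have "AE \<omega> in M. (indicator {i} (Y \<omega>) :: ennreal) = 0"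
    by (subst nn_integral_0_iff_AE[symmetric]) simp_all
  then show ?thesis by eventually_elim auto
qed

text \<open>If \<open>S\<close> were null, every class would have probability zero, leaving no
  admissible label. Strict positivity of the impurity integral rests on this.\<close>

lemma S_not_null: "emeasure lborel S \<noteq> 0"
proof
  assume "emeasure lborel S = 0"
  then have "AE x in lborel. x \<notin> S" by (intro AE_not_in) (auto simp: null_sets_def)
  then have "AE x in lborel. p i x = 0" for i by eventually_elim (simp add: p_off)
  then have "AE \<omega> in M. \<forall>i\<in>{1..Q}. Y \<omega> \<noteq> i"
    by (intro AE_finite_allI AE_class_neq) auto
  then have "AE \<omega> in M. False" using data_in by eventually_elim auto
  then show False by simp
qed

text \<open>With a second class present everywhere on \<open>S\<close>, the ratio for class
  \<open>i\<close> lies strictly between 0 and 1, so the integrand is positive on all of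
  \<open>S\<close>.\<close>

lemma impurity_pos:
  assumes ij: "i \<in> {1..Q}" "j \<in> {1..Q}" "i \<noteq> j"
    and pos: "\<And>x. x \<in> S \<Longrightarrow> 0 < p i x" "\<And>x. x \<in> S \<Longrightarrow> 0 < p j x"
  shows "0 < impurity"
proof -
  let ?f = "\<lambda>x. \<Sum>i=1..Q. p i x / mixture x * (1 - p i x / mixture x)"
  have nonneg: "0 \<le> p k x / mixture x * (1 - p k x / mixture x)" if "k \<in> {1..Q}" "x \<in> S" for k x
    using ratio_bounds[OF that] by (intro mult_nonneg_nonneg) auto
  have f_pos: "0 < ?f x" if x: "x \<in> S" for x
  proof (rule sum_pos2[OF _ ij(1)])
    have gx: "mixture x > 0" using mixture_ge[OF x] a_pos by simp
    have "p i x + p j x = sum (\<lambda>k. p k x) {i, j}" using ij by simp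
    also have "\<dots> \<le> mixture x" unfolding mixture_def using ij p_nonneg by (intro sum_mono2) auto
    finally have "p i x < mixture x" using pos(2)[OF x] by simp
    then show "0 < p i x / mixture x * (1 - p i x / mixture x)" using pos(1)[OF x] gx by simp
  qed (use nonneg x in auto)
  have int: "set_integrable lborel S ?f"
    by (intro set_integrable_sum impurity_integrand_integrable)
  have nn: "AE x in lborel. 0 \<le> indicator S x *\<^sub>R ?f x"
    using f_pos by (intro AE_I2) (auto simp: indicator_def less_imp_le)
  have "impurity \<ge> 0" unfolding impurity_def set_lebesgue_integral_def by (rule integral_nonneg_AE[OF nn])
  moreover have "impurity \<noteq> 0"
  proof
    assume "impurity = 0"
    then have "AE x in lborel. indicator S x *\<^sub>R ?f x = 0"
      using integral_nonneg_eq_0_iff_AE[OF int[unfolded set_integrable_def] nn]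
      unfolding impurity_def set_lebesgue_integral_def by simp
    then have "AE x in lborel. x \<notin> S"
    proof eventually_elim
      case (elim x)
      then show ?case using f_pos[of x] by (auto simp: indicator_def split: if_splits)
    qed
    then have "S \<in> null_sets lborel" by (subst (asm) AE_iff_null_sets[symmetric]) auto
    then show False using S_not_null by auto
  qed
  ultimately show ?thesis by simp
qed

text \<open>Almost surely every observed label is \<open>k\<close>; then all other class estimators
  are zero while that of \<open>k\<close> equals the positive \<open>kde\<close>, so the arg max is
  \<open>k\<close> everywhere. The posterior of every other class vanishes almost everywhere on
  \<open>S\<close>.\<close>

lemma AE_misclassified_volume_eq_0_of_single_class:
  assumes iid: "iid_copies M (borel \<Otimes>\<^sub>M count_space UNIV) (\<lambda>\<omega>. (X \<omega>, Y \<omega>)) (\<lambda>l \<omega>. (Xs l \<omega>, Ys l \<omega>))"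
    and h: "\<And>n. n \<ge> 1 \<Longrightarrow> 0 < h n"
    and k: "k \<in> {1..Q}" "\<And>i x. i \<noteq> k \<Longrightarrow> p i x = 0"
    and \<eta>: "\<And>i. i \<in> {1..Q} \<Longrightarrow> \<eta> i \<in> borel_measurable borel"
      "\<And>i. i \<in> {1..Q} \<Longrightarrow> AE x in lborel. x \<in> S \<longrightarrow> \<eta> i x = p i x / mixture x"
    and F: "\<And>n \<omega>. 1 \<le> n \<Longrightarrow> \<omega> \<in> space M \<Longrightarrow>
      plugin_classifier Q (\<lambda>l. Xs l \<omega>) (\<lambda>l. Ys l \<omega>) n (h n) (F n \<omega>)"
  shows "AE \<omega> in M. \<forall>\<^sub>F n in sequentially. misclassified_volume S Q \<eta> (F n \<omega>) = 0"
proof -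
  have "AE \<omega> in M. \<forall>i\<in>{1..Q} - {k}. Y \<omega> \<noteq> i"
    by (intro AE_finite_allI AE_class_neq) (auto simp: k)
  then have "AE \<omega> in M. Y \<omega> = k" using data_in by eventually_elim auto
  then have "AE \<omega> in M. \<forall>l\<ge>1. Ys l \<omega> = k"
    using AE_iid_copies[OF iid, where P = "\<lambda>z. fst z \<in> UNIV \<and> snd z \<in> {k}"] data_sets[of UNIV "{k}"] by simp
  then show ?thesis using AE_space
  proof eventually_elim
    case (elim \<omega>)
    let ?K = "class_kde (\<lambda>l. Xs l \<omega>) (\<lambda>l. Ys l \<omega>)"
    have "misclassified_volume S Q \<eta> (F n \<omega>) = 0" if n: "n \<ge> 1" for n
    proof -
      note plugin = F[OF n elim(2)]
      have [measurable]: "F n \<omega> \<in> borel \<rightarrow>\<^sub>M count_space UNIV" using plugin by (simp add: plugin_classifier_def)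
      have Fk: "F n \<omega> x = k" for x
      proof (rule ccontr)
        assume "F n \<omega> x \<noteq> k"
        then have "?K n (h n) (F n \<omega> x) x = 0"
          using elim(1) by (auto simp: class_kde_def intro!: sum.neutral)
        moreover have "?K n (h n) k x = kde (\<lambda>l. Xs l \<omega>) n (h n) x"
          using elim(1) by (simp add: class_kde_def kde_def)
        ultimately show False
          using plugin_classifier_argmax(2)[OF plugin h[OF n] n k(1), of x] kde_pos[OF h[OF n] n, of "\<lambda>l. Xs l \<omega>" x]
          by simp
      qed
      have "misclassified_volume S Q \<eta> (F n \<omega>) = misclassified_volume S Q (\<lambda>i x. p i x / mixture x) (F n \<omega>)"
        by (rule misclassified_volume_cong_AE) (use \<eta> in auto)
      also have "\<dots> = 0"
        unfolding misclassified_volume_def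
      proof (intro sum.neutral ballI)
        fix i j assume "i \<in> {1..Q}" "j \<in> {1..Q} - {i}"
        then have "p i x / mixture x * of_bool (F n \<omega> x = j) = 0" for x
          using k(2) by (cases "i = k") (auto simp: Fk)
        then show "(LINT x:S|lborel. p i x / mixture x * of_bool (F n \<omega> x = j)) = 0"
          by (simp only: set_lebesgue_integral_def) simp
      qed
      finally show ?thesis .
    qed
    then show ?case by (rule eventually_sequentiallyI)
  qed
qed

text \<open>For a fixed \<open>\<epsilon>\<close>, the V-statistic is eventually at least
  \<open>impurity - C1 * \<epsilon>\<close> and the volume at most
  \<open>impurity + C2 * \<epsilon>\<close>. Both constants are independent of \<open>n\<close>, so
  \<open>\<epsilon>\<close> can be fixed before passing to almost sure events.\<close>

lemma AE_misclassified_volume_le_of_impurity_pos: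
  assumes iid: "iid_copies M (borel \<Otimes>\<^sub>M count_space UNIV) (\<lambda>\<omega>. (X \<omega>, Y \<omega>)) (\<lambda>l \<omega>. (Xs l \<omega>, Ys l \<omega>))"
    and band: "bandwidth_cond CARD('d) \<gamma> h" "\<gamma> > 0"
    and "0 < impurity"
    and \<eta>: "\<And>i. i \<in> {1..Q} \<Longrightarrow> \<eta> i \<in> borel_measurable borel"
      "\<And>i. i \<in> {1..Q} \<Longrightarrow> AE x in lborel. x \<in> S \<longrightarrow> \<eta> i x = p i x / mixture x"
    and F: "\<And>n \<omega>. 1 \<le> n \<Longrightarrow> \<omega> \<in> space M \<Longrightarrow>
      plugin_classifier Q (\<lambda>l. Xs l \<omega>) (\<lambda>l. Ys l \<omega>) n (h n) (F n \<omega>)"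
  shows "AE \<omega> in M. \<forall>\<^sub>F n in sequentially. misclassified_volume S Q \<eta> (F n \<omega>) \<le>
      2 / (real n)\<^sup>2 * (\<Sum>l=1..n. \<Sum>m=1..n.
        of_bool (Ys l \<omega> \<noteq> Ys m \<omega>) * V_kernel (\<lambda>k. Xs k \<omega>) n (h n) (Xs l \<omega>) (Xs m \<omega>))"
proof -
  have h: "\<And>n. n \<ge> 1 \<Longrightarrow> 0 < h n" and hlim: "h \<longlonglongrightarrow> 0"
    using band by (auto simp: bandwidth_cond_def)
  define m where "m = measure lborel S"
  define G where "G = Q * A"
  \<comment> \<open>A smoothed class density is at most \<open>A\<close> and its estimator deviates
    by at most \<open>\<epsilon> \<le> 1\<close>, which bounds \<open>kde\<close> on
    \<open>S\<close> by this sum over the classes.\<close>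
  define B where "B = Q * (A + 1)"
  \<comment> \<open>In units of \<open>\<epsilon>\<close>, the factor \<open>Q + G * Q + 1\<close>
    collects the uniform deviations of \<open>Q\<close> estimators, their L1 bias carried over to
    the sample, and the fluctuation of the averaged bias. \<open>(B + G) / a ^ 3\<close> comes from
    taking both \<open>w\<close> and \<open>\<kappa>\<close> equal to \<open>\<epsilon>\<close>, the
    final 1 from the leading term.\<close>
  define C1 where "C1 = (2 * B / a ^ 3 + 1 / a\<^sup>2) * (Q + G * Q + 1) + (B + G) / a ^ 3 + 1"
  define C2 where "C2 = (Q + Q * m) / a"
  have nonneg: "m \<ge> 0" "G \<ge> 0" "B \<ge> 0" by (auto simp: m_def G_def B_def A_nonneg)
  have C: "C1 \<ge> 1" "C2 \<ge> 0" using nonneg a_pos by (auto simp: C1_def C2_def)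
  \<comment> \<open>Equivalent to spending the factor 2:
    \<open>(2 * C1 + C2) * \<epsilon> \<le> impurity\<close> says that \<open>impurity + C2 *
    \<epsilon> \<le> 2 * (impurity - C1 * \<epsilon>)\<close>.\<close>
  define \<epsilon> where "\<epsilon> = min 1 (impurity / (2 * C1 + C2))"
  have \<epsilon>: "0 < \<epsilon>" "\<epsilon> \<le> 1" using \<open>0 < impurity\<close> C by (auto simp: \<epsilon>_def)
  have "\<epsilon> \<le> impurity / (2 * C1 + C2)" by (simp add: \<epsilon>_def)
  then have slack: "(2 * C1 + C2) * \<epsilon> \<le> impurity" using C by (simp add: field_simps)
  have "uniformly_continuous_on S mixture"
    unfolding mixture_def by (intro uniformly_continuous_on_sum p_cont)
  then obtain r where r: "r > 0" "\<And>x y. x \<in> S \<Longrightarrow> y \<in> S \<Longrightarrow> dist y x < r \<Longrightarrow> dist (mixture y) (mixture x) < \<epsilon>"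
    using \<epsilon> unfolding uniformly_continuous_on_def by metis
  have "(\<lambda>n. exp (- (r\<^sup>2 / 2) / (h n)\<^sup>2) / h n ^ CARD('d)) \<longlonglongrightarrow> 0"
    by (rule tendsto_exp_div_power[OF hlim]) (use h r in \<open>auto intro: eventually_sequentiallyI[of 1]\<close>)
  then have ev_far: "\<forall>\<^sub>F n in sequentially. exp (- (r\<^sup>2 / 2) / (h n)\<^sup>2) / h n ^ CARD('d) < \<epsilon>"
    using \<epsilon> by (intro order_tendstoD)
  have ev_bias: "\<forall>\<^sub>F n in sequentially. \<forall>i\<in>{1..Q}. (LINT x:S|lborel. \<bar>smoothed (h n) i x - p i x\<bar>) \<le> \<epsilon>"
    unfolding smoothed_def
    by (intro eventually_ball_finite ballI finite_atLeastAtMost)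
       (rule eventually_mollify_L1_le[OF S_meas S_bounded p_meas p_nonneg p_le p_off p_cont hlim h \<epsilon>(1)])
  have mean_bias: "AE \<omega> in M. \<forall>\<^sub>F n in sequentially.
    (\<Sum>l=1..n. \<Sum>i=1..Q. \<bar>smoothed (h n) i (Xs l \<omega>) - p i (Xs l \<omega>)\<bar>) / n
      \<le> Q * A * (\<Sum>i=1..Q. LINT x:S|lborel. \<bar>smoothed (h n) i x - p i x\<bar>) + \<epsilon>"
    by (rule AE_mean_bias[OF iid h \<epsilon>(1)])
  have "AE \<omega> in M. \<forall>\<^sub>F n in sequentially. \<forall>i\<in>{1..Q}. \<forall>x\<in>S.
    \<bar>class_kde (\<lambda>l. Xs l \<omega>) (\<lambda>l. Ys l \<omega>) n (h n) i x
      - expectation (\<lambda>\<omega>. scaled_kernel (h n) (x - X \<omega>) * of_bool (Y \<omega> = i))\<bar> \<le> \<epsilon>"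
    by (rule AE_class_kde_uniform[where A = A, OF X_meas Y_meas iid S_bounded finite_atLeastAtMost _ band \<epsilon>(1)])
       (simp only: expectation_kernel h smoothed_bounds(2))
  moreover note AE_mean_weight[OF iid \<epsilon>(1)] mean_bias AE_data_in[OF iid] AE_space
  ultimately show ?thesis
  proof eventually_elim
    case (elim \<omega>)
    let ?xs = "\<lambda>l. Xs l \<omega>" and ?ys = "\<lambda>l. Ys l \<omega>"
    from elim(1-3) ev_far ev_bias eventually_ge_at_top[of 1] show ?case
    proof eventually_elim
      case (elim n)
      note weight = elim(2) and bias = elim(3) and far = elim(4) and L1 = elim(5) and n = elim(6)
      note hn = h[OF n]
      let ?P = "class_kde ?xs ?ys n (h n)" and ?q = "smoothed (h n)"
      have close: "\<bar>?P i x - ?q i x\<bar> \<le> \<epsilon>" if "i \<in> {1..Q}" "x \<in> S" for i x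
        using elim(1)[THEN bspec, OF that(1), THEN bspec, OF that(2)]
        unfolding expectation_kernel[OF that(1) hn] .
      note data = \<open>\<forall>l\<ge>1. Xs l \<omega> \<in> S \<and> Ys l \<omega> \<in> {1..Q}\<close>
      have n0: "real n > 0" using n by simp
      have sumL1: "(\<Sum>i=1..Q. LINT x:S|lborel. \<bar>?q i x - p i x\<bar>) \<le> Q * \<epsilon>"
        using sum_bounded_above[of "{1..Q}" _ \<epsilon>] L1 by simp
      let ?T = "(\<Sum>l=1..n. \<Sum>m=1..n. of_bool (?ys l \<noteq> ?ys m) * V_kernel ?xs n (h n) (?xs l) (?xs m)) / (real n)\<^sup>2"
      let ?D = "Q * \<epsilon> + (G * (Q * \<epsilon>) + \<epsilon>)"
      have D: "(\<Sum>l=1..n. \<Sum>i=1..Q. \<bar>?P i (?xs l) - p i (?xs l)\<bar>) / n \<le> ?D"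
      proof -
        have "(\<Sum>l=1..n. \<Sum>i=1..Q. \<bar>?P i (?xs l) - p i (?xs l)\<bar>)
            \<le> (\<Sum>l=1..n. \<Sum>i=1..Q. \<epsilon> + \<bar>?q i (?xs l) - p i (?xs l)\<bar>)"
        proof (intro sum_mono)
          fix l i assume "l \<in> {1..n}" "i \<in> {1..Q}"
          then show "\<bar>?P i (?xs l) - p i (?xs l)\<bar> \<le> \<epsilon> + \<bar>?q i (?xs l) - p i (?xs l)\<bar>"
            using close[of i "?xs l"] data by auto
        qed
        also have "\<dots> = n * (Q * \<epsilon>) + (\<Sum>l=1..n. \<Sum>i=1..Q. \<bar>?q i (?xs l) - p i (?xs l)\<bar>)"
          by (simp add: sum.distrib)
        finally have "(\<Sum>l=1..n. \<Sum>i=1..Q. \<bar>?P i (?xs l) - p i (?xs l)\<bar>) / n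
            \<le> (n * (Q * \<epsilon>) + (\<Sum>l=1..n. \<Sum>i=1..Q. \<bar>?q i (?xs l) - p i (?xs l)\<bar>)) / n"
          by (rule divide_right_mono) simp
        also have "\<dots> = Q * \<epsilon> + (\<Sum>l=1..n. \<Sum>i=1..Q. \<bar>?q i (?xs l) - p i (?xs l)\<bar>) / n"
          using n0 by (simp add: add_divide_distrib)
        also have "\<dots> \<le> Q * \<epsilon> + (G * (\<Sum>i=1..Q. LINT x:S|lborel. \<bar>?q i x - p i x\<bar>) + \<epsilon>)"
          using bias by (simp add: G_def)
        also have "\<dots> \<le> ?D"
          using mult_left_mono[OF sumL1 nonneg(2)] by simp
        finally show ?thesis .
      qed
      have kde_le: "kde ?xs n (h n) (?xs l) \<le> B" if l: "l \<in> {1..n}" for l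
      proof -
        have "kde ?xs n (h n) (?xs l) = (\<Sum>i=1..Q. ?P i (?xs l))"
          using data by (intro kde_eq_sum_class_kde) auto
        also have "\<dots> \<le> (\<Sum>i=1..Q. A + 1)"
        proof (rule sum_mono)
          fix i assume "i \<in> {1..Q}"
          then show "?P i (?xs l) \<le> A + 1"
            using close[of i "?xs l"] data l smoothed_bounds(2)[OF hn, of i "?xs l"] \<epsilon> by fastforce
        qed
        finally show ?thesis by (simp add: B_def)
      qed
      have lower: "(\<Sum>l=1..n. (1 - p (?ys l) (?xs l) / (\<Sum>i=1..Q. p i (?xs l))) / (\<Sum>i=1..Q. p i (?xs l))) / n
          - (2 * B / a ^ 3 + 1 / a\<^sup>2) * ?D - (\<epsilon> * B + G * \<epsilon>) / a ^ 3 \<le> ?T"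
      proof (rule V_statistic_lower_bound[where S = S and r = r])
        show "\<bar>(\<Sum>i=1..Q. p i x) - (\<Sum>i=1..Q. p i y)\<bar> \<le> \<epsilon>" if "x \<in> S" "y \<in> S" "norm (x - y) < r" for x y
          using r(2)[of y x] that by (simp add: mixture_def dist_norm)
        show "scaled_kernel (h n) z \<le> \<epsilon>" if "r \<le> norm z" for z :: "real ^ 'd"
          using scaled_kernel_le_exp[OF hn less_imp_le[OF r(1)] that] far by simp
        show "(\<Sum>i=1..Q. p i x) \<le> G" for x using mixture_le[of x] by (simp add: mixture_def G_def)
      qed (use hn n data p_nonneg a_pos sum_p_ge kde_le \<epsilon> D in auto)
      have "(2 * B / a ^ 3 + 1 / a\<^sup>2) * ?D + (\<epsilon> * B + G * \<epsilon>) / a ^ 3 + \<epsilon> = C1 * \<epsilon>"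
        using a_pos by (simp add: C1_def field_simps)
      then have T: "impurity - C1 * \<epsilon> \<le> ?T" using lower weight unfolding mixture_def by linarith
      note plugin = F[OF n \<open>\<omega> \<in> space M\<close>]
      have meas: "F n \<omega> \<in> borel \<rightarrow>\<^sub>M count_space UNIV" using plugin by (simp add: plugin_classifier_def)
      have "misclassified_volume S Q \<eta> (F n \<omega>) = misclassified_volume S Q (\<lambda>i x. p i x / mixture x) (F n \<omega>)"
        by (rule misclassified_volume_cong_AE) (use \<eta> meas in auto)
      also have "\<dots> \<le> impurity + ((\<Sum>i=1..Q. LINT x:S|lborel. \<bar>?q i x - p i x\<bar>) + Q * \<epsilon> * m) / a"
        unfolding impurity_def mixture_def m_def
        by (rule misclassified_volume_le[where P = ?P and A = A, OF S_meas S_finite p_meas p_nonneg p_le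
              a_pos sum_p_ge smoothed_meas smoothed_bounds[OF hn] meas
              plugin_classifier_argmax[OF plugin hn n] close])
      also have "\<dots> \<le> impurity + (Q * \<epsilon> + Q * \<epsilon> * m) / a"
        using sumL1 a_pos by (intro add_left_mono divide_right_mono) auto
      also have "\<dots> = impurity + C2 * \<epsilon>" using a_pos by (simp add: C2_def field_simps)
      also have "\<dots> \<le> 2 * (impurity - C1 * \<epsilon>)" using slack by (simp add: algebra_simps)
      also have "\<dots> \<le> 2 * ?T" using T by simp
      finally show ?case by simp
    qed
  qed
qed

end

section \<open>Verification of the model and conclusion\<close>

lemma holder_imp_uniformly_continuous_on:
  fixes f :: "'a::real_normed_vector \<Rightarrow> real"
  assumes "\<gamma> > 0" "\<And>x y. x \<in> S \<Longrightarrow> y \<in> S \<Longrightarrow> \<bar>f x - f y\<bar> \<le> c * norm (x - y) powr \<gamma>"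
  shows "uniformly_continuous_on S f"
  unfolding uniformly_continuous_on_def
proof (intro allI impI)
  fix e :: real assume "e > 0"
  \<comment> \<open>The denominator \<open>\<bar>c\<bar> + 1\<close> covers zero and negative
    \<open>c\<close> and makes the final inequality strict.\<close>
  define \<delta> where "\<delta> = (e / (\<bar>c\<bar> + 1)) powr (1 / \<gamma>)"
  have \<delta>: "\<delta> > 0" "\<delta> powr \<gamma> = e / (\<bar>c\<bar> + 1)"
    using \<open>e > 0\<close> \<open>\<gamma> > 0\<close> by (auto simp: \<delta>_def powr_powr)
  have "dist (f y) (f x) < e" if "x \<in> S" "y \<in> S" "dist y x < \<delta>" for x y
  proof -
    have "\<bar>f y - f x\<bar> \<le> c * norm (y - x) powr \<gamma>" using assms(2) that by simp
    also have "\<dots> \<le> \<bar>c\<bar> * \<delta> powr \<gamma>"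
      using that \<open>\<gamma> > 0\<close> by (intro mult_mono powr_mono2) (auto simp: dist_norm)
    also have "\<dots> < (\<bar>c\<bar> + 1) * \<delta> powr \<gamma>" using \<delta>(1) by (intro mult_strict_right_mono) auto
    also have "\<dots> = e" unfolding \<delta>(2) by simp
    finally show ?thesis by (simp add: dist_real_def)
  qed
  then show "\<exists>d>0. \<forall>x\<in>S. \<forall>x'\<in>S. dist x' x < d \<longrightarrow> dist (f x') (f x) < e"
    using \<delta>(1) by blast
qed

text \<open>Undoes the conditioning on \<open>Y = i\<close>. A class of probability zero has no
  conditional law, but then both sides vanish.\<close>

lemma (in prob_space) nn_integral_class_density:
  fixes X :: "'a \<Rightarrow> real ^ 'd" and Y :: "'a \<Rightarrow> nat"
  assumes [measurable]: "X \<in> M \<rightarrow>\<^sub>M borel" "Y \<in> M \<rightarrow>\<^sub>M count_space UNIV"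
    and dens: "class_density M X Y i f" and \<phi> [measurable]: "\<phi> \<in> borel_measurable borel"
  shows "(\<integral>\<^sup>+\<omega>. \<phi> (X \<omega>) * indicator {i} (Y \<omega>) \<partial>M)
    = (\<integral>\<^sup>+x. \<phi> x * ennreal (prob {\<omega> \<in> space M. Y \<omega> = i} * f x) \<partial>lborel)"
proof -
  let ?E = "{\<omega> \<in> space M. Y \<omega> = i}"
  have [measurable]: "f \<in> borel_measurable borel" and f: "\<And>x. 0 \<le> f x"
    using dens by (auto simp: class_density_def)
  have E [measurable]: "?E \<in> sets M" by measurable
  have eq: "(\<integral>\<^sup>+\<omega>. \<phi> (X \<omega>) * indicator {i} (Y \<omega>) \<partial>M) = (\<integral>\<^sup>+\<omega>. \<phi> (X \<omega>) * indicator ?E \<omega> \<partial>M)"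
    by (intro nn_integral_cong) (auto simp: indicator_def)
  show ?thesis
  proof (cases "prob ?E = 0")
    case True
    then have "AE \<omega> in M. \<omega> \<notin> ?E" using E by (simp add: prob_eq_0)
    then have "(\<integral>\<^sup>+\<omega>. \<phi> (X \<omega>) * indicator ?E \<omega> \<partial>M) = (\<integral>\<^sup>+\<omega>. 0 \<partial>M)"
    proof (intro nn_integral_cong_AE)
      assume "AE \<omega> in M. \<omega> \<notin> ?E"
      then show "AE \<omega> in M. \<phi> (X \<omega>) * indicator ?E \<omega> = 0" by eventually_elim (auto simp: indicator_def)
    qed
    then show ?thesis by (simp add: eq True)
  next
    case False
    then have pos: "0 < prob ?E" by (simp add: zero_less_measure_iff)
    then have D: "distributed (uniform_measure M ?E) lborel X (\<lambda>x. ennreal (f x))"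
      using dens by (simp add: class_density_def)
    have "(\<integral>\<^sup>+x. ennreal (f x) * \<phi> x \<partial>lborel) = (\<integral>\<^sup>+\<omega>. \<phi> (X \<omega>) \<partial>uniform_measure M ?E)"
      by (rule distributed_nn_integral[OF D]) simp
    also have "\<dots> = (\<integral>\<^sup>+\<omega>. \<phi> (X \<omega>) * indicator ?E \<omega> \<partial>M) / ennreal (prob ?E)"
      by (simp add: nn_integral_uniform_measure emeasure_eq_measure)
    finally have "ennreal (prob ?E) * (\<integral>\<^sup>+x. ennreal (f x) * \<phi> x \<partial>lborel)
        = (\<integral>\<^sup>+\<omega>. \<phi> (X \<omega>) * indicator ?E \<omega> \<partial>M) * ennreal (prob ?E) / ennreal (prob ?E)"
      by (simp only: ennreal_times_divide mult.commute)
    also have "\<dots> = (\<integral>\<^sup>+\<omega>. \<phi> (X \<omega>) * indicator ?E \<omega> \<partial>M)"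
      by (rule mult_divide_eq_ennreal) (use pos in auto)
    also have "ennreal (prob ?E) * (\<integral>\<^sup>+x. ennreal (f x) * \<phi> x \<partial>lborel)
        = (\<integral>\<^sup>+x. ennreal (prob ?E) * (ennreal (f x) * \<phi> x) \<partial>lborel)"
      by (rule nn_integral_cmult[symmetric]) measurable
    also have "\<dots> = (\<integral>\<^sup>+x. \<phi> x * ennreal (prob ?E * f x) \<partial>lborel)"
      using f pos by (simp add: ennreal_mult' mult_ac)
    finally show ?thesis by (simp add: eq)
  qed
qed

theorem theorem4:
  fixes M :: "'w measure"
    and S :: "(real ^ 'd) set" and M0 :: real and Q :: nat
    and X :: "'w \<Rightarrow> real ^ 'd" and Y :: "'w \<Rightarrow> nat"
    and Xs :: "nat \<Rightarrow> 'w \<Rightarrow> real ^ 'd" and Ys :: "nat \<Rightarrow> 'w \<Rightarrow> nat"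
    and f :: "real ^ 'd \<Rightarrow> real"
    and \<eta> fc :: "nat \<Rightarrow> real ^ 'd \<Rightarrow> real"
    and fmin fmax :: real and fcmin fcmax c :: "nat \<Rightarrow> real" and \<gamma> :: real
    and h :: "nat \<Rightarrow> real"
    and F :: "nat \<Rightarrow> 'w \<Rightarrow> real ^ 'd \<Rightarrow> nat"
  assumes "prob_space M"
    and "S \<in> sets borel" and "S \<subseteq> cbox (\<chi> i. - M0) (\<chi> i. M0)"
    and "X \<in> M \<rightarrow>\<^sub>M borel" and "Y \<in> M \<rightarrow>\<^sub>M count_space UNIV"
    and "AE \<omega> in M. X \<omega> \<in> S \<and> Y \<omega> \<in> {1..Q}"
    and "iid_copies M (borel \<Otimes>\<^sub>M count_space UNIV) (\<lambda>\<omega>. (X \<omega>, Y \<omega>)) (\<lambda>l \<omega>. (Xs l \<omega>, Ys l \<omega>))"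
    and "\<And>x. 0 \<le> f x" and "distributed M lborel X (\<lambda>x. ennreal (f x))"
    and "\<And>i. i \<in> {1..Q} \<Longrightarrow> cond_prob_version M X Y i (\<eta> i)"
    and "\<And>i. i \<in> {1..Q} \<Longrightarrow> class_density M X Y i (fc i)"
    and A1: "0 < fmin" "\<And>x. x \<in> S \<Longrightarrow> fmin \<le> f x \<and> f x \<le> fmax"
    and C1: "\<And>i. i \<in> {1..Q} \<Longrightarrow> 0 < fcmin i"
      "\<And>i x. i \<in> {1..Q} \<Longrightarrow> x \<in> S \<Longrightarrow> fcmin i \<le> fc i x \<and> fc i x \<le> fcmax i"
    and C2: "0 < \<gamma>"
      "\<And>i x y. i \<in> {1..Q} \<Longrightarrow> x \<in> S \<Longrightarrow> y \<in> S \<Longrightarrow> \<bar>fc i x - fc i y\<bar> \<le> c i * norm (x - y) powr \<gamma>"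
    and B: "bandwidth_cond CARD('d) \<gamma> h"
    and "\<And>n \<omega>. 1 \<le> n \<Longrightarrow> \<omega> \<in> space M \<Longrightarrow>
      plugin_classifier Q (\<lambda>l. Xs l \<omega>) (\<lambda>l. Ys l \<omega>) n (h n) (F n \<omega>)"
  shows "\<exists>C. AE \<omega> in M. \<forall>\<^sub>F n in sequentially.
    misclassified_volume S Q \<eta> (F n \<omega>) \<le>
      2 / (real n)\<^sup>2 * (\<Sum>l=1..n. \<Sum>m=1..n.
        of_bool (Ys l \<omega> \<noteq> Ys m \<omega>) * V_kernel (\<lambda>k. Xs k \<omega>) n (h n) (Xs l \<omega>) (Xs m \<omega>))
      + C * h n powr \<gamma>"
proof -
  interpret prob_space M by fact
  note S = assms(2) and X [measurable] = assms(4) and Y [measurable] = assms(5) and data = assms(6)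
  have h: "\<And>n. n \<ge> 1 \<Longrightarrow> 0 < h n" using B by (simp add: bandwidth_cond_def)
  define \<pi> where "\<pi> i = prob {\<omega> \<in> space M. Y \<omega> = i}" for i
  \<comment> \<open>The cut-off outside \<open>S\<close> and outside the valid labels makes
    nonnegativity and the upper bound hold everywhere, as the model demands.\<close>
  define p where "p i x = (if i \<in> {1..Q} \<and> x \<in> S then \<pi> i * fc i x else 0)" for i x
  \<comment> \<open>On \<open>S\<close> the mixture is a convex combination of the class densities
    with weights \<open>\<pi> i\<close>, hence at least the smallest \<open>fcmin\<close>.\<close>
  define a where "a = Min (fcmin ` {1..Q})"
  define A where "A = (\<Sum>i=1..Q. \<bar>fcmax i\<bar>)"
  have \<pi>: "0 \<le> \<pi> i" "\<pi> i \<le> 1" for i by (auto simp: \<pi>_def)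
  have fc: "fc i \<in> borel_measurable borel" "\<And>x. 0 \<le> fc i x" if "i \<in> {1..Q}" for i
    using assms(11)[OF that] by (auto simp: class_density_def)
  have sum_\<pi>: "(\<Sum>i=1..Q. \<pi> i) = 1"
  proof -
    have "(\<Sum>i=1..Q. \<pi> i) = prob (\<Union>i\<in>{1..Q}. {\<omega> \<in> space M. Y \<omega> = i})"
      unfolding \<pi>_def
      by (rule finite_measure_finite_Union[symmetric]) (auto simp: disjoint_family_on_def)
    also have "\<dots> = 1"
    proof (rule prob_eq_1[THEN iffD2])
      show "AE \<omega> in M. \<omega> \<in> (\<Union>i\<in>{1..Q}. {\<omega> \<in> space M. Y \<omega> = i})"
        using data AE_space by eventually_elim auto
    qed auto
    finally show ?thesis .
  qed
  have Q: "{1..Q} \<noteq> {}"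
  proof
    assume "{1..Q} = {}"
    then show False using sum_\<pi> by (simp only: sum.empty)
  qed
  have a: "0 < a" unfolding a_def using Q C1(1) by (subst Min_gr_iff) auto
  interpret plugin_model M X Y S Q p a A
  proof
    show "bounded S" using assms(3) bounded_cbox bounded_subset by blast
    show "p i \<in> borel_measurable borel" for i
    proof (cases "i \<in> {1..Q}")
      case True
      note [measurable] = fc(1)[OF True] S
      have "p i = (\<lambda>x. if x \<in> S then \<pi> i * fc i x else 0)" using True by (auto simp: p_def)
      also have "\<dots> \<in> borel_measurable borel" by measurable
      finally show ?thesis .
    next
      case False
      then have "p i = (\<lambda>_. 0)" by (auto simp: p_def)
      then show ?thesis by simp
    qed
    show "0 \<le> p i x" for i x using fc(2)[of i x] \<pi>(1)[of i] by (simp add: p_def)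
    show "p i x \<le> A" for i x
    proof (cases "i \<in> {1..Q} \<and> x \<in> S")
      case True
      then have "\<pi> i * fc i x \<le> 1 * \<bar>fcmax i\<bar>"
        using C1(2)[of i x] \<pi>[of i] fc(2)[of i x] by (intro mult_mono) auto
      also have "\<dots> \<le> A" unfolding A_def mult_1 using True by (intro member_le_sum) auto
      finally show ?thesis using True by (simp add: p_def)
    next
      case False
      then have "p i x = 0" unfolding p_def by (rule if_not_P)
      then show ?thesis by (simp add: A_def sum_nonneg)
    qed
    show "uniformly_continuous_on S (p i)" for i
    proof (cases "i \<in> {1..Q}")
      case True
      show ?thesis
      proof (rule holder_imp_uniformly_continuous_on[OF C2(1)])
        fix x y assume "x \<in> S" "y \<in> S"
        then have "\<bar>p i x - p i y\<bar> = \<pi> i * \<bar>fc i x - fc i y\<bar>"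
          using True \<pi>(1)[of i] by (simp add: p_def abs_mult flip: right_diff_distrib)
        also have "\<dots> \<le> \<pi> i * (c i * norm (x - y) powr \<gamma>)"
          using C2(2)[OF True \<open>x \<in> S\<close> \<open>y \<in> S\<close>] \<pi>(1) by (rule mult_left_mono)
        finally show "\<bar>p i x - p i y\<bar> \<le> (\<pi> i * c i) * norm (x - y) powr \<gamma>" by (simp add: mult.assoc)
      qed
    next
      case False
      then have "p i = (\<lambda>_. 0)" by (auto simp: p_def)
      then show ?thesis by (simp add: uniformly_continuous_on_const)
    qed
    show "a \<le> (\<Sum>i=1..Q. p i x)" if x: "x \<in> S" for x
    proof -
      have "a = (\<Sum>i=1..Q. \<pi> i * a)" by (simp only: sum_distrib_right[symmetric] sum_\<pi> mult_1)
      also have "\<dots> \<le> (\<Sum>i=1..Q. p i x)"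
      proof (rule sum_mono)
        fix i assume i: "i \<in> {1..Q}"
        then have "a \<le> fcmin i" by (simp add: a_def)
        then have "a \<le> fc i x" using C1(2)[OF i x] by simp
        then show "\<pi> i * a \<le> p i x" using i x \<pi>(1)[of i] by (simp add: p_def mult_left_mono)
      qed
      finally show ?thesis .
    qed
    show "(\<integral>\<^sup>+\<omega>. \<phi> (X \<omega>) * indicator {i} (Y \<omega>) \<partial>M) = (\<integral>\<^sup>+x. \<phi> x * ennreal (p i x) \<partial>lborel)"
      if i: "i \<in> {1..Q}" and [measurable]: "\<phi> \<in> borel_measurable borel" for i \<phi>
    proof -
      note [measurable] = S
      \<comment> \<open>\<open>X\<close> lies in \<open>S\<close> almost surely, so the indicator of
        \<open>S\<close> can be inserted; it turns the class density into its cut-off version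
        \<open>p i\<close>.\<close>
      have "(\<integral>\<^sup>+\<omega>. \<phi> (X \<omega>) * indicator {i} (Y \<omega>) \<partial>M)
          = (\<integral>\<^sup>+\<omega>. (\<phi> (X \<omega>) * indicator S (X \<omega>)) * indicator {i} (Y \<omega>) \<partial>M)"
        by (rule nn_integral_cong_AE) (use data in \<open>eventually_elim, simp\<close>)
      also have "\<dots> = (\<integral>\<^sup>+x. (\<phi> x * indicator S x) * ennreal (\<pi> i * fc i x) \<partial>lborel)"
        unfolding \<pi>_def
        by (rule nn_integral_class_density[OF X Y assms(11)[OF i], where \<phi> = "\<lambda>x. \<phi> x * indicator S x"]) measurable
      also have "\<dots> = (\<integral>\<^sup>+x. \<phi> x * ennreal (p i x) \<partial>lborel)"
        by (intro nn_integral_cong) (use i in \<open>auto simp: p_def indicator_def\<close>)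
      finally show ?thesis .
    qed
  qed (use assms a in \<open>auto simp: p_def\<close>)
  note posterior = AE_eq_posterior[OF _ assms(10)]
  have \<eta>: "\<eta> i \<in> borel_measurable borel" if "i \<in> {1..Q}" for i
    using assms(10)[OF that] by (simp add: cond_prob_version_def)
  \<comment> \<open>In the single-class case the volume is zero and the claim reduces to this
    sign.\<close>
  have V_nonneg: "0 \<le> 2 / (real n)\<^sup>2 * (\<Sum>l=1..n. \<Sum>m=1..n.
      of_bool (Ys l \<omega> \<noteq> Ys m \<omega>) * V_kernel (\<lambda>k. Xs k \<omega>) n (h n) (Xs l \<omega>) (Xs m \<omega>))"
    if n: "n \<ge> 1" for n \<omega>
    unfolding V_kernel_def
    by (intro mult_nonneg_nonneg sum_nonneg divide_nonneg_pos mult_pos_pos kde_pos scaled_kernel_nonneg h n)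
       (use n in auto)
  have "AE \<omega> in M. \<forall>\<^sub>F n in sequentially. misclassified_volume S Q \<eta> (F n \<omega>) \<le>
      2 / (real n)\<^sup>2 * (\<Sum>l=1..n. \<Sum>m=1..n.
        of_bool (Ys l \<omega> \<noteq> Ys m \<omega>) * V_kernel (\<lambda>k. Xs k \<omega>) n (h n) (Xs l \<omega>) (Xs m \<omega>))"
  proof (cases "\<exists>i\<in>{1..Q}. \<exists>j\<in>{1..Q}. i \<noteq> j \<and> 0 < \<pi> i \<and> 0 < \<pi> j")
    case True
    then obtain i j where ij: "i \<in> {1..Q}" "j \<in> {1..Q}" "i \<noteq> j" "0 < \<pi> i" "0 < \<pi> j" by blast
    have "0 < p k x" if "k \<in> {1..Q}" "0 < \<pi> k" "x \<in> S" for k x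
      using C1(1)[OF that(1)] C1(2)[OF that(1,3)] that by (simp add: p_def)
    then have "0 < impurity" using ij by (intro impurity_pos[OF ij(1-3)]) auto
    then show ?thesis
      by (rule AE_misclassified_volume_le_of_impurity_pos[OF assms(7) B C2(1) _ \<eta> posterior assms(19)])
  next
    case False
    \<comment> \<open>The weights sum to 1, so one of them is positive; by the case assumption it is
      the only one.\<close>
    have "\<exists>k\<in>{1..Q}. 0 < \<pi> k"
      using sum_\<pi> sum_nonpos[of "{1..Q}" \<pi>] by (metis not_less not_one_le_zero)
    then obtain k where k: "k \<in> {1..Q}" "0 < \<pi> k" by blast
    have zero: "p i x = 0" if "i \<noteq> k" for i x
    proof (cases "i \<in> {1..Q}")
      case True
      then have "\<not> 0 < \<pi> i" using False k that by blast
      then have "\<pi> i = 0" using \<pi>(1)[of i] by simp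
      then show ?thesis by (simp add: p_def)
    qed (auto simp: p_def)
    have "AE \<omega> in M. \<forall>\<^sub>F n in sequentially. misclassified_volume S Q \<eta> (F n \<omega>) = 0"
      by (rule AE_misclassified_volume_eq_0_of_single_class[OF assms(7) h k(1) zero \<eta> posterior assms(19)])
    then show ?thesis
    proof eventually_elim
      case (elim \<omega>)
      then show ?case using eventually_ge_at_top[of 1]
      proof eventually_elim
        case (elim n)
        then show ?case using V_nonneg[OF elim(2)] by (simp only:)
      qed
    qed
  qed
  then show ?thesis by (intro exI[of _ 0]) simp
qed

end
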